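(* Let $\alpha_1,\alpha_2$ be nonzero real numbers such that $|\alpha_1|\neq|\alpha_2|$ and let $\theta\in\mathbb{R}\setminus\frac{\pi}{2}\mathbb{Z}$. Let $(A_1,A_2)\in \mathrm{GL}_4(\mathbb{R})^2$ where $$A_1=\begin{pmatrix}\alpha_1&0\\0&\alpha_2\end{pmatrix}\otimes\begin{pmatrix}\cos\theta&-\sin\theta\\ \sin\theta&\cos\theta\end{pmatrix}=\begin{pmatrix}\alpha_1\cos\theta&-\alpha_1\sin\theta&0&0\\ \alpha_1\sin\theta&\alpha_1\cos\theta&0&0\\ 0&0&\alpha_2\cos\theta&-\alpha_2\sin\theta\\ 0&0&\alpha_2\sin\theta&\alpha_2\cos\theta\end{pmatrix}$$ and $$A_2=\begin{pmatrix}\cos\theta&-\sin\theta\\ \sin\theta&\cos\theta\end{pmatrix}\otimes\begin{pmatrix}\alpha_1&0\\0&\alpha_2\end{pmatrix}=\begin{pmatrix}\alpha_1\cos\theta&0&-\alpha_1\sin\theta&0\\ 0&\alpha_2\cos\theta&0&-\alpha_2\sin\theta\\ \alpha_1\sin\theta&0&\alpha_1\cos\theta&0\\ 0&\alpha_2\sin\theta&0&\alpha_2\cos\theta\end{pmatrix}.$$ Then $(A_1,A_2)$ is strongly irreducible, and for every $s\in(1,3)$ there exist exactly two distinct ergodic $\varphi^s$-equilibrium states for $(A_1,A_2)$. These equilibrium states are both fully supported on $\Sigma_2$.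
   Context: Kronecker product: for matrices $A=[a_{ij}]$ and $B$, $A\otimes B$ is the block matrix whose $(i,j)$ block is $a_{ij}B$. Strong irreducibility: a tuple $(A_1,\ldots,A_N)\in\mathrm{GL}_d(\mathbb{R})^N$ is strongly irreducible if there does not exist a nonempty finite collection $V_1,\ldots,V_m$ of nonzero proper subspaces of $\mathbb{R}^d$ such that $A_i\left(\bigcup_{j=1}^m V_j\right)=\bigcup_{j=1}^m V_j$ for every $i$. Singular value function: for $A\in\mathrm{GL}_d(\mathbb{R})$ let $\sigma_1(A)\geq\cdots\geq\sigma_d(A)$ be its singular values. For $s\geq0$ put $\varphi^s(A):=\sigma_1(A)\cdots\sigma_{\lfloor s\rfloor}(A)\,\sigma_{\lceil s\rceil}(A)^{s-\lfloor s\rfloor}$ if $0\leq s\leq d$ (the last factor being $1$ when $s$ is an integer), and $\varphi^s(A):=|\det A|^{s/d}$ if $s\geq d$. This satisfies $\varphi^s(AB)\leq\varphi^s(A)\varphi^s(B)$. Symbolic space: $\Sigma_N:=\{1,\ldots,N\}^{\mathbb{N}}$ with the infinite product topology; the shift is $\sigma[(x_k)_{k=1}^\infty]:=(x_{k+1})_{k=1}^\infty$. A measure is ergodic if it is ergodic with respect to $\sigma$, and fully supported if every nonempty open set has positive measure. Pressure: $P_{\varphi^s}(A_1,\ldots,A_N):=\lim_{n\to\infty}\frac1n\log\sum_{i_1,\ldots,i_n=1}^N\varphi^s(A_{i_1}\cdots A_{i_n})$. Equilibrium state: a $\sigma$-invariant Borel probability measure $\mu$ on $\Sigma_N$ is a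 $\varphi^s$-equilibrium state for $(A_1,\ldots,A_N)$ if $$P_{\varphi^s}(A_1,\ldots,A_N)=h(\mu)+\lim_{n\to\infty}\frac1n\int\log\varphi^s(A_{x_1}\cdots A_{x_n})\,d\mu[(x_k)_{k=1}^\infty],$$ where $h(\mu)$ is the (Kolmogorov–Sinai) entropy of $\mu$ with respect to $\sigma$. Here $N=2$ and $d=4$. *)

theory Defs
  imports
    "HOL-Analysis.Analysis"
    "HOL-Computational_Algebra.Polynomial"
    "HOL-Library.Multiset"
    "HOL-Library.Disjoint_Sets"
    "HOL-Probability.Probability_Measure"
begin

section \<open>Kronecker products\<close>

definition kronecker ::
    "real ^ 'n ^ 'm \<Rightarrow> real ^ 'q ^ 'p \<Rightarrow> real ^ ('n \<times> 'q) ^ ('m \<times> 'p)"  (infixl "\<otimes>\<^sub>K" 70) where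
  "A \<otimes>\<^sub>K B = (\<chi> r c. A $ fst r $ fst c * B $ snd r $ snd c)"

text \<open>
  Index \<open>(i, p)\<close> of a Kronecker product is row (or column) \<open>p\<close> inside block \<open>i\<close>, so the usual
  block form lists the pairs lexicographically. Note that \<open>4 = 0\<close> in the type \<open>4\<close>, and \<open>2 = 0\<close> in
  the type \<open>2\<close>; the literals used are those used by \<^const>\<open>vector\<close>.
\<close>

definition block_index :: "4 \<Rightarrow> 2 \<times> 2" where
  "block_index i = (if i = 1 then (1, 1) else if i = 2 then (1, 2) else if i = 3 then (2, 1) else (2, 2))"

definition block_matrix :: "real ^ (2 \<times> 2) ^ (2 \<times> 2) \<Rightarrow> real ^ 4 ^ 4" where
  "block_matrix K = (\<chi> i j. K $ block_index i $ block_index j)"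

definition diag2 :: "real \<Rightarrow> real \<Rightarrow> real ^ 2 ^ 2" where
  "diag2 a b = vector [vector [a, 0], vector [0, b]]"

definition rotation2 :: "real \<Rightarrow> real ^ 2 ^ 2" where
  "rotation2 \<theta> = vector [vector [cos \<theta>, - sin \<theta>], vector [sin \<theta>, cos \<theta>]]"

lemma vector_4_nth:
  "(vector [a, b, c, d] :: 'a::zero ^ 4) $ 1 = a"
  "(vector [a, b, c, d] :: 'a::zero ^ 4) $ 2 = b"
  "(vector [a, b, c, d] :: 'a::zero ^ 4) $ 3 = c"
  "(vector [a, b, c, d] :: 'a::zero ^ 4) $ 4 = d"
  unfolding vector_def by (auto simp: eval_nat_numeral)

lemma diag2_kronecker_rotation2:
  "block_matrix (diag2 a b \<otimes>\<^sub>K rotation2 \<theta>) = vector [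
     vector [a * cos \<theta>, - a * sin \<theta>, 0, 0],
     vector [a * sin \<theta>, a * cos \<theta>, 0, 0],
     vector [0, 0, b * cos \<theta>, - b * sin \<theta>],
     vector [0, 0, b * sin \<theta>, b * cos \<theta>]]"
  by (simp add: vec_eq_iff forall_4 block_matrix_def block_index_def kronecker_def
      diag2_def rotation2_def vector_4_nth)

lemma rotation2_kronecker_diag2:
  "block_matrix (rotation2 \<theta> \<otimes>\<^sub>K diag2 a b) = vector [
     vector [a * cos \<theta>, 0, - a * sin \<theta>, 0],
     vector [0, b * cos \<theta>, 0, - b * sin \<theta>],
     vector [a * sin \<theta>, 0, a * cos \<theta>, 0],
     vector [0, b * sin \<theta>, 0, b * cos \<theta>]]"
  by (simp add: vec_eq_iff forall_4 block_matrix_def block_index_def kronecker_def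
      diag2_def rotation2_def vector_4_nth)

section \<open>Strong irreducibility\<close>

text \<open>Here and below, a tuple \<open>(A\<^sub>1, \<dots>, A\<^sub>N)\<close> is a function on \<^typ>\<open>nat\<close> of which only the
  values at \<open>1, \<dots>, N\<close> matter.\<close>

definition strongly_irreducible :: "nat \<Rightarrow> (nat \<Rightarrow> real ^ 'd ^ 'd) \<Rightarrow> bool" where
  "strongly_irreducible N A \<longleftrightarrow>
     (\<forall>i\<in>{1..N}. invertible (A i)) \<and>
     \<not> (\<exists>\<V>. finite \<V> \<and> \<V> \<noteq> {} \<and>
           (\<forall>V\<in>\<V>. subspace V \<and> V \<noteq> {0} \<and> V \<noteq> UNIV) \<and>
           (\<forall>i\<in>{1..N}. (\<lambda>v. A i *v v) ` \<Union>\<V> = \<Union>\<V>))"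

section \<open>Singular values\<close>

definition charpoly :: "real ^ 'd ^ 'd \<Rightarrow> real poly" where
  "charpoly A = det (mat [:0, 1:] - (\<chi> i j. [:A $ i $ j:]))"

text \<open>The singular values are the square roots of the eigenvalues of \<open>A\<^sup>T A\<close>, in nonincreasing
  order and repeated according to multiplicity. The characteristic polynomial of \<open>A\<^sup>T A\<close>
  splits over the reals, so the list has length \<^term>\<open>CARD('d)\<close>.\<close>

definition singular_values :: "real ^ 'd ^ 'd \<Rightarrow> real list" where
  "singular_values A =
     map sqrt (rev (sorted_list_of_multiset (proots (charpoly (transpose A ** A)))))"

definition singular_value :: "nat \<Rightarrow> real ^ 'd ^ 'd \<Rightarrow> real" where
  "singular_value k A = singular_values A ! (k - 1)"

text \<open>Only meaningful for \<open>s \<ge> 0\<close> and invertible \<open>A\<close>.\<close>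

definition sv_function :: "real \<Rightarrow> real ^ 'd ^ 'd \<Rightarrow> real" where
  "sv_function s A =
     (if s \<le> real CARD('d)
      then (\<Prod>k = 1..nat \<lfloor>s\<rfloor>. singular_value k A) *
           (if s \<in> \<int> then 1 else singular_value (nat \<lceil>s\<rceil>) A powr (s - of_int \<lfloor>s\<rfloor>))
      else \<bar>det A\<bar> powr (s / real CARD('d)))"

section \<open>The full shift\<close>

text \<open>The alphabet is \<open>{1..N}\<close>, but positions in a sequence are numbered from \<open>0\<close>. The type
  \<^typ>\<open>nat \<Rightarrow> nat\<close> carries the product topology of the discrete topology on \<^typ>\<open>nat\<close>.\<close>

definition shift_space :: "nat \<Rightarrow> (nat \<Rightarrow> nat) set" where
  "shift_space N = {x. \<forall>k. x k \<in> {1..N}}"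

definition shift :: "(nat \<Rightarrow> 'a) \<Rightarrow> nat \<Rightarrow> 'a" where
  "shift x = (\<lambda>k. x (Suc k))"

definition invariant_measure :: "nat \<Rightarrow> (nat \<Rightarrow> nat) measure \<Rightarrow> bool" where
  "invariant_measure N \<mu> \<longleftrightarrow>
     sets \<mu> = sets (restrict_space borel (shift_space N)) \<and> prob_space \<mu> \<and>
     (\<forall>B\<in>sets \<mu>. emeasure \<mu> (shift -` B \<inter> space \<mu>) = emeasure \<mu> B)"

definition ergodic_measure :: "nat \<Rightarrow> (nat \<Rightarrow> nat) measure \<Rightarrow> bool" where
  "ergodic_measure N \<mu> \<longleftrightarrow>
     invariant_measure N \<mu> \<and>
     (\<forall>B\<in>sets \<mu>. shift -` B \<inter> space \<mu> = B \<longrightarrow> emeasure \<mu> B = 0 \<or> emeasure \<mu> B = 1)"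

definition fully_supported :: "nat \<Rightarrow> (nat \<Rightarrow> nat) measure \<Rightarrow> bool" where
  "fully_supported N \<mu> \<longleftrightarrow>
     (\<forall>U. openin (top_of_set (shift_space N)) U \<and> U \<noteq> {} \<longrightarrow> emeasure \<mu> U > 0)"

section \<open>Kolmogorov--Sinai entropy\<close>

text \<open>The convention \<open>0 log 0 = 0\<close> is automatic.\<close>

definition partition_entropy :: "'a measure \<Rightarrow> 'a set set \<Rightarrow> real" where
  "partition_entropy M P = - (\<Sum>B\<in>P. measure M B * ln (measure M B))"

definition iterated_join :: "'a measure \<Rightarrow> ('a \<Rightarrow> 'a) \<Rightarrow> 'a set set \<Rightarrow> nat \<Rightarrow> 'a set set" where
  "iterated_join M T P n =
     common_refinement ((\<lambda>i. (\<lambda>B. (T ^^ i) -` B \<inter> space M) ` P) ` {..<n})"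

definition entropy_wrt_partition :: "'a measure \<Rightarrow> ('a \<Rightarrow> 'a) \<Rightarrow> 'a set set \<Rightarrow> real" where
  "entropy_wrt_partition M T P = lim (\<lambda>n. partition_entropy M (iterated_join M T P n) / real n)"

definition ks_entropy :: "'a measure \<Rightarrow> ('a \<Rightarrow> 'a) \<Rightarrow> ereal" where
  "ks_entropy M T =
     (SUP P\<in>{P. finite P \<and> P \<subseteq> sets M \<and> partition_on (space M) P}.
        ereal (entropy_wrt_partition M T P))"

section \<open>Pressure and equilibrium states\<close>

primrec word_product :: "(nat \<Rightarrow> real ^ 'd ^ 'd) \<Rightarrow> (nat \<Rightarrow> nat) \<Rightarrow> nat \<Rightarrow> real ^ 'd ^ 'd" where
  "word_product A x 0 = mat 1"
| "word_product A x (Suc n) = word_product A x n ** A (x n)"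

text \<open>For invertible matrices and invariant measures the limits below exist by
  subadditivity, so \<^const>\<open>lim\<close> is well defined.\<close>

definition pressure :: "real \<Rightarrow> nat \<Rightarrow> (nat \<Rightarrow> real ^ 'd ^ 'd) \<Rightarrow> real" where
  "pressure s N A =
     lim (\<lambda>n. ln (\<Sum>w\<in>{..<n} \<rightarrow>\<^sub>E {1..N}. sv_function s (word_product A w n)) / real n)"

definition sv_energy :: "real \<Rightarrow> (nat \<Rightarrow> real ^ 'd ^ 'd) \<Rightarrow> (nat \<Rightarrow> nat) measure \<Rightarrow> real" where
  "sv_energy s A \<mu> = lim (\<lambda>n. (\<integral>x. ln (sv_function s (word_product A x n)) \<partial>\<mu>) / real n)"

definition equilibrium_state ::
    "real \<Rightarrow> nat \<Rightarrow> (nat \<Rightarrow> real ^ 'd ^ 'd) \<Rightarrow> (nat \<Rightarrow> nat) measure \<Rightarrow> bool" where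
  "equilibrium_state s N A \<mu> \<longleftrightarrow>
     invariant_measure N \<mu> \<and>
     ereal (pressure s N A) = ks_entropy \<mu> shift + ereal (sv_energy s A \<mu>)"

end

theory Submission
  imports Defs "HOL-Complex_Analysis.Great_Picard"
begin

text \<open>
  For \<open>1 < s < 3\<close> the function \<open>\<phi>\<^sup>s\<close> of a Kronecker product \<open>X \<otimes> Y\<close> of \<open>2 \<times> 2\<close> matrices is the
  maximum of two potentials that are exchanged when \<open>X\<close> and \<open>Y\<close> are. Strong irreducibility
  makes each potential quasi-multiplicative along words, so each has a unique ergodic Gibbs measure,
  and this measure is fully supported. Exchanging the two letters exchanges the potentials, so the two have
  the same pressure, which is then also the pressure of the maximum. An equilibrium state of the
  maximum is absolutely continuous with respect to the sum of the two Gibbs measures, so if it is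
  ergodic it is one of them. They differ because the quotient of the potentials is unbounded along
  the words \<open>1\<^sup>n\<close>.
\<close>

section \<open>Subadditive sequences\<close>

text \<open>The maximum of the two potentials is submultiplicative but cannot be
  quasi-multiplicative, since a quasi-multiplicative potential has only one ergodic equilibrium
  state; hence the detour through the sum of two Gibbs measures, which bounds the maximum from above
  up to a constant and \<open>exp (n P)\<close>. Each potential involves the norms of both Kronecker
  factors, so one connecting word has to serve both factors at once. It comes from the Frobenius
  norm, which is multiplicative on Kronecker products: a word that keeps the norm of the whole
  product large keeps both factors large, because neither can exceed its submultiplicative bound.
  The quotient of the potentials is a power of \<open>(|X|^2 |det Y|) / (|Y|^2 |det X|)\<close> with
  exponent \<open>1 - |s - 2|\<close>, which is positive exactly for \<open>1 < s < 3\<close>.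
  Entropy is a supremum over all finite measurable partitions and has to be reduced to words before
  it can be compared with sums over words. Singularity of distinct ergodic measures is obtained from
  a Hahn decomposition.\<close>

lemma fekete:
  fixes a :: "nat \<Rightarrow> real"
  assumes sub: "\<And>m n. a (m + n) \<le> a m + a n" and low: "\<And>n. - K * real n \<le> a n"
  obtains L where "(\<lambda>n. a n / real n) \<longlonglongrightarrow> L" and "\<And>n. real n * L \<le> a n"
proof -
  define L where "L = (INF n\<in>{1..}. a n / real n)"
  have bdd: "bdd_below ((\<lambda>n. a n / real n) ` {1..})"
  proof (rule bdd_belowI2)
    fix n :: nat assume "n \<in> {1..}"
    then show "- K \<le> a n / real n" using low[of n] by (simp add: field_simps)
  qed
  have a0: "0 \<le> a 0" using sub[of 0 0] by simp
  have L_le: "L \<le> a n / real n" if "n \<ge> 1" for n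
    unfolding L_def using bdd that by (intro cINF_lower) auto
  have mult: "a (q * m) \<le> a 0 + real q * a m" for q m
  proof (induction q)
    case (Suc q)
    then show ?case using sub[of m "q * m"] by (simp add: algebra_simps)
  qed simp
  have lim: "(\<lambda>n. a n / real n) \<longlonglongrightarrow> L"
  proof (rule LIMSEQ_I)
    fix e :: real assume e: "0 < e"
    have "\<exists>n\<in>{1..}. a n / real n < L + e / 2"
      using cINF_less_iff[of "{1..}" "\<lambda>n. a n / real n" "L + e / 2"] bdd e
      unfolding L_def by auto
    then obtain m where m: "m \<ge> 1" "a m / real m < L + e / 2" by auto
    \<comment> \<open>\<open>C\<close> collects what does not grow with \<open>n\<close> when
      \<open>n = q * m + r\<close>: the value \<open>a 0\<close>, the part of \<open>a m\<close>
      lost to the remainder, and \<open>a r\<close> for every possible remainder.\<close>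
    define C where "C = a 0 + \<bar>a m\<bar> + (\<Sum>r<m. \<bar>a r\<bar>)"
    have C0: "C \<ge> 0" unfolding C_def using a0 by (simp add: sum_nonneg)
    have bound: "a n / real n \<le> a m / real m + C / real n" if n: "n \<ge> 1" for n
    proof -
      define q r where "q = n div m" and "r = n mod m"
      have nqr: "n = q * m + r" and r: "r < m" using m by (auto simp: q_def r_def)
      have "a r \<le> (\<Sum>r<m. \<bar>a r\<bar>)"
        using member_le_sum[of r "{..<m}" "\<lambda>r. \<bar>a r\<bar>"] r by fastforce
      then have "a n \<le> a 0 + real q * a m + (\<Sum>r<m. \<bar>a r\<bar>)"
        using sub[of "q * m" r] mult[of q m] nqr by simp
      also have "real q * a m = real n * (a m / real m) - real r / real m * a m"
        using nqr m by (simp add: field_simps)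
      also have "- (real r / real m * a m) \<le> \<bar>a m\<bar>"
      proof -
        have "\<bar>real r / real m * a m\<bar> \<le> 1 * \<bar>a m\<bar>"
          unfolding abs_mult using r by (intro mult_right_mono) auto
        then show ?thesis by linarith
      qed
      ultimately have "a n \<le> real n * (a m / real m) + C" by (simp add: C_def)
      then show ?thesis using n by (simp add: field_simps)
    qed
    obtain N0 :: nat where N0: "C / (e / 2) < real N0" using reals_Archimedean2 by blast
    show "\<exists>no. \<forall>n\<ge>no. norm (a n / real n - L) < e"
    proof (intro exI allI impI)
      fix n assume n: "Suc N0 \<le> n"
      then have "C / real n < e / 2"
        using N0 e C0 by (simp add: field_simps) (smt (verit) mult_left_mono of_nat_mono of_nat_Suc)
      then show "norm (a n / real n - L) < e"
        using bound[of n] L_le[of n] n m(2) unfolding real_norm_def abs_less_iff by linarith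
    qed
  qed
  moreover have "real n * L \<le> a n" for n
    using L_le[of n] a0 by (cases "n = 0") (auto simp: field_simps)
  ultimately show thesis by (rule that)
qed

section \<open>Entropy of simple functions\<close>

definition fibres :: "'a measure \<Rightarrow> ('a \<Rightarrow> 'b) \<Rightarrow> 'a set set" where
  "fibres M X = (\<lambda>a. X -` {X a} \<inter> space M) ` space M"

text \<open>Shannon entropy of a partition given by a labelling function instead of a set of blocks.
  A join of partitions becomes a tuple of functions, and conditional entropy a difference of
  entropies of tuples.\<close>

definition ent :: "'a measure \<Rightarrow> ('a \<Rightarrow> 'b) \<Rightarrow> real" where
  "ent M X = - (\<Sum>v\<in>X ` space M. measure M (X -` {v} \<inter> space M) * ln (measure M (X -` {v} \<inter> space M)))"

lemma partition_entropy_fibres: "partition_entropy M (fibres M X) = ent M X"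
proof -
  have "fibres M X = (\<lambda>v. X -` {v} \<inter> space M) ` X ` space M"
    unfolding fibres_def by auto
  moreover have "inj_on (\<lambda>v. X -` {v} \<inter> space M) (X ` space M)"
    by (rule inj_onI) auto
  ultimately show ?thesis
    unfolding partition_entropy_def ent_def by (simp add: sum.reindex)
qed

text \<open>Only the relation of having equal labels matters. This allows tuples to be regrouped,
  and coordinates that are functions of others to be added or dropped.\<close>

lemma ent_cong_fibres:
  assumes "\<And>a b. a \<in> space M \<Longrightarrow> b \<in> space M \<Longrightarrow> X a = X b \<longleftrightarrow> Y a = Y b"
  shows "ent M X = ent M Y"
proof -
  have "fibres M X = fibres M Y"
    unfolding fibres_def using assms by (intro image_cong) auto
  then show ?thesis by (metis partition_entropy_fibres)
qed

lemma ent_superset: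
  assumes "finite V" "X ` space M \<subseteq> V"
  shows "ent M X = - (\<Sum>v\<in>V. measure M (X -` {v} \<inter> space M) * ln (measure M (X -` {v} \<inter> space M)))"
  unfolding ent_def
proof (subst sum.mono_neutral_left[OF assms])
  have "X -` {v} \<inter> space M = {}" if "v \<in> V - X ` space M" for v using that by auto
  then show "\<forall>i\<in>V - X ` space M. measure M (X -` {i} \<inter> space M) * ln (measure M (X -` {i} \<inter> space M)) = 0"
    by simp
qed simp

text \<open>Nonnegativity of conditional mutual information, H(X,Y,Z) + H(Z) \<le> H(X,Z) + H(Y,Z);
  the sums are negatives of entropies, which reverses the sides. The reason is
  \<open>ln r \<le> r - 1\<close> for the quotient \<open>r\<close> of the conditionally independent
  weight by the actual one.\<close>

lemma ssa_sums:
  fixes p :: "'x \<Rightarrow> 'y \<Rightarrow> 'z \<Rightarrow> real"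
  assumes fin: "finite A" "finite B" "finite C" and p0: "\<And>x y z. p x y z \<ge> 0"
  defines "pxz \<equiv> \<lambda>x z. \<Sum>y\<in>B. p x y z" and "pyz \<equiv> \<lambda>y z. \<Sum>x\<in>A. p x y z"
    and "pz \<equiv> \<lambda>z. \<Sum>x\<in>A. \<Sum>y\<in>B. p x y z"
  shows "(\<Sum>x\<in>A. \<Sum>z\<in>C. pxz x z * ln (pxz x z)) + (\<Sum>y\<in>B. \<Sum>z\<in>C. pyz y z * ln (pyz y z))
    \<le> (\<Sum>x\<in>A. \<Sum>y\<in>B. \<Sum>z\<in>C. p x y z * ln (p x y z)) + (\<Sum>z\<in>C. pz z * ln (pz z))"
proof -
  have pyz_sum: "(\<Sum>y\<in>B. pyz y z) = pz z" and pxz_sum: "(\<Sum>x\<in>A. pxz x z) = pz z" for z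
    unfolding pyz_def pz_def pxz_def by (simp_all add: sum.swap[of _ A B])
  have nn: "pxz x z \<ge> 0" "pyz y z \<ge> 0" "pz z \<ge> 0" for x y z
    unfolding pxz_def pyz_def pz_def by (auto intro!: sum_nonneg p0)
  have termwise: "p x y z - pxz x z * pyz y z / pz z
      \<le> p x y z * (ln (p x y z) + ln (pz z) - ln (pxz x z) - ln (pyz y z))"
    if "x \<in> A" "y \<in> B" for x y z
  proof (cases "p x y z = 0")
    case False
    then have pos: "p x y z > 0" using p0[of x y z] by simp
    have 1: "p x y z \<le> pxz x z" "p x y z \<le> pyz y z"
      unfolding pxz_def pyz_def using that fin p0
      by (auto intro: member_le_sum[of y B "\<lambda>y. p x y z"] member_le_sum[of x A "\<lambda>x. p x y z"])
    have 2: "pxz x z \<le> pz z"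
      unfolding pxz_sum[symmetric] using that fin nn by (intro member_le_sum) auto
    have pos': "pxz x z > 0" "pyz y z > 0" "pz z > 0" using 1 2 pos by linarith+
    define r where "r = pxz x z * pyz y z / (p x y z * pz z)"
    have r: "r > 0" unfolding r_def using pos pos' by simp
    have "ln r = ln (pxz x z) + ln (pyz y z) - ln (p x y z) - ln (pz z)"
      unfolding r_def using pos pos' by (simp add: ln_div ln_mult)
    moreover have "ln r \<le> r - 1" using r by (rule ln_le_minus_one)
    ultimately have "p x y z * (1 - r) \<le> p x y z * (ln (p x y z) + ln (pz z) - ln (pxz x z) - ln (pyz y z))"
      using pos by (intro mult_left_mono) auto
    moreover have "p x y z * (1 - r) = p x y z - pxz x z * pyz y z / pz z"
      unfolding r_def using pos pos' by (simp add: field_simps)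
    ultimately show ?thesis by simp
  qed (simp add: nn)
  \<comment> \<open>Summed over \<open>x\<close> and \<open>y\<close>, both terms give
    \<open>pz z\<close>; where \<open>pz z = 0\<close>, division by zero yields 0 and the identity
    persists.\<close>
  have "(\<Sum>z\<in>C. \<Sum>x\<in>A. \<Sum>y\<in>B. p x y z - pxz x z * pyz y z / pz z) = 0"
  proof (rule sum.neutral, rule ballI)
    fix z
    have "(\<Sum>x\<in>A. \<Sum>y\<in>B. pxz x z * pyz y z / pz z) = (\<Sum>x\<in>A. pxz x z) * (\<Sum>y\<in>B. pyz y z) / pz z"
      by (simp add: sum_product sum_divide_distrib)
    also have "\<dots> = pz z" by (simp add: pyz_sum pxz_sum)
    finally show "(\<Sum>x\<in>A. \<Sum>y\<in>B. p x y z - pxz x z * pyz y z / pz z) = 0"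
      by (simp add: sum_subtractf pz_def)
  qed
  then have "0 \<le> (\<Sum>z\<in>C. \<Sum>x\<in>A. \<Sum>y\<in>B.
      p x y z * (ln (p x y z) + ln (pz z) - ln (pxz x z) - ln (pyz y z)))"
    using termwise by (metis (no_types, lifting) sum_mono)
  also have "\<dots> = (\<Sum>z\<in>C. (\<Sum>x\<in>A. \<Sum>y\<in>B. p x y z * ln (p x y z)) + pz z * ln (pz z)
      - (\<Sum>x\<in>A. pxz x z * ln (pxz x z)) - (\<Sum>y\<in>B. pyz y z * ln (pyz y z)))"
  proof (rule sum.cong[OF refl])
    fix z
    have "(\<Sum>x\<in>A. \<Sum>y\<in>B. p x y z * (ln (p x y z) + ln (pz z) - ln (pxz x z) - ln (pyz y z)))
       = (\<Sum>x\<in>A. \<Sum>y\<in>B. p x y z * ln (p x y z)) + (\<Sum>x\<in>A. \<Sum>y\<in>B. p x y z * ln (pz z))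
        - (\<Sum>x\<in>A. \<Sum>y\<in>B. p x y z * ln (pxz x z)) - (\<Sum>x\<in>A. \<Sum>y\<in>B. p x y z * ln (pyz y z))"
      by (simp add: algebra_simps sum.distrib sum_subtractf)
    also have "(\<Sum>x\<in>A. \<Sum>y\<in>B. p x y z * ln (pz z)) = pz z * ln (pz z)"
      by (simp add: pz_def sum_distrib_right)
    also have "(\<Sum>x\<in>A. \<Sum>y\<in>B. p x y z * ln (pxz x z)) = (\<Sum>x\<in>A. pxz x z * ln (pxz x z))"
      by (simp add: pxz_def sum_distrib_right)
    also have "(\<Sum>x\<in>A. \<Sum>y\<in>B. p x y z * ln (pyz y z)) = (\<Sum>y\<in>B. pyz y z * ln (pyz y z))"
      by (subst sum.swap) (simp add: pyz_def sum_distrib_right)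
    finally show "(\<Sum>x\<in>A. \<Sum>y\<in>B. p x y z * (ln (p x y z) + ln (pz z) - ln (pxz x z) - ln (pyz y z)))
       = (\<Sum>x\<in>A. \<Sum>y\<in>B. p x y z * ln (p x y z)) + pz z * ln (pz z)
      - (\<Sum>x\<in>A. pxz x z * ln (pxz x z)) - (\<Sum>y\<in>B. pyz y z * ln (pyz y z))" .
  qed
  also have "\<dots> = (\<Sum>x\<in>A. \<Sum>y\<in>B. \<Sum>z\<in>C. p x y z * ln (p x y z)) + (\<Sum>z\<in>C. pz z * ln (pz z))
      - (\<Sum>x\<in>A. \<Sum>z\<in>C. pxz x z * ln (pxz x z)) - (\<Sum>y\<in>B. \<Sum>z\<in>C. pyz y z * ln (pyz y z))"
    by (simp add: sum.distrib sum_subtractf sum.swap[of _ C])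
  finally show ?thesis by linarith
qed

section \<open>Strong subadditivity and monotonicity of entropy\<close>

context prob_space
begin

lemma prob_fibre_marginal:
  assumes X: "simple_function M X" and Y: "simple_function M Y"
  shows "prob (X -` {x} \<inter> space M) = (\<Sum>y\<in>Y ` space M. prob ((\<lambda>a. (X a, Y a)) -` {(x, y)} \<inter> space M))"
proof -
  have S: "simple_function M (\<lambda>a. (X a, Y a))" using X Y by (rule simple_function_Pair)
  have meas: "(\<lambda>a. (X a, Y a)) -` {v} \<inter> space M \<in> events" for v
    using simple_functionD(2)[OF S, of "{v}"] .
  have "X -` {x} \<inter> space M = (\<Union>y\<in>Y ` space M. (\<lambda>a. (X a, Y a)) -` {(x, y)} \<inter> space M)"
    by auto
  also have "prob \<dots> = (\<Sum>y\<in>Y ` space M. prob ((\<lambda>a. (X a, Y a)) -` {(x, y)} \<inter> space M))"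
    using Y meas by (intro finite_measure_finite_Union) (auto simp: disjoint_family_on_def simple_functionD image_subset_iff)
  finally show ?thesis .
qed

text \<open>Read as: the entropy of \<open>X\<close> given \<open>(Y, Z)\<close> is at most that
  given \<open>Z\<close>. In this form it yields subadditivity and the estimates of conditional
  entropy along an orbit.\<close>

lemma ent_ssa:
  assumes X: "simple_function M X" and Y: "simple_function M Y" and Z: "simple_function M Z"
  shows "ent M (\<lambda>a. (X a, Y a, Z a)) + ent M Z \<le> ent M (\<lambda>a. (X a, Z a)) + ent M (\<lambda>a. (Y a, Z a))"
proof -
  define A B C where "A = X ` space M" and "B = Y ` space M" and "C = Z ` space M"
  have fin: "finite A" "finite B" "finite C"
    using X Y Z by (auto simp: A_def B_def C_def simple_functionD)
  define p where "p = (\<lambda>x y z. prob ((\<lambda>a. (X a, Y a, Z a)) -` {(x, y, z)} \<inter> space M))"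
  have xz: "prob ((\<lambda>a. (X a, Z a)) -` {(x, z)} \<inter> space M) = (\<Sum>y\<in>B. p x y z)" for x z
    unfolding p_def B_def
    by (subst prob_fibre_marginal[OF simple_function_Pair[OF X Z] Y])
      (intro sum.cong arg_cong[where f=prob], auto)
  have yz: "prob ((\<lambda>a. (Y a, Z a)) -` {(y, z)} \<inter> space M) = (\<Sum>x\<in>A. p x y z)" for y z
    unfolding p_def A_def
    by (subst prob_fibre_marginal[OF simple_function_Pair[OF Y Z] X])
      (intro sum.cong arg_cong[where f=prob], auto)
  have z: "prob (Z -` {z} \<inter> space M) = (\<Sum>x\<in>A. \<Sum>y\<in>B. p x y z)" for z
  proof -
    have "prob (Z -` {z} \<inter> space M) = (\<Sum>x\<in>A. prob ((\<lambda>a. (X a, Z a)) -` {(x, z)} \<inter> space M))"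
      unfolding A_def by (subst prob_fibre_marginal[OF Z X])
        (intro sum.cong arg_cong[where f=prob], auto)
    then show ?thesis by (simp add: xz)
  qed
  have "ent M (\<lambda>a. (X a, Y a, Z a)) = - (\<Sum>x\<in>A. \<Sum>y\<in>B. \<Sum>z\<in>C. p x y z * ln (p x y z))"
    by (subst ent_superset[of "A \<times> B \<times> C"])
      (use fin in \<open>auto simp: A_def B_def C_def p_def sum.cartesian_product\<close>)
  moreover have "ent M (\<lambda>a. (X a, Z a)) = - (\<Sum>x\<in>A. \<Sum>z\<in>C. (\<Sum>y\<in>B. p x y z) * ln (\<Sum>y\<in>B. p x y z))"
    by (subst ent_superset[of "A \<times> C"])
      (use fin in \<open>auto simp: A_def C_def sum.cartesian_product xz[symmetric]\<close>)
  moreover have "ent M (\<lambda>a. (Y a, Z a)) = - (\<Sum>y\<in>B. \<Sum>z\<in>C. (\<Sum>x\<in>A. p x y z) * ln (\<Sum>x\<in>A. p x y z))"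
    by (subst ent_superset[of "B \<times> C"])
      (use fin in \<open>auto simp: B_def C_def sum.cartesian_product yz[symmetric]\<close>)
  moreover have "ent M Z = - (\<Sum>z\<in>C. (\<Sum>x\<in>A. \<Sum>y\<in>B. p x y z) * ln (\<Sum>x\<in>A. \<Sum>y\<in>B. p x y z))"
    unfolding ent_def C_def by (simp add: z)
  ultimately show ?thesis
    using ssa_sums[OF fin, of p] by (simp add: p_def)
qed

lemma ent_const: "ent M (\<lambda>_. c) = 0"
proof -
  have "(\<lambda>_. c) -` {c} \<inter> space M = space M" by auto
  moreover have "(\<lambda>_. c) ` space M = {c}" using not_empty by auto
  ultimately show ?thesis by (simp add: ent_def prob_space)
qed

lemma ent_nonneg: "0 \<le> ent M X"
  unfolding ent_def neg_0_le_iff_le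
proof (rule sum_nonpos)
  fix v
  show "prob (X -` {v} \<inter> space M) * ln (prob (X -` {v} \<inter> space M)) \<le> 0"
    by (cases "prob (X -` {v} \<inter> space M) = 0")
      (auto intro!: mult_nonneg_nonpos simp: order.strict_iff_order)
qed

text \<open>Strong subadditivity with the constant \<open>()\<close> as third variable, whose
  entropy is 0.\<close>

lemma ent_Pair_le:
  assumes X: "simple_function M X" and Y: "simple_function M Y"
  shows "ent M (\<lambda>a. (X a, Y a)) \<le> ent M X + ent M Y"
  using ent_ssa[OF X Y simple_function_const[of _ "()"]] ent_const[of "()"]
    ent_cong_fibres[of M "\<lambda>a. (X a, Y a, ())" "\<lambda>a. (X a, Y a)"]
    ent_cong_fibres[of M "\<lambda>a. (X a, ())" X] ent_cong_fibres[of M "\<lambda>a. (Y a, ())" Y]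
  by simp

text \<open>Each joint probability is at most the marginal, so putting the marginal inside the
  logarithm can only increase the sum of \<open>q ln q\<close>.\<close>

lemma ent_le_Pair:
  assumes X: "simple_function M X" and Y: "simple_function M Y"
  shows "ent M X \<le> ent M (\<lambda>a. (X a, Y a))"
proof -
  define q where "q = (\<lambda>x y. prob ((\<lambda>a. (X a, Y a)) -` {(x, y)} \<inter> space M))"
  have fin: "finite (X ` space M)" "finite (Y ` space M)" using X Y by (auto simp: simple_functionD)
  have m: "prob (X -` {x} \<inter> space M) = (\<Sum>y\<in>Y ` space M. q x y)" for x
    unfolding q_def by (rule prob_fibre_marginal[OF X Y])
  have "(\<Sum>x\<in>X ` space M. \<Sum>y\<in>Y ` space M. q x y * ln (q x y))
      \<le> (\<Sum>x\<in>X ` space M. \<Sum>y\<in>Y ` space M. q x y * ln (prob (X -` {x} \<inter> space M)))"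
  proof (intro sum_mono)
    fix x y assume "y \<in> Y ` space M"
    then have "q x y \<le> prob (X -` {x} \<inter> space M)"
      unfolding m using fin by (intro member_le_sum) (auto simp: q_def)
    moreover have "q x y \<ge> 0" by (simp add: q_def)
    ultimately show "q x y * ln (q x y) \<le> q x y * ln (prob (X -` {x} \<inter> space M))"
      by (cases "q x y = 0") (auto intro!: mult_left_mono)
  qed
  also have "\<dots> = (\<Sum>x\<in>X ` space M. prob (X -` {x} \<inter> space M) * ln (prob (X -` {x} \<inter> space M)))"
    by (simp add: m sum_distrib_right)
  finally have "ent M X \<le> - (\<Sum>x\<in>X ` space M. \<Sum>y\<in>Y ` space M. q x y * ln (q x y))"
    by (simp add: ent_def)
  also have "\<dots> = ent M (\<lambda>a. (X a, Y a))"
    by (subst ent_superset[of "X ` space M \<times> Y ` space M"])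
      (use fin in \<open>auto simp: q_def sum.cartesian_product\<close>)
  finally show ?thesis .
qed

end

section \<open>Entropy of measure preserving maps\<close>

text \<open>The labels seen along an orbit at times \<open>0\<close> to \<open>n - 1\<close>; its
  level sets are the atoms of the \<open>n\<close>-fold join.\<close>

definition itinerary :: "('a \<Rightarrow> 'b) \<Rightarrow> ('a \<Rightarrow> 'a) \<Rightarrow> nat \<Rightarrow> 'a \<Rightarrow> 'b list" where
  "itinerary f T n x = map (\<lambda>i. f ((T ^^ i) x)) [0..<n]"

lemma itinerary_eq_iff:
  "itinerary f T n x = itinerary f T n y \<longleftrightarrow> (\<forall>i<n. f ((T ^^ i) x) = f ((T ^^ i) y))"
  by (auto simp: itinerary_def)

text \<open>Turns a set partition into a labelling function; outside the partitioned set the value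
  is unspecified.\<close>

definition partition_label :: "'a set set \<Rightarrow> 'a \<Rightarrow> 'a set" where
  "partition_label P x = (THE B. B \<in> P \<and> x \<in> B)"

lemma partition_label_eq:
  assumes "partition_on S P" "B \<in> P" "x \<in> B"
  shows "partition_label P x = B"
  unfolding partition_label_def
  using assms by (intro the_equality) (auto simp: partition_on_def disjoint_def)

lemma partition_label:
  assumes "partition_on S P" "x \<in> S"
  shows "partition_label P x \<in> P" "x \<in> partition_label P x"
proof -
  obtain B where "B \<in> P" "x \<in> B" using assms by (auto simp: partition_on_def)
  then show "partition_label P x \<in> P" "x \<in> partition_label P x"
    using partition_label_eq[OF assms(1) \<open>B \<in> P\<close> \<open>x \<in> B\<close>] by auto
qed

lemma funpow_in_space:
  assumes "T \<in> S \<rightarrow> S" "x \<in> S"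
  shows "(T ^^ i) x \<in> S"
  by (induction i) (use assms in auto)

text \<open>A nonempty intersection of one block from each pulled back partition is determined by
  any of its points. The case \<open>n = 0\<close> is excluded because the empty refinement is
  \<open>{UNIV}\<close> rather than \<open>{space M}\<close>.\<close>

lemma iterated_join_eq_fibres:
  assumes P: "partition_on (space M) P" and T: "T \<in> space M \<rightarrow> space M" and n: "n > 0"
  shows "iterated_join M T P n = fibres M (itinerary (partition_label P) T n)"
proof -
  let ?f = "partition_label P"
  define Q where "Q = (\<lambda>i. (\<lambda>B. (T ^^ i) -` B \<inter> space M) ` P)"
  define c where "c = (\<lambda>x i. (T ^^ i) -` ?f ((T ^^ i) x) \<inter> space M)"
  note Tn = funpow_in_space[OF T]
  have c_in: "c x i \<in> Q i" "x \<in> c x i" if "x \<in> space M" for x i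
    using partition_label[OF P Tn[OF that]] that unfolding c_def Q_def by auto
  have c_unique: "R = c x i" if R: "R \<in> Q i" and x: "x \<in> R" for R x i
  proof -
    obtain B where B: "B \<in> P" "R = (T ^^ i) -` B \<inter> space M" using R by (auto simp: Q_def)
    then show ?thesis using x partition_label_eq[OF P, of B "(T ^^ i) x"] by (simp add: c_def)
  qed
  have fibre: "itinerary ?f T n -` {itinerary ?f T n x} \<inter> space M = \<Inter> (c x ` {..<n})"
    if x: "x \<in> space M" for x
  proof (intro equalityI subsetI)
    fix y assume "y \<in> itinerary ?f T n -` {itinerary ?f T n x} \<inter> space M"
    then have "y \<in> space M" "\<And>i. i < n \<Longrightarrow> ?f ((T ^^ i) y) = ?f ((T ^^ i) x)"
      by (auto simp: itinerary_eq_iff)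
    then show "y \<in> \<Inter> (c x ` {..<n})"
      unfolding c_def using partition_label(2)[OF P Tn[of y]] by force
  next
    fix y assume y: "y \<in> \<Inter> (c x ` {..<n})"
    then have "y \<in> c x 0" using n by blast
    then have "y \<in> space M" by (simp add: c_def)
    moreover have "?f ((T ^^ i) y) = ?f ((T ^^ i) x)" if "i < n" for i
    proof (rule partition_label_eq[OF P partition_label(1)[OF P Tn[OF x]]])
      have "y \<in> c x i" using y that by blast
      then show "(T ^^ i) y \<in> ?f ((T ^^ i) x)" by (simp add: c_def)
    qed
    ultimately show "y \<in> itinerary ?f T n -` {itinerary ?f T n x} \<inter> space M"
      by (auto simp: itinerary_eq_iff)
  qed
  have join: "iterated_join M T P n = (\<Union>g\<in>(\<Pi> R\<in>Q ` {..<n}. R). {\<Inter> (g ` Q ` {..<n})}) - {{}}"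
    unfolding iterated_join_def common_refinement Q_def ..
  show ?thesis
  proof (intro equalityI subsetI)
    fix C assume "C \<in> iterated_join M T P n"
    then obtain g where g: "g \<in> (\<Pi> R\<in>Q ` {..<n}. R)" and C: "C = \<Inter> (g ` Q ` {..<n})" "C \<noteq> {}"
      unfolding join by auto
    then obtain x where x: "x \<in> C" by auto
    have gQ: "g (Q i) = c x i" if "i < n" for i
      using g x C(1) that by (intro c_unique) auto
    then have eq: "C = \<Inter> (c x ` {..<n})" using C(1) by (simp add: image_image)
    then have "x \<in> c x 0" using x n by blast
    then have "x \<in> space M" by (simp add: c_def)
    then show "C \<in> fibres M (itinerary ?f T n)"
      unfolding fibres_def eq using fibre by auto
  next
    fix C assume "C \<in> fibres M (itinerary ?f T n)"
    then obtain x where x: "x \<in> space M" and C: "C = \<Inter> (c x ` {..<n})"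
      unfolding fibres_def using fibre by auto
    \<comment> \<open>The choice is indexed by the partition and not by the time, so equal
      partitions at different times receive the same block; uniqueness of the block through
      \<open>x\<close> makes this consistent.\<close>
    define g where "g = (\<lambda>R. SOME D. D \<in> R \<and> x \<in> D)"
    have g: "g (Q i) \<in> Q i \<and> x \<in> g (Q i)" for i
      unfolding g_def by (rule someI[of _ "c x i"]) (use c_in[OF x] in auto)
    have "g (Q i) = c x i" for i using g c_unique by blast
    then have "C = \<Inter> (g ` Q ` {..<n})" by (simp add: C image_image)
    moreover have "g \<in> (\<Pi> R\<in>Q ` {..<n}. R)" using g by auto
    moreover have "x \<in> C" using c_in[OF x] by (auto simp: C)
    ultimately show "C \<in> iterated_join M T P n" unfolding join by blast
  qed
qed

section \<open>Entropy of a measure preserving map relative to a labelling\<close>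

locale measure_preserving = prob_space M for M :: "'a measure" +
  fixes T :: "'a \<Rightarrow> 'a"
  assumes measurable_T: "T \<in> measurable M M"
    and emeasure_T: "\<And>B. B \<in> sets M \<Longrightarrow> emeasure M (T -` B \<inter> space M) = emeasure M B"
begin

lemma T_space: "T \<in> space M \<rightarrow> space M"
  using measurable_T by (auto simp: measurable_def)

lemma measurable_funpow: "(T ^^ i) \<in> measurable M M"
proof (induction i)
  case (Suc i)
  then show ?case using measurable_comp[OF Suc measurable_T] by (simp add: comp_def)
qed (simp add: measurable_ident)

lemma prob_funpow:
  assumes B: "B \<in> events"
  shows "prob ((T ^^ i) -` B \<inter> space M) = prob B"
proof (induction i)
  case 0
  then show ?case using sets.sets_into_space[OF B] by (simp add: Int_absorb2)
next
  case (Suc i)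
  have "(T ^^ Suc i) -` B \<inter> space M = T -` ((T ^^ i) -` B \<inter> space M) \<inter> space M"
    using T_space by (auto simp: funpow_swap1)
  moreover have "prob (T -` ((T ^^ i) -` B \<inter> space M) \<inter> space M) = prob ((T ^^ i) -` B \<inter> space M)"
    unfolding measure_def using emeasure_T[OF measurable_sets[OF measurable_funpow B]] by simp
  ultimately show ?case using Suc by (simp only:)
qed

lemma simple_function_funpow:
  assumes f: "simple_function M f"
  shows "simple_function M (\<lambda>x. f ((T ^^ i) x))"
proof -
  have "finite ((\<lambda>x. f ((T ^^ i) x)) ` space M)"
    using funpow_in_space[OF T_space, of _ i]
    by (intro finite_subset[OF _ simple_functionD(1)[OF f]]) auto
  moreover have "(\<lambda>x. f ((T ^^ i) x)) -` {v} \<inter> space M = (T ^^ i) -` (f -` {v} \<inter> space M) \<inter> space M" for v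
    using funpow_in_space[OF T_space, of _ i] by auto
  then have "(\<lambda>x. f ((T ^^ i) x)) -` {v} \<inter> space M \<in> events" for v
    using measurable_sets[OF measurable_funpow[of i] simple_functionD(2)[OF f, of "{v}"]] by simp
  ultimately show ?thesis by (simp add: simple_function_def)
qed

lemma ent_funpow:
  assumes f: "simple_function M f"
  shows "ent M (\<lambda>x. f ((T ^^ i) x)) = ent M f"
proof -
  have "(\<lambda>x. f ((T ^^ i) x)) -` {v} \<inter> space M = (T ^^ i) -` (f -` {v} \<inter> space M) \<inter> space M" for v
    using funpow_in_space[OF T_space, of _ i] by auto
  moreover have "(\<lambda>x. f ((T ^^ i) x)) ` space M \<subseteq> f ` space M"
    using funpow_in_space[OF T_space, of _ i] by auto
  moreover have "prob ((T ^^ i) -` (f -` {v} \<inter> space M) \<inter> space M) = prob (f -` {v} \<inter> space M)" for v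
    by (rule prob_funpow[OF simple_functionD(2)[OF f]])
  ultimately show ?thesis
    unfolding ent_superset[OF simple_functionD(1)[OF f] \<open>_ \<subseteq> f ` space M\<close>] ent_def[of M f] by (simp only:)
qed

lemma simple_function_itinerary:
  assumes f: "simple_function M f"
  shows "simple_function M (itinerary f T n)"
proof (induction n)
  case 0
  then show ?case by (simp add: itinerary_def)
next
  case (Suc n)
  have "itinerary f T (Suc n) = (\<lambda>p. fst p @ [snd p]) \<circ> (\<lambda>x. (itinerary f T n x, f ((T ^^ n) x)))"
    by (auto simp: itinerary_def)
  then show ?case
    using simple_function_compose[OF simple_function_Pair[OF Suc simple_function_funpow[OF f]],
        of "\<lambda>p. fst p @ [snd p]" n] by (simp only:)
qed

lemma itinerary_funpow: "itinerary f T n ((T ^^ m) x) = map (\<lambda>i. f ((T ^^ i) x)) [m..<m + n]"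
proof -
  have "[m..<m + n] = map (\<lambda>i. i + m) [0..<n]" by (simp add: map_add_upt add.commute)
  then show ?thesis by (simp add: itinerary_def funpow_add)
qed

lemma ent_itinerary_add:
  assumes f: "simple_function M f"
  shows "ent M (itinerary f T (m + n)) \<le> ent M (itinerary f T m) + ent M (itinerary f T n)"
proof -
  have "ent M (itinerary f T (m + n)) = ent M (\<lambda>x. (itinerary f T m x, itinerary f T n ((T ^^ m) x)))"
  proof (rule ent_cong_fibres)
    fix a b
    have "(\<forall>i<m + n. f ((T ^^ i) a) = f ((T ^^ i) b)) \<longleftrightarrow>
      (\<forall>i<m. f ((T ^^ i) a) = f ((T ^^ i) b)) \<and> (\<forall>i\<in>{m..<m + n}. f ((T ^^ i) a) = f ((T ^^ i) b))"
      by auto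
    then show "itinerary f T (m + n) a = itinerary f T (m + n) b \<longleftrightarrow>
      (itinerary f T m a, itinerary f T n ((T ^^ m) a)) = (itinerary f T m b, itinerary f T n ((T ^^ m) b))"
      unfolding prod.inject itinerary_funpow by (simp add: itinerary_def Ball_def)
  qed
  also have "\<dots> \<le> ent M (itinerary f T m) + ent M (\<lambda>x. itinerary f T n ((T ^^ m) x))"
    using f by (intro ent_Pair_le simple_function_itinerary simple_function_funpow)
  finally show ?thesis using ent_funpow[OF simple_function_itinerary[OF f]] by simp
qed

definition label_entropy :: "('a \<Rightarrow> 'b) \<Rightarrow> real" where
  "label_entropy f = lim (\<lambda>n. ent M (itinerary f T n) / real n)"

lemma
  assumes f: "simple_function M f"
  shows label_entropy_LIMSEQ: "(\<lambda>n. ent M (itinerary f T n) / real n) \<longlonglongrightarrow> label_entropy f"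
    and label_entropy_le: "real n * label_entropy f \<le> ent M (itinerary f T n)"
proof -
  obtain L where L: "(\<lambda>n. ent M (itinerary f T n) / real n) \<longlonglongrightarrow> L"
      "\<And>n. real n * L \<le> ent M (itinerary f T n)"
    by (rule fekete[of "\<lambda>n. ent M (itinerary f T n)" 0]) (use ent_itinerary_add[OF f] ent_nonneg in auto)
  moreover have "label_entropy f = L"
    unfolding label_entropy_def using L(1) by (rule limI)
  ultimately show "(\<lambda>n. ent M (itinerary f T n) / real n) \<longlonglongrightarrow> label_entropy f"
    "real n * label_entropy f \<le> ent M (itinerary f T n)" by auto
qed

lemma entropy_wrt_partition_eq:
  assumes "partition_on (space M) P"
  shows "entropy_wrt_partition M T P = label_entropy (partition_label P)"
proof -
  have "partition_entropy M (iterated_join M T P n) / real n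
      = ent M (itinerary (partition_label P) T n) / real n" for n
    by (cases "n = 0") (auto simp: iterated_join_eq_fibres[OF assms T_space] partition_entropy_fibres)
  then show ?thesis unfolding entropy_wrt_partition_def label_entropy_def by (simp only:)
qed

lemma simple_function_partition_label:
  assumes P: "partition_on (space M) P" and fin: "finite P" and sub: "P \<subseteq> events"
  shows "simple_function M (partition_label P)"
proof -
  have "partition_label P ` space M \<subseteq> P" using partition_label(1)[OF P] by auto
  then have "finite (partition_label P ` space M)" using fin finite_subset by blast
  moreover have "partition_label P -` {v} \<inter> space M = v" if "v \<in> partition_label P ` space M" for v
  proof -
    have v: "v \<in> P" using that partition_label(1)[OF P] by auto
    then have "v \<subseteq> space M" using P by (auto simp: partition_on_def)
    then show ?thesis
      using partition_label_eq[OF P v] partition_label(2)[OF P] by auto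
  qed
  ultimately show ?thesis
    using \<open>partition_label P ` space M \<subseteq> P\<close> sub by (auto simp: simple_function_def)
qed

text \<open>Each step of the orbit adds at most the entropy of \<open>f\<close> given the next
  \<open>m\<close> labels of \<open>g\<close>, because those labels can be read off the longer
  itinerary \<open>W\<close>. Invariance makes this increment the same at all times.\<close>

lemma ent_itinerary_conditional:
  assumes f: "simple_function M f" and g: "simple_function M g"
  shows "ent M (itinerary f T n) \<le> ent M (itinerary g T (n + m)) +
    real n * (ent M (\<lambda>x. (f x, itinerary g T m x)) - ent M (itinerary g T m))"
proof -
  define W where "W = itinerary g T (n + m)"
  define d where "d = ent M (\<lambda>x. (f x, itinerary g T m x)) - ent M (itinerary g T m)"
  have W: "simple_function M W" unfolding W_def using g by (rule simple_function_itinerary)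
  have "ent M (\<lambda>x. (itinerary f T k x, W x)) \<le> ent M W + real k * d" if "k \<le> n" for k
    using that
  proof (induction k)
    case 0
    then show ?case by (simp add: itinerary_def ent_cong_fibres[of M "\<lambda>x. ([], W x)" W])
  next
    case (Suc k)
    define Z where "Z = (\<lambda>x. itinerary g T m ((T ^^ k) x))"
    have ZW: "Z a = Z b" if "W a = W b" for a b
      using that Suc.prems unfolding W_def Z_def itinerary_funpow by (auto simp: itinerary_def)
    have S: "simple_function M (\<lambda>x. f ((T ^^ k) x))" "simple_function M Z"
      "simple_function M (\<lambda>x. (itinerary f T k x, W x))"
      unfolding Z_def
      using f g W by (auto intro: simple_function_funpow simple_function_itinerary simple_function_Pair)
    have "ent M (\<lambda>x. (f ((T ^^ k) x), (itinerary f T k x, W x), Z x)) + ent M Z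
      \<le> ent M (\<lambda>x. (f ((T ^^ k) x), Z x)) + ent M (\<lambda>x. ((itinerary f T k x, W x), Z x))"
      using S by (intro ent_ssa)
    moreover have "ent M (\<lambda>x. (f ((T ^^ k) x), (itinerary f T k x, W x), Z x))
        = ent M (\<lambda>x. (itinerary f T (Suc k) x, W x))"
      by (intro ent_cong_fibres) (auto simp: itinerary_eq_iff less_Suc_eq intro: ZW)
    moreover have "ent M (\<lambda>x. ((itinerary f T k x, W x), Z x)) = ent M (\<lambda>x. (itinerary f T k x, W x))"
      by (intro ent_cong_fibres) (auto intro: ZW)
    moreover have "ent M (\<lambda>x. (f ((T ^^ k) x), Z x)) = ent M (\<lambda>x. (f x, itinerary g T m x))"
      using ent_funpow[OF simple_function_Pair[OF f simple_function_itinerary[OF g]]] by (simp add: Z_def)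
    moreover have "ent M Z = ent M (itinerary g T m)"
      unfolding Z_def using ent_funpow[OF simple_function_itinerary[OF g]] .
    ultimately show ?case using Suc by (simp add: d_def algebra_simps)
  qed
  from this[of n] have "ent M (\<lambda>x. (itinerary f T n x, W x)) \<le> ent M W + real n * d" by simp
  moreover have "ent M (itinerary f T n) \<le> ent M (\<lambda>x. (itinerary f T n x, W x))"
    using f W by (intro ent_le_Pair simple_function_itinerary)
  ultimately show ?thesis by (simp add: W_def d_def)
qed

text \<open>The excess over \<open>g\<close> is at most the conditional entropy of \<open>f\<close>
  given \<open>m\<close> labels of \<open>g\<close>. When the labels of \<open>g\<close> along the
  orbit determine the point, this can be made small by the choice of \<open>m\<close>.\<close>

lemma label_entropy_conditional:
  assumes f: "simple_function M f" and g: "simple_function M g"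
  shows "label_entropy f \<le> label_entropy g + (ent M (\<lambda>x. (f x, itinerary g T m x)) - ent M (itinerary g T m))"
proof -
  define d where "d = ent M (\<lambda>x. (f x, itinerary g T m x)) - ent M (itinerary g T m)"
  have "(\<lambda>n. ent M (itinerary g T (n + m)) / real (n + m) * (real (n + m) / real n) + d)
      \<longlonglongrightarrow> label_entropy g * 1 + d"
  proof (intro tendsto_intros)
    show "(\<lambda>n. ent M (itinerary g T (n + m)) / real (n + m)) \<longlonglongrightarrow> label_entropy g"
      using LIMSEQ_ignore_initial_segment[OF label_entropy_LIMSEQ[OF g], of m] by simp
    have "(\<lambda>n. 1 + real m * inverse (real n)) \<longlonglongrightarrow> 1 + real m * 0"
      by (intro tendsto_intros LIMSEQ_inverse_real_of_nat lim_inverse_n)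
    moreover have "\<forall>\<^sub>F n in sequentially. 1 + real m * inverse (real n) = real (n + m) / real n"
      using eventually_gt_at_top[of 0] by eventually_elim (simp add: field_simps)
    ultimately show "(\<lambda>n. real (n + m) / real n) \<longlonglongrightarrow> 1"
      by (simp add: tendsto_cong)
  qed
  moreover have "\<forall>\<^sub>F n in sequentially. ent M (itinerary f T n) / real n \<le>
      ent M (itinerary g T (n + m)) / real (n + m) * (real (n + m) / real n) + d"
    using eventually_gt_at_top[of 0]
  proof eventually_elim
    case (elim n)
    have "ent M (itinerary f T n) / real n \<le> (ent M (itinerary g T (n + m)) + real n * d) / real n"
      using ent_itinerary_conditional[OF f g, of n m] by (intro divide_right_mono) (simp_all add: d_def)
    moreover have "ent M (itinerary g T (n + m)) / real (n + m) * (real (n + m) / real n)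
        = ent M (itinerary g T (n + m)) / real n"
      using elim by (simp del: of_nat_add)
    ultimately show ?case using elim by (simp add: add_divide_distrib del: of_nat_add)
  qed
  ultimately have "label_entropy f \<le> label_entropy g * 1 + d"
    by (intro LIMSEQ_le[OF label_entropy_LIMSEQ[OF f]]) (auto simp: eventually_sequentially)
  then show ?thesis by (simp add: d_def)
qed

text \<open>If every level set of \<open>f\<close> is, up to measure \<open>\<delta>\<close>, a
  union of level sets of \<open>W\<close>, then \<open>f\<close> has small conditional entropy given
  \<open>W\<close>. The parameter \<open>t\<close> trades the size of the logarithm on the
  exceptional part against an additive error; it is to be fixed before
  \<open>\<delta>\<close>.\<close>

lemma ent_conditional_le:
  assumes f: "simple_function M f" and W: "simple_function M W"
    and t: "0 < t" "t \<le> 1"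
    and approx: "\<And>v. v \<in> f ` space M \<Longrightarrow> \<exists>V. prob ((f -` {v} \<inter> space M) - W -` V) < \<delta> \<and>
        prob ((W -` V \<inter> space M) - f -` {v}) < \<delta>"
  shows "ent M (\<lambda>x. (f x, W x)) - ent M W \<le> real (card (f ` space M)) * (\<delta> + \<delta> * ln (1 / t) + t)"
proof -
  define A B where "A = f ` space M" and "B = W ` space M"
  have fin: "finite A" "finite B" using f W by (auto simp: A_def B_def simple_functionD)
  have S: "simple_function M (\<lambda>x. (f x, W x))" "simple_function M (\<lambda>x. (W x, f x))"
    using f W by (auto intro: simple_function_Pair)
  define p where "p = (\<lambda>v w. prob ((\<lambda>x. (f x, W x)) -` {(v, w)} \<inter> space M))"
  define q where "q = (\<lambda>w. prob (W -` {w} \<inter> space M))"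
  have p0: "p v w \<ge> 0" for v w by (simp add: p_def)
  have ev: "(\<lambda>x. (f x, W x)) -` R \<inter> space M \<in> events" for R
    using simple_functionD(2)[OF S(1), of R] .
  have q: "q w = (\<Sum>v\<in>A. p v w)" for w
    unfolding q_def A_def p_def
    by (subst prob_fibre_marginal[OF W f]) (intro sum.cong arg_cong[where f=prob], auto)
  have q1: "(\<Sum>w\<in>B. q w) = 1"
  proof -
    have "(\<Sum>w\<in>B. q w) = prob (\<Union>w\<in>B. W -` {w} \<inter> space M)"
      unfolding q_def using fin simple_functionD(2)[OF W]
      by (intro finite_measure_finite_Union[symmetric]) (auto simp: disjoint_family_on_def)
    also have "(\<Union>w\<in>B. W -` {w} \<inter> space M) = space M" by (auto simp: B_def)
    finally show ?thesis by (simp add: prob_space)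
  qed
  have pq: "p v w \<le> q w" if "v \<in> A" for v w
    unfolding q using that fin p0 by (intro member_le_sum) auto
  \<comment> \<open>This is \<open>ln r \<le> r - 1\<close> at \<open>r = u * q w / p v w\<close>,
    with a free scale \<open>u\<close> that is set to 1 on the approximating set and to
    \<open>t\<close> off it.\<close>
  have termwise: "p v w * (ln (q w) - ln (p v w)) \<le> p v w * ln (1 / u) + u * q w - p v w"
    if "v \<in> A" "u > 0" for u v w
  proof (cases "p v w = 0")
    case True
    have "q w \<ge> 0" by (simp add: q_def)
    then show ?thesis using True that by simp
  next
    case False
    then have pos: "p v w > 0" "q w > 0" using p0[of v w] pq[OF that(1), of w] by linarith+
    have "ln (u * q w / p v w) \<le> u * q w / p v w - 1"
      using pos that by (intro ln_le_minus_one) auto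
    then have "p v w * ln (u * q w / p v w) \<le> p v w * (u * q w / p v w - 1)"
      using pos by (intro mult_left_mono) auto
    also have "ln (u * q w / p v w) = ln u + ln (q w) - ln (p v w)"
      using pos that by (simp add: ln_div ln_mult)
    also have "p v w * (u * q w / p v w - 1) = u * q w - p v w"
      using pos by (simp add: field_simps)
    finally show ?thesis using that by (simp add: ln_div algebra_simps)
  qed
  have sum_p: "(\<Sum>w\<in>B \<inter> V. p v w) = prob ((f -` {v} \<inter> space M) \<inter> W -` V)" for v V
  proof -
    have "(\<Sum>w\<in>B \<inter> V. p v w) = prob (\<Union>w\<in>B \<inter> V. (\<lambda>x. (f x, W x)) -` {(v, w)} \<inter> space M)"
      unfolding p_def using fin ev
      by (intro finite_measure_finite_Union[symmetric]) (auto simp: disjoint_family_on_def)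
    also have "(\<Union>w\<in>B \<inter> V. (\<lambda>x. (f x, W x)) -` {(v, w)} \<inter> space M) = (f -` {v} \<inter> space M) \<inter> W -` V"
      by (auto simp: B_def)
    finally show ?thesis .
  qed
  have sum_q: "(\<Sum>w\<in>B \<inter> V. q w) = prob (W -` V \<inter> space M)" for V
  proof -
    have "(\<Sum>w\<in>B \<inter> V. q w) = prob (\<Union>w\<in>B \<inter> V. W -` {w} \<inter> space M)"
      unfolding q_def using fin simple_functionD(2)[OF W]
      by (intro finite_measure_finite_Union[symmetric]) (auto simp: disjoint_family_on_def)
    also have "(\<Union>w\<in>B \<inter> V. W -` {w} \<inter> space M) = W -` V \<inter> space M"
      by (auto simp: B_def)
    finally show ?thesis .
  qed
  have each: "(\<Sum>w\<in>B. p v w * (ln (q w) - ln (p v w))) \<le> \<delta> + \<delta> * ln (1 / t) + t" if v: "v \<in> A" for v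
  proof -
    obtain V where V: "prob ((f -` {v} \<inter> space M) - W -` V) < \<delta>" "prob ((W -` V \<inter> space M) - f -` {v}) < \<delta>"
      using approx v unfolding A_def by blast
    have split: "(\<Sum>w\<in>B. h w) = (\<Sum>w\<in>B \<inter> V. h w) + (\<Sum>w\<in>B \<inter> - V. h w)" for h :: "_ \<Rightarrow> real"
      using sum.Int_Diff[OF fin(2), of h V] by (simp add: Diff_eq)
    \<comment> \<open>On \<open>V\<close>, scale 1 leaves only the mass of \<open>W\<close> in
      \<open>V\<close> that carries another label than \<open>v\<close>, which is below
      \<open>\<delta>\<close>. Off \<open>V\<close>, it is the label \<open>v\<close> itself that
      has mass below \<open>\<delta>\<close>.\<close>
    have "(\<Sum>w\<in>B \<inter> V. p v w * (ln (q w) - ln (p v w))) \<le> (\<Sum>w\<in>B \<inter> V. q w - p v w)"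
      using termwise[OF v, of 1] by (intro sum_mono) auto
    also have "\<dots> = prob (W -` V \<inter> space M) - prob ((f -` {v} \<inter> space M) \<inter> W -` V)"
      by (simp add: sum_subtractf sum_p sum_q)
    also have "\<dots> = prob ((W -` V \<inter> space M) - ((f -` {v} \<inter> space M) \<inter> W -` V))"
    proof (rule finite_measure_Diff[symmetric])
      show "W -` V \<inter> space M \<in> events" using simple_functionD(2)[OF W] .
      have "(f -` {v} \<inter> space M) \<inter> W -` V = (\<lambda>x. (f x, W x)) -` ({v} \<times> V) \<inter> space M" by auto
      then show "(f -` {v} \<inter> space M) \<inter> W -` V \<in> events" using ev by simp
    qed auto
    also have "(W -` V \<inter> space M) - ((f -` {v} \<inter> space M) \<inter> W -` V) = (W -` V \<inter> space M) - f -` {v}"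
      by auto
    finally have 1: "(\<Sum>w\<in>B \<inter> V. p v w * (ln (q w) - ln (p v w))) \<le> \<delta>" using V(2) by linarith
    have "(\<Sum>w\<in>B \<inter> - V. p v w * (ln (q w) - ln (p v w))) \<le> (\<Sum>w\<in>B \<inter> - V. p v w * ln (1 / t) + t * q w)"
    proof (rule sum_mono)
      fix w
      show "p v w * (ln (q w) - ln (p v w)) \<le> p v w * ln (1 / t) + t * q w"
        using termwise[OF v t(1), of w] p0[of v w] by linarith
    qed
    also have "\<dots> = (\<Sum>w\<in>B \<inter> - V. p v w) * ln (1 / t) + t * (\<Sum>w\<in>B \<inter> - V. q w)"
      by (simp only: sum.distrib sum_distrib_right sum_distrib_left)
    also have "(\<Sum>w\<in>B \<inter> - V. p v w) = prob ((f -` {v} \<inter> space M) - W -` V)"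
      unfolding sum_p by (rule arg_cong[where f=prob]) auto
    also have "(prob ((f -` {v} \<inter> space M) - W -` V)) * ln (1 / t) \<le> \<delta> * ln (1 / t)"
      using V(1) t by (intro mult_right_mono) auto
    also have "t * (\<Sum>w\<in>B \<inter> - V. q w) \<le> t * 1"
      unfolding sum_q using t by (intro mult_left_mono) auto
    finally show ?thesis using 1 split[of "\<lambda>w. p v w * (ln (q w) - ln (p v w))"] by simp
  qed
  have "ent M (\<lambda>x. (f x, W x)) = - (\<Sum>v\<in>A. \<Sum>w\<in>B. p v w * ln (p v w))"
    by (subst ent_superset[of "A \<times> B"]) (use fin in \<open>auto simp: A_def B_def p_def sum.cartesian_product\<close>)
  moreover have "ent M W = - (\<Sum>v\<in>A. \<Sum>w\<in>B. p v w * ln (q w))"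
  proof -
    have "(\<Sum>w\<in>B. q w * ln (q w)) = (\<Sum>w\<in>B. \<Sum>v\<in>A. p v w * ln (q w))"
      by (subst (1) q) (simp add: sum_distrib_right)
    then show ?thesis unfolding ent_def B_def q_def by (subst sum.swap) simp
  qed
  ultimately have "ent M (\<lambda>x. (f x, W x)) - ent M W = (\<Sum>v\<in>A. \<Sum>w\<in>B. p v w * (ln (q w) - ln (p v w)))"
    by (simp add: right_diff_distrib sum_subtractf)
  also have "\<dots> \<le> (\<Sum>v\<in>A. \<delta> + \<delta> * ln (1 / t) + t)" using each by (intro sum_mono)
  finally show ?thesis by (simp add: A_def)
qed

end

section \<open>Cylinders in the full shift\<close>

definition words :: "nat \<Rightarrow> nat \<Rightarrow> nat list set" where
  "words N n = {w. set w \<subseteq> {1..N} \<and> length w = n}"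

definition init_word :: "nat \<Rightarrow> (nat \<Rightarrow> nat) \<Rightarrow> nat list" where
  "init_word n x = map x [0..<n]"

text \<open>Finite unions of cylinders of a common length are kept as a single object, which makes
  the family visibly closed under complements and, after lengthening the words, under finite unions.
  Words in \<open>V\<close> of another length or alphabet contribute nothing.\<close>

definition cylinders :: "nat \<Rightarrow> nat \<Rightarrow> nat list set \<Rightarrow> (nat \<Rightarrow> nat) set" where
  "cylinders N n V = {x \<in> shift_space N. init_word n x \<in> V}"

abbreviation cyl :: "nat \<Rightarrow> nat list \<Rightarrow> (nat \<Rightarrow> nat) set" where
  "cyl N w \<equiv> cylinders N (length w) {w}"

abbreviation shift_borel :: "nat \<Rightarrow> (nat \<Rightarrow> nat) measure" where
  "shift_borel N \<equiv> restrict_space borel (shift_space N)"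

lemma finite_words [simp]: "finite (words N n)"
  unfolding words_def using finite_lists_length_eq[of "{1..N}" n] by simp

lemma words_0 [simp]: "words N 0 = {[]}"
  by (auto simp: words_def)

lemma length_init_word [simp]: "length (init_word n x) = n"
  by (simp add: init_word_def)

lemma init_word_in_words [simp]: "x \<in> shift_space N \<Longrightarrow> init_word n x \<in> words N n"
  by (auto simp: init_word_def words_def shift_space_def)

lemma take_init_word: "m \<le> n \<Longrightarrow> take m (init_word n x) = init_word m x"
  by (simp add: init_word_def take_map)

lemma init_word_eq_iff: "init_word n x = init_word n y \<longleftrightarrow> (\<forall>i<n. x i = y i)"
  by (auto simp: init_word_def)

lemma init_word_eq_word_iff: "init_word (length w) x = w \<longleftrightarrow> (\<forall>i<length w. x i = w ! i)"
proof
  assume eq: "init_word (length w) x = w"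
  have "init_word (length w) x ! i = x i" if "i < length w" for i
    using that by (simp add: init_word_def)
  then show "\<forall>i<length w. x i = w ! i" by (metis eq)
qed (auto simp: init_word_def intro!: nth_equalityI)

lemma init_word_add: "init_word (m + n) x = init_word m x @ init_word n (\<lambda>k. x (m + k))"
  by (rule nth_equalityI) (auto simp: init_word_def nth_append)

lemma init_word_Suc: "init_word (Suc n) x = init_word n x @ [x n]"
  by (simp add: init_word_def)

lemma init_word_Suc': "init_word (Suc n) x = x 0 # init_word n (shift x)"
  by (rule nth_equalityI) (auto simp: init_word_def shift_def nth_Cons' simp del: upt_Suc)

lemma shift_funpow: "(shift ^^ i) x = (\<lambda>k. x (i + k))"
  by (induction i arbitrary: x) (simp_all add: shift_def)

lemma itinerary_shift: "itinerary (\<lambda>x. x 0) shift n = init_word n"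
  by (auto simp: itinerary_def init_word_def shift_funpow)

lemma shift_in_shift_space: "shift \<in> shift_space N \<rightarrow> shift_space N"
  by (auto simp: shift_space_def shift_def)

lemma cylinders_lift:
  "m \<le> n \<Longrightarrow> cylinders N m V = cylinders N n {w. take m w \<in> V}"
  by (auto simp: cylinders_def take_init_word)

lemma cylinders_Un: "cylinders N n (\<Union>i\<in>I. V i) = (\<Union>i\<in>I. cylinders N n (V i))"
  by (auto simp: cylinders_def)

lemma cylinders_Int_words: "cylinders N n V = cylinders N n (V \<inter> words N n)"
  by (auto simp: cylinders_def)

lemma cylinders_UNION: "cylinders N n V = (\<Union>w\<in>V \<inter> words N n. cyl N w)"
proof (intro equalityI subsetI)
  fix x assume "x \<in> cylinders N n V"
  then have "init_word n x \<in> V \<inter> words N n" "x \<in> cyl N (init_word n x)" by (auto simp: cylinders_def)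
  then show "x \<in> (\<Union>w\<in>V \<inter> words N n. cyl N w)" by blast
qed (auto simp: cylinders_def words_def)

lemma cylinders_in_sets [measurable, simp]: "cylinders N n V \<in> sets (shift_borel N)"
proof -
  have *: "cyl N w \<in> sets (shift_borel N)" for w
  proof -
    have c: "closed {x::nat \<Rightarrow> nat. \<forall>i. i < length w \<longrightarrow> x i = w ! i}"
      by (rule closed_Collect_all, rule closed_Collect_imp, rule open_Collect_const,
          rule closed_Collect_eq, rule continuous_on_product_coordinates, rule continuous_on_const)
    have e: "cyl N w = shift_space N \<inter> {x. \<forall>i. i < length w \<longrightarrow> x i = w ! i}"
      by (auto simp only: cylinders_def init_word_eq_word_iff mem_Collect_eq singleton_iff Int_iff)
    show ?thesis unfolding sets_restrict_space 
      by (rule image_eqI[where f = "(\<inter>) (shift_space N)", OF e borel_closed[OF c]])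
  qed
  show ?thesis
    by (subst cylinders_UNION, rule sets.finite_UN) (auto intro: *)
qed

lemma shift_measurable: "shift \<in> measurable (shift_borel N) (shift_borel N)"
proof (rule measurable_restrict_space3[OF _ shift_in_shift_space])
  show "(shift :: (nat \<Rightarrow> nat) \<Rightarrow> _) \<in> borel \<rightarrow>\<^sub>M borel"
    unfolding shift_def
    by (rule measurable_coordinatewise_then_product, rule borel_measurable_continuous_onI,
        rule continuous_on_product_coordinates)
qed

lemma open_contains_cylinder:
  assumes U: "open U" and x: "x \<in> U"
  obtains n where "cylinders N n {init_word n x} \<subseteq> U"
proof -
  have "openin (product_topology (\<lambda>i. euclidean) UNIV) U" using U by (simp add: open_fun_def)
  from product_topology_open_contains_basis[OF this x] obtain X where
    X: "x \<in> (\<Pi>\<^sub>E i\<in>UNIV. X i)" "finite {i. X i \<noteq> UNIV}" "(\<Pi>\<^sub>E i\<in>UNIV. X i) \<subseteq> U"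
    by auto
  obtain n where n: "\<forall>i\<in>{i. X i \<noteq> UNIV}. i < n"
    using X(2) unfolding finite_nat_set_iff_bounded by blast
  have "cylinders N n {init_word n x} \<subseteq> U"
  proof
    fix y assume "y \<in> cylinders N n {init_word n x}"
    then have y: "\<And>i. i < n \<Longrightarrow> y i = x i" by (auto simp: cylinders_def init_word_eq_iff)
    have "y i \<in> X i" for i
    proof (cases "X i = UNIV")
      case False
      then have "y i = x i" using n y by blast
      then show ?thesis using X(1) by (auto simp: PiE_iff)
    qed simp
    then show "y \<in> U" using X(3) by (auto simp: PiE_iff)
  qed
  then show thesis by (rule that)
qed

text \<open>Every relatively open set is the union of the cylinders inside it, and there are only
  countably many words.\<close>

lemma sets_shift_borel:
  "sets (shift_borel N) = sigma_sets (shift_space N) (range (cyl N))"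
proof
  let ?M = "sigma (shift_space N) (range (cyl N))"
  have sub: "range (cyl N) \<subseteq> Pow (shift_space N)" by (auto simp: cylinders_def)
  have "(\<lambda>x. x) \<in> borel_measurable ?M"
  proof (rule borel_measurableI)
    fix S :: "(nat \<Rightarrow> nat) set" assume S: "open S"
    have "S \<inter> shift_space N = \<Union> (cyl N ` {w. cyl N w \<subseteq> S})"
    proof (intro equalityI subsetI)
      fix x assume x: "x \<in> S \<inter> shift_space N"
      then obtain n where "cylinders N n {init_word n x} \<subseteq> S" using open_contains_cylinder[OF S] by blast
      then have "cyl N (init_word n x) \<subseteq> S" by simp
      moreover have "x \<in> cyl N (init_word n x)" using x by (simp add: cylinders_def)
      ultimately show "x \<in> \<Union> (cyl N ` {w. cyl N w \<subseteq> S})" by blast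
    qed (auto simp: cylinders_def)
    moreover have "\<Union> (cyl N ` {w. cyl N w \<subseteq> S}) \<in> sets ?M"
      using sub by (intro sets.countable_UN'') auto
    ultimately show "(\<lambda>x. x) -` S \<inter> space ?M \<in> sets ?M"
      using sub by (simp add: space_measure_of)
  qed
  then have "B \<inter> shift_space N \<in> sets ?M" if "B \<in> sets borel" for B
    using measurable_sets[OF _ that, of "\<lambda>x. x" ?M] sub by (simp add: space_measure_of)
  then show "sets (shift_borel N) \<subseteq> sigma_sets (shift_space N) (range (cyl N))"
    using sub by (auto simp: sets_restrict_space sets_measure_of Int_commute)
  show "sigma_sets (shift_space N) (range (cyl N)) \<subseteq> sets (shift_borel N)"
    using sets.sigma_sets_subset[of "range (cyl N)" "shift_borel N"] cylinders_in_sets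
    unfolding space_restrict_space space_borel by (simp add: image_subset_iff)
qed

lemma space_shift_borel [simp]: "space (shift_borel N) = shift_space N"
  by (simp add: space_restrict_space)

section \<open>Approximation of Borel sets by cylinder sets\<close>

text \<open>One cylinder set serves finitely many measures at once, which is what comparing two
  measures on the same set requires. The sets with this property contain the cylinders and are
  closed under complements and countable unions.\<close>

lemma approx_by_cylinders:
  assumes fin: "finite \<M>" and M: "\<And>\<mu>. \<mu> \<in> \<M> \<Longrightarrow> finite_measure \<mu> \<and> sets \<mu> = sets (shift_borel N)"
    and E: "E \<in> sets (shift_borel N)" and e: "0 < e"
  shows "\<exists>n V. \<forall>\<mu>\<in>\<M>. measure \<mu> (sym_diff E (cylinders N n V)) < e"
  using E[unfolded sets_shift_borel] e
proof (induction arbitrary: e rule: sigma_sets.induct)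
  case (Basic a)
  then obtain w where "a = cyl N w" by auto
  then show ?case using Basic by (intro exI[of _ "length w"] exI[of _ "{w}"]) simp
next
  case Empty
  then show ?case by (intro exI[of _ 0] exI[of _ "{}"]) (simp add: cylinders_def)
next
  case (Compl a)
  then obtain n V where V: "\<forall>\<mu>\<in>\<M>. measure \<mu> (sym_diff a (cylinders N n V)) < e" by blast
  have "a \<subseteq> shift_space N"
    using Compl.hyps sigma_sets_into_sp[of "range (cyl N)" "shift_space N"] by (auto simp: cylinders_def)
  then have "sym_diff (shift_space N - a) (cylinders N n (- V)) = sym_diff a (cylinders N n V)"
    by (auto simp: cylinders_def)
  then show ?case using V by metis
next
  case (Union A)
  have A: "A i \<in> sets (shift_borel N)" for i using Union.hyps sets_shift_borel by blast
  have "\<forall>\<^sub>F k in sequentially. measure \<mu> ((\<Union>i. A i) - (\<Union>i<k. A i)) < e / 2" if mu: "\<mu> \<in> \<M>" for \<mu>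
  proof -
    interpret finite_measure \<mu> using M mu by blast
    have A': "A i \<in> sets \<mu>" for i using A M mu by blast
    have "(\<lambda>k. measure \<mu> (\<Union>i<k. A i)) \<longlonglongrightarrow> measure \<mu> (\<Union>k. \<Union>i<k. A i)"
    proof (rule finite_Lim_measure_incseq)
      show "incseq (\<lambda>k. \<Union>i<k. A i)" unfolding incseq_def by (intro allI impI UN_mono) auto
    qed (use A' in auto)
    moreover have "(\<Union>k. \<Union>i<k. A i) = (\<Union>i. A i)" by auto
    ultimately have "(\<lambda>k. measure \<mu> (\<Union>i. A i) - measure \<mu> (\<Union>i<k. A i)) \<longlonglongrightarrow> 0"
      by (auto intro!: tendsto_eq_intros)
    moreover have "measure \<mu> (\<Union>i. A i) - measure \<mu> (\<Union>i<k. A i) = measure \<mu> ((\<Union>i. A i) - (\<Union>i<k. A i))" for k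
      using A' by (intro finite_measure_Diff[symmetric]) auto
    ultimately have "(\<lambda>k. measure \<mu> ((\<Union>i. A i) - (\<Union>i<k. A i))) \<longlonglongrightarrow> 0" by simp
    then show ?thesis using Union.prems by (intro order_tendstoD) auto
  qed
  then have "\<forall>\<^sub>F k in sequentially. \<forall>\<mu>\<in>\<M>. measure \<mu> ((\<Union>i. A i) - (\<Union>i<k. A i)) < e / 2"
    using fin by (intro eventually_ball_finite) auto
  from eventually_happens'[OF sequentially_bot this]
  obtain k where k: "\<And>\<mu>. \<mu> \<in> \<M> \<Longrightarrow> measure \<mu> ((\<Union>i. A i) - (\<Union>i<k. A i)) < e / 2"
    by blast
  \<comment> \<open>Half of \<open>e\<close> is spent on truncating the union, the other half is
    shared by the \<open>k\<close> sets that remain; \<open>Suc k\<close> avoids division by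
    zero.\<close>
  define d where "d = e / 2 / real (Suc k)"
  have d: "d > 0" using Union.prems by (simp add: d_def)
  have "\<forall>i. \<exists>n V. \<forall>\<mu>\<in>\<M>. measure \<mu> (sym_diff (A i) (cylinders N n V)) < d"
    using Union.IH d by blast
  then obtain n V where nV: "\<And>i \<mu>. \<mu> \<in> \<M> \<Longrightarrow> measure \<mu> (sym_diff (A i) (cylinders N (n i) (V i))) < d"
    by metis
  define m where "m = (\<Sum>i<k. n i)"
  have nm: "n i \<le> m" if "i < k" for i unfolding m_def using that by (intro member_le_sum) auto
  define W where "W = (\<Union>i<k. {w. take (n i) w \<in> V i})"
  have W: "cylinders N m W = (\<Union>i<k. cylinders N (n i) (V i))"
    unfolding W_def cylinders_Un using nm by (intro SUP_cong refl cylinders_lift[symmetric]) auto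
  show ?case
  proof (intro exI ballI)
    fix \<mu> assume mu: "\<mu> \<in> \<M>"
    interpret finite_measure \<mu> using M mu by blast
    have A': "A i \<in> sets \<mu>" "cylinders N j X \<in> sets \<mu>" for i j X using A M mu by auto
    have "measure \<mu> (sym_diff (\<Union> (range A)) (cylinders N m W))
      \<le> measure \<mu> (((\<Union>i. A i) - (\<Union>i<k. A i)) \<union> (\<Union>i<k. sym_diff (A i) (cylinders N (n i) (V i))))"
      unfolding W using A' by (intro finite_measure_mono) auto
    also have "\<dots> \<le> measure \<mu> ((\<Union>i. A i) - (\<Union>i<k. A i)) +
        measure \<mu> (\<Union>i<k. sym_diff (A i) (cylinders N (n i) (V i)))"
      using A' by (intro measure_Un_le) auto
    also have "measure \<mu> (\<Union>i<k. sym_diff (A i) (cylinders N (n i) (V i)))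
        \<le> (\<Sum>i<k. measure \<mu> (sym_diff (A i) (cylinders N (n i) (V i))))"
      using A' by (intro finite_measure_subadditive_finite) auto
    also have "\<dots> \<le> (\<Sum>i<k. d)" using nV[OF mu] by (intro sum_mono less_imp_le)
    also have "\<dots> \<le> e / 2" using Union.prems by (simp add: d_def field_simps)
    finally show "measure \<mu> (sym_diff (\<Union> (range A)) (cylinders N m W)) < e"
      using k[OF mu] by simp
  qed
qed

lemma measure_cylinders:
  assumes "finite_measure \<mu>" "sets \<mu> = sets (shift_borel N)"
  shows "measure \<mu> (cylinders N n V) = (\<Sum>w\<in>V \<inter> words N n. measure \<mu> (cyl N w))"
proof -
  interpret finite_measure \<mu> by fact
  have "cylinders N n V = (\<Union>w\<in>V \<inter> words N n. cylinders N n {w})"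
    using cylinders_Un[of N n "\<lambda>w. {w}" "V \<inter> words N n"] cylinders_Int_words[of N n V] by simp
  also have "measure \<mu> \<dots> = (\<Sum>w\<in>V \<inter> words N n. measure \<mu> (cylinders N n {w}))"
  proof (rule finite_measure_finite_Union)
    show "disjoint_family_on (\<lambda>w. cylinders N n {w}) (V \<inter> words N n)"
      unfolding disjoint_family_on_def cylinders_def by blast
    have "cylinders N n {w} \<in> sets \<mu>" for w unfolding assms(2) by (rule cylinders_in_sets)
    then show "(\<lambda>w. cylinders N n {w}) ` (V \<inter> words N n) \<subseteq> sets \<mu>" by blast
  qed simp
  also have "\<dots> = (\<Sum>w\<in>V \<inter> words N n. measure \<mu> (cyl N w))"
    by (intro sum.cong) (auto simp: words_def)
  finally show ?thesis .
qed

lemma measure_sym_diff_le: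
  assumes "finite_measure \<mu>" "A \<in> sets \<mu>" "B \<in> sets \<mu>"
  shows "\<bar>measure \<mu> A - measure \<mu> B\<bar> \<le> measure \<mu> (sym_diff A B)"
proof -
  interpret finite_measure \<mu> by fact
  have "measure \<mu> A \<le> measure \<mu> (B \<union> sym_diff A B)" "measure \<mu> B \<le> measure \<mu> (A \<union> sym_diff A B)"
    using assms by (auto intro!: finite_measure_mono)
  moreover have "measure \<mu> (B \<union> sym_diff A B) \<le> measure \<mu> B + measure \<mu> (sym_diff A B)"
    "measure \<mu> (A \<union> sym_diff A B) \<le> measure \<mu> A + measure \<mu> (sym_diff A B)"
    using assms by (auto intro!: measure_Un_le)
  ultimately show ?thesis by linarith
qed

text \<open>Agreement spreads from cylinder sets to a Borel set by approximating it for both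
  measures simultaneously.\<close>

lemma measure_eq_on_cylinders:
  assumes mu: "finite_measure \<mu>" "sets \<mu> = sets (shift_borel N)"
    and nu: "finite_measure \<nu>" "sets \<nu> = sets (shift_borel N)"
    and eq: "\<And>n w. w \<in> words N n \<Longrightarrow> measure \<mu> (cyl N w) = measure \<nu> (cyl N w)"
  shows "\<mu> = \<nu>"
proof (rule measure_eqI)
  interpret \<mu>: finite_measure \<mu> by fact
  interpret \<nu>: finite_measure \<nu> by fact
  fix E assume E: "E \<in> sets \<mu>"
  have "\<bar>measure \<mu> E - measure \<nu> E\<bar> \<le> 0 + e" if "e > 0" for e
  proof -
    have "\<exists>n V. \<forall>\<rho>\<in>{\<mu>, \<nu>}. measure \<rho> (sym_diff E (cylinders N n V)) < e / 2"
      by (rule approx_by_cylinders) (use mu nu E that in auto)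
    then obtain n V where "\<forall>\<rho>\<in>{\<mu>, \<nu>}. measure \<rho> (sym_diff E (cylinders N n V)) < e / 2"
      by (elim exE)
    then have V: "measure \<mu> (sym_diff E (cylinders N n V)) < e / 2"
        "measure \<nu> (sym_diff E (cylinders N n V)) < e / 2"
      by (simp_all only: ball_simps)
    have "measure \<mu> (cylinders N n V) = measure \<nu> (cylinders N n V)"
      by (rule trans[OF measure_cylinders[OF mu] trans[OF _ measure_cylinders[OF nu, symmetric]]],
          rule sum.cong[OF refl], rule eq[of _ n], erule IntD2)
    moreover have "\<bar>measure \<mu> E - measure \<mu> (cylinders N n V)\<bar> \<le> measure \<mu> (sym_diff E (cylinders N n V))"
      by (rule measure_sym_diff_le[OF mu(1) E]) (simp add: mu(2))
    moreover have "\<bar>measure \<nu> E - measure \<nu> (cylinders N n V)\<bar> \<le> measure \<nu> (sym_diff E (cylinders N n V))"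
      using E by (intro measure_sym_diff_le[OF nu(1)]) (simp_all add: mu(2) nu(2))
    ultimately show ?thesis using V by linarith
  qed
  then have "measure \<mu> E = measure \<nu> E" using field_le_epsilon[of "\<bar>measure \<mu> E - measure \<nu> E\<bar>" 0] by auto
  then show "emeasure \<mu> E = emeasure \<nu> E"
    by (simp add: \<mu>.emeasure_eq_measure \<nu>.emeasure_eq_measure)
qed (use mu nu in auto)

section \<open>Entropy and equilibrium states of the full shift\<close>

locale shift_invariant =
  fixes N :: nat and \<mu> :: "(nat \<Rightarrow> nat) measure"
  assumes invariant: "invariant_measure N \<mu>"
begin

lemma sets_mu: "sets \<mu> = sets (shift_borel N)"
  using invariant by (simp add: invariant_measure_def)

lemma space_mu: "space \<mu> = shift_space N"
  using sets_eq_imp_space_eq[OF sets_mu] by simp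

end

sublocale shift_invariant \<subseteq> measure_preserving \<mu> shift
proof -
  interpret prob_space \<mu> using invariant by (simp add: invariant_measure_def)
  show "measure_preserving \<mu> shift"
  proof
    show "shift \<in> \<mu> \<rightarrow>\<^sub>M \<mu>"
      using shift_measurable[of N] measurable_cong_sets[OF sets_mu sets_mu] by simp
  qed (use invariant in \<open>simp add: invariant_measure_def\<close>)
qed

context shift_invariant
begin

lemma cylinders_events [simp]: "cylinders N n V \<in> events"
  by (simp add: sets_mu)

lemma prob_cylinders: "prob (cylinders N n V) = (\<Sum>w\<in>V \<inter> words N n. prob (cyl N w))"
  by (rule measure_cylinders[OF finite_measure_axioms sets_mu])

lemma init_word_vimage: "init_word n -` V \<inter> space \<mu> = cylinders N n V"
  by (auto simp: cylinders_def space_mu)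

lemma simple_function_init_word: "simple_function \<mu> (init_word n)"
proof -
  have "init_word n ` space \<mu> \<subseteq> words N n" by (auto simp: space_mu)
  then have "finite (init_word n ` space \<mu>)" by (rule finite_subset) simp
  then show ?thesis by (simp add: simple_function_def init_word_vimage)
qed

lemma simple_function_zeroth: "simple_function \<mu> (\<lambda>x. x 0)"
  using simple_function_compose[OF simple_function_init_word[of 1], of hd]
  by (simp add: comp_def init_word_def)

lemma ent_init_word: "ent \<mu> (init_word n) = - (\<Sum>w\<in>words N n. prob (cyl N w) * ln (prob (cyl N w)))"
proof -
  have "init_word n ` space \<mu> \<subseteq> words N n" by (auto simp: space_mu)
  from ent_superset[OF finite_words this] show ?thesis
    unfolding init_word_vimage by (simp add: words_def)
qed

section \<open>The generator theorem for the full shift\<close>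

definition entropy :: real where "entropy = label_entropy (\<lambda>x. x 0)"

lemma entropy_le: "real n * entropy \<le> ent \<mu> (init_word n)"
  unfolding entropy_def using label_entropy_le[OF simple_function_zeroth, of n] by (simp add: itinerary_shift)

lemma entropy_LIMSEQ: "(\<lambda>n. ent \<mu> (init_word n) / real n) \<longlonglongrightarrow> entropy"
  unfolding entropy_def using label_entropy_LIMSEQ[OF simple_function_zeroth] by (simp add: itinerary_shift)

text \<open>The zeroth symbol generates: the level sets of \<open>f\<close> are approximated by
  cylinder sets, so the conditional entropy of \<open>f\<close> given a long enough word is as small
  as desired.\<close>

lemma label_entropy_le_entropy:
  assumes f: "simple_function \<mu> f"
  shows "label_entropy f \<le> entropy"
proof (rule field_le_epsilon)
  fix e :: real assume e: "0 < e"
  define c where "c = real (card (f ` space \<mu>))"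
  have "f ` space \<mu> \<noteq> {}" using not_empty by simp
  then have c: "c > 0" using simple_functionD(1)[OF f] by (simp add: c_def card_gt_0_iff)
  \<comment> \<open>\<open>t\<close> is fixed so that \<open>c * t \<le> e / 2\<close>, and then
    \<open>\<delta>\<close> so that the other two terms of the conditional entropy bound contribute
    \<open>e / 2\<close>.\<close>
  define t where "t = min 1 (e / (2 * c))"
  have t: "0 < t" "t \<le> 1" "c * t \<le> e / 2" using e c by (auto simp: t_def min_def field_simps)
  define \<delta> where "\<delta> = e / (2 * c * (1 + ln (1 / t)))"
  have l: "0 \<le> ln (1 / t)" using t by simp
  then have \<delta>: "\<delta> > 0" using e c by (simp add: \<delta>_def)
  have "c * (\<delta> + \<delta> * ln (1 / t)) = e / 2"
  proof -
    have "c * (\<delta> + \<delta> * ln (1 / t)) = c * (1 + ln (1 / t)) * \<delta>" by (simp add: algebra_simps)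
    also have "\<dots> = e / 2"
    proof -
      have "1 + ln (1 / t) \<noteq> 0" using l by linarith
      moreover have "c * K * (e / (2 * c * K)) = e / 2" if "K \<noteq> 0" for K
        using c that by (simp add: field_simps)
      ultimately show ?thesis unfolding \<delta>_def by blast
    qed
    finally show ?thesis .
  qed
  then have bound: "c * (\<delta> + \<delta> * ln (1 / t) + t) \<le> e" using t(3) by (simp add: algebra_simps)
  have "\<forall>v. \<exists>n V. \<forall>\<rho>\<in>{\<mu>}. measure \<rho> (sym_diff (f -` {v} \<inter> space \<mu>) (cylinders N n V)) < \<delta>"
  proof
    fix v
    show "\<exists>n V. \<forall>\<rho>\<in>{\<mu>}. measure \<rho> (sym_diff (f -` {v} \<inter> space \<mu>) (cylinders N n V)) < \<delta>"
      by (rule approx_by_cylinders) (use simple_functionD(2)[OF f] \<delta> sets_mu finite_measure_axioms in auto)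
  qed
  then obtain n V where nV: "\<And>v. prob (sym_diff (f -` {v} \<inter> space \<mu>) (cylinders N (n v) (V v))) < \<delta>"
    by (metis singletonI)
  define m where "m = (\<Sum>v\<in>f ` space \<mu>. n v)"
  have "ent \<mu> (\<lambda>x. (f x, init_word m x)) - ent \<mu> (init_word m) \<le> c * (\<delta> + \<delta> * ln (1 / t) + t)"
    unfolding c_def
  proof (rule ent_conditional_le[OF f simple_function_init_word t(1,2)])
    fix v assume v: "v \<in> f ` space \<mu>"
    have "n v \<le> m" unfolding m_def using v simple_functionD(1)[OF f] by (intro member_le_sum) auto
    let ?V = "{w. take (n v) w \<in> V v}"
    have eq: "cylinders N (n v) (V v) = cylinders N m ?V" using \<open>n v \<le> m\<close> by (rule cylinders_lift)
    have D: "sym_diff (f -` {v} \<inter> space \<mu>) (cylinders N (n v) (V v)) \<in> events"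
      by (intro sets.Un sets.Diff cylinders_events simple_functionD(2)[OF f])
    have "prob ((f -` {v} \<inter> space \<mu>) - init_word m -` ?V) \<le> prob (sym_diff (f -` {v} \<inter> space \<mu>) (cylinders N (n v) (V v)))"
      by (rule finite_measure_mono[OF _ D]) (auto simp: cylinders_def space_mu take_init_word[OF \<open>n v \<le> m\<close>])
    moreover have "prob ((init_word m -` ?V \<inter> space \<mu>) - f -` {v}) \<le> prob (sym_diff (f -` {v} \<inter> space \<mu>) (cylinders N (n v) (V v)))"
      by (rule finite_measure_mono[OF _ D]) (auto simp: cylinders_def space_mu take_init_word[OF \<open>n v \<le> m\<close>])
    ultimately show "\<exists>V. prob ((f -` {v} \<inter> space \<mu>) - init_word m -` V) < \<delta> \<and>
        prob ((init_word m -` V \<inter> space \<mu>) - f -` {v}) < \<delta>"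
      using nV[of v] by (intro exI[of _ ?V]) linarith
  qed
  then show "label_entropy f \<le> entropy + e"
    using label_entropy_conditional[OF f simple_function_zeroth, of m] bound
    by (simp add: entropy_def itinerary_shift)
qed

text \<open>The supremum over partitions is attained at the partition by the zeroth symbol. In
  particular it is a real number, computable from the measures of words.\<close>

theorem ks_entropy_eq: "ks_entropy \<mu> shift = ereal entropy"
  unfolding ks_entropy_def
proof (rule antisym[OF SUP_least SUP_upper2])
  fix P assume "P \<in> {P. finite P \<and> P \<subseteq> events \<and> partition_on (space \<mu>) P}"
  then show "ereal (entropy_wrt_partition \<mu> shift P) \<le> ereal entropy"
    by (simp add: entropy_wrt_partition_eq label_entropy_le_entropy simple_function_partition_label)
next
  let ?P = "fibres \<mu> (\<lambda>x. x 0)"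
  have P: "partition_on (space \<mu>) ?P"
    by (auto simp: partition_on_def fibres_def disjoint_def)
  have "?P = (\<lambda>v. (\<lambda>x. x 0) -` {v} \<inter> space \<mu>) ` (\<lambda>x. x 0) ` space \<mu>"
    by (auto simp: fibres_def)
  then show "?P \<in> {P. finite P \<and> P \<subseteq> events \<and> partition_on (space \<mu>) P}"
    using P simple_functionD[OF simple_function_zeroth] by auto
  have lab: "partition_label ?P a = partition_label ?P b \<longleftrightarrow> a 0 = b 0" if "a \<in> space \<mu>" "b \<in> space \<mu>" for a b
  proof -
    have "partition_label ?P x = (\<lambda>x. x 0) -` {x 0} \<inter> space \<mu>" if "x \<in> space \<mu>" for x
      by (rule partition_label_eq[OF P]) (use that in \<open>auto simp: fibres_def\<close>)
    then show ?thesis using that by auto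
  qed
  have "label_entropy (partition_label ?P) = label_entropy (\<lambda>x. x 0)"
  proof -
    have "ent \<mu> (itinerary (partition_label ?P) shift n) = ent \<mu> (itinerary (\<lambda>x. x 0) shift n)" for n
      by (rule ent_cong_fibres) (auto simp: itinerary_eq_iff lab funpow_in_space[OF T_space])
    then show ?thesis unfolding label_entropy_def by (simp only:)
  qed
  then show "ereal entropy \<le> ereal (entropy_wrt_partition \<mu> shift ?P)"
    by (simp add: entropy_wrt_partition_eq[OF P] entropy_def)
qed

end

section \<open>Submultiplicative potentials and the variational principle\<close>

lemma length_words: "w \<in> words N n \<Longrightarrow> length w = n"
  by (simp add: words_def)

lemma append_in_words: "u \<in> words N m \<Longrightarrow> v \<in> words N n \<Longrightarrow> u @ v \<in> words N (m + n)"
  by (auto simp: words_def)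

lemma words_add: "words N (m + n) = (\<lambda>(u, v). u @ v) ` (words N m \<times> words N n)"
proof (intro equalityI subsetI)
  fix w assume w: "w \<in> words N (m + n)"
  then have "take m w \<in> words N m" "drop m w \<in> words N n"
    by (auto simp: words_def dest: in_set_takeD in_set_dropD)
  then have "(\<lambda>(u, v). u @ v) (take m w, drop m w) \<in> (\<lambda>(u, v). u @ v) ` (words N m \<times> words N n)"
    by (intro imageI) simp
  then show "w \<in> (\<lambda>(u, v). u @ v) ` (words N m \<times> words N n)" by simp
qed (auto intro: append_in_words)

lemma sum_words_add:
  "(\<Sum>w\<in>words N (m + n). f w) = (\<Sum>u\<in>words N m. \<Sum>v\<in>words N n. f (u @ v))"
proof -
  have "inj_on (\<lambda>(u, v). u @ v) (words N m \<times> words N n)"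
    by (auto simp: inj_on_def words_def)
  then show ?thesis
    unfolding words_add by (subst sum.reindex) (simp_all add: sum.cartesian_product case_prod_beta)
qed

text \<open>The exponential lower bound supplies the linear lower bound under which the averaged
  logarithms of these weights have finite subadditive limits.\<close>

locale submultiplicative =
  fixes N :: nat and \<phi> :: "nat list \<Rightarrow> real"
  assumes pos: "w \<in> words N n \<Longrightarrow> 0 < \<phi> w"
    and submult: "u \<in> words N m \<Longrightarrow> v \<in> words N n \<Longrightarrow> \<phi> (u @ v) \<le> \<phi> u * \<phi> v"
    and lower: "\<exists>K. \<forall>n. \<forall>w\<in>words N n. exp (- K * real n) \<le> \<phi> w"

text \<open>Jensen's inequality for the logarithm with unnormalised weights, obtained from
  \<open>ln r \<le> r - 1\<close> at \<open>r = m a * P / (p a * M)\<close>.\<close>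

lemma log_sum_inequality:
  fixes p m :: "'a \<Rightarrow> real"
  assumes fin: "finite A" and p: "\<And>a. a \<in> A \<Longrightarrow> 0 \<le> p a" and m: "\<And>a. a \<in> A \<Longrightarrow> 0 < m a"
  shows "(\<Sum>a\<in>A. p a * (ln (m a) - ln (p a))) \<le> sum p A * (ln (sum m A) - ln (sum p A))"
proof (cases "sum p A = 0")
  case True
  then have "\<And>a. a \<in> A \<Longrightarrow> p a = 0" using fin p by (simp add: sum_nonneg_eq_0_iff)
  then show ?thesis by (simp add: True)
next
  case False
  define P M where "P = sum p A" and "M = sum m A"
  have P: "P > 0" using False p by (simp add: P_def sum_nonneg order.strict_iff_order)
  have "A \<noteq> {}" using False by auto
  then have M: "M > 0" unfolding M_def using fin m by (intro sum_pos) auto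
  have "p a * (ln (m a) - ln (p a)) \<le> p a * (ln M - ln P) + (m a * P / M - p a)" if a: "a \<in> A" for a
  proof (cases "p a = 0")
    case True
    then show ?thesis using m[OF a] P M by simp
  next
    case False
    then have pa: "p a > 0" using p[OF a] by simp
    have "ln (m a * P / (p a * M)) \<le> m a * P / (p a * M) - 1"
      using pa m[OF a] P M by (intro ln_le_minus_one) auto
    then have "p a * ln (m a * P / (p a * M)) \<le> p a * (m a * P / (p a * M) - 1)"
      using pa by (intro mult_left_mono) auto
    moreover have "ln (m a * P / (p a * M)) = ln (m a) + ln P - ln (p a) - ln M"
      using pa m[OF a] P M by (simp add: ln_div ln_mult)
    moreover have "p a * (m a * P / (p a * M) - 1) = m a * P / M - p a"
      using pa M by (simp add: field_simps)
    ultimately have "p a * (ln (m a) + ln P - ln (p a) - ln M) \<le> m a * P / M - p a"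
      by (simp only:)
    then show ?thesis by (simp add: algebra_simps)
  qed
  then have "(\<Sum>a\<in>A. p a * (ln (m a) - ln (p a))) \<le> (\<Sum>a\<in>A. p a * (ln M - ln P) + (m a * P / M - p a))"
    by (intro sum_mono)
  also have "\<dots> = P * (ln M - ln P) + (M * P / M - P)"
    by (simp add: sum.distrib sum_subtractf sum_distrib_right[symmetric] sum_divide_distrib[symmetric] P_def M_def)
  also have "\<dots> = P * (ln M - ln P)" using M by simp
  finally show ?thesis by (simp add: P_def M_def)
qed

context shift_invariant
begin

lemma prob_prefix_sum:
  assumes u: "u \<in> words N m"
  shows "(\<Sum>v\<in>words N n. prob (cyl N (u @ v))) = prob (cyl N u)"
proof -
  have len: "length u = m" using u by (simp add: words_def)
  have "cyl N u = cylinders N (m + n) {w. take m w = u}"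
    using cylinders_lift[of m "m + n" N "{u}"] len by simp
  moreover have "{w. take m w = u} \<inter> words N (m + n) = (\<lambda>v. u @ v) ` words N n"
  proof (intro equalityI subsetI)
    fix w assume "w \<in> {w. take m w = u} \<inter> words N (m + n)"
    then have "w = u @ drop m w" "drop m w \<in> words N n"
      by (auto simp: words_def dest: in_set_dropD)
    then show "w \<in> (\<lambda>v. u @ v) ` words N n" by blast
  qed (use append_in_words[OF u] len in auto)
  ultimately show ?thesis
    using prob_cylinders[of "m + n" "{w. take m w = u}"]
    by (simp add: sum.reindex inj_on_def)
qed

lemma prob_shift_cylinders: "prob ((shift ^^ m) -` cylinders N n V \<inter> space \<mu>) = prob (cylinders N n V)"
  by (rule prob_funpow) simp

lemma shift_vimage_cyl:
  assumes "v \<in> words N n"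
  shows "(shift ^^ m) -` cyl N v \<inter> space \<mu> = cylinders N (m + n) {w. drop m w = v}"
proof -
  have "drop m (init_word (m + n) x) = init_word n ((shift ^^ m) x)" for x
    by (simp add: init_word_add shift_funpow)
  then show ?thesis
    using assms funpow_in_space[OF shift_in_shift_space, of _ N m]
    by (auto simp: cylinders_def space_mu words_def)
qed

text \<open>Consistency on the left is where invariance enters: the sum is the measure of a preimage
  of the cylinder under a power of the shift.\<close>

lemma prob_suffix_sum:
  assumes v: "v \<in> words N n"
  shows "(\<Sum>u\<in>words N m. prob (cyl N (u @ v))) = prob (cyl N v)"
proof -
  have "{w. drop m w = v} \<inter> words N (m + n) = (\<lambda>u. u @ v) ` words N m"
  proof (intro equalityI subsetI)
    fix w assume w: "w \<in> {w. drop m w = v} \<inter> words N (m + n)"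
    then have "w = take m w @ v" by (metis (mono_tags) IntD1 append_take_drop_id mem_Collect_eq)
    moreover have "take m w \<in> words N m" using w by (auto simp: words_def dest: in_set_takeD)
    ultimately show "w \<in> (\<lambda>u. u @ v) ` words N m" by blast
  qed (use append_in_words[OF _ v] in \<open>auto dest: length_words\<close>)
  then show ?thesis
    using prob_cylinders[of "m + n" "{w. drop m w = v}"] prob_shift_cylinders[of m "length v" "{v}"]
      shift_vimage_cyl[OF v, of m]
    by (simp add: sum.reindex inj_on_def)
qed

lemma sum_prob_cyl: "(\<Sum>w\<in>words N n. prob (cyl N w)) = 1"
proof -
  have "cyl N [] = space \<mu>" by (auto simp: cylinders_def space_mu init_word_def)
  then show ?thesis using prob_prefix_sum[of "[]" 0 n] by (simp add: prob_space)
qed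

lemma integral_init_word:
  fixes h :: "nat list \<Rightarrow> real"
  shows "(\<integral>x. h (init_word n x) \<partial>\<mu>) = (\<Sum>w\<in>words N n. prob (cyl N w) * h w)"
proof -
  have "(\<integral>x. h (init_word n x) \<partial>\<mu>) = (\<integral>x. (\<Sum>w\<in>words N n. indicator (cyl N w) x * h w) \<partial>\<mu>)"
  proof (rule Bochner_Integration.integral_cong[OF refl])
    fix x assume "x \<in> space \<mu>"
    then have x: "x \<in> shift_space N" by (simp add: space_mu)
    have "(\<Sum>w\<in>words N n. indicator (cyl N w) x * h w) = (\<Sum>w\<in>words N n. if w = init_word n x then h w else 0)"
      using x by (intro sum.cong refl) (auto simp: cylinders_def words_def indicator_def)
    then show "h (init_word n x) = (\<Sum>w\<in>words N n. indicator (cyl N w) x * h w)" using x by simp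
  qed
  also have "\<dots> = (\<Sum>w\<in>words N n. prob (cyl N w) * h w)"
    by (subst Bochner_Integration.integral_sum) (auto simp: less_top[symmetric])
  finally show ?thesis .
qed

definition energy_sum :: "(nat list \<Rightarrow> real) \<Rightarrow> nat \<Rightarrow> real" where
  "energy_sum \<phi> n = (\<Sum>w\<in>words N n. prob (cyl N w) * ln (\<phi> w))"

definition energy :: "(nat list \<Rightarrow> real) \<Rightarrow> real" where
  "energy \<phi> = lim (\<lambda>n. energy_sum \<phi> n / real n)"

lemma energy_sum_add:
  assumes "submultiplicative N \<phi>"
  shows "energy_sum \<phi> (m + n) \<le> energy_sum \<phi> m + energy_sum \<phi> n"
proof -
  interpret submultiplicative N \<phi> by fact
  have "energy_sum \<phi> (m + n) = (\<Sum>u\<in>words N m. \<Sum>v\<in>words N n. prob (cyl N (u @ v)) * ln (\<phi> (u @ v)))"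
    unfolding energy_sum_def by (rule sum_words_add)
  also have "\<dots> \<le> (\<Sum>u\<in>words N m. \<Sum>v\<in>words N n. prob (cyl N (u @ v)) * (ln (\<phi> u) + ln (\<phi> v)))"
  proof (intro sum_mono mult_left_mono)
    fix u v assume uv: "u \<in> words N m" "v \<in> words N n"
    have "ln (\<phi> (u @ v)) \<le> ln (\<phi> u * \<phi> v)"
      using submult[OF uv] pos[OF append_in_words[OF uv]] by simp
    also have "\<dots> = ln (\<phi> u) + ln (\<phi> v)" using pos[OF uv(1)] pos[OF uv(2)] by (simp add: ln_mult)
    finally show "ln (\<phi> (u @ v)) \<le> ln (\<phi> u) + ln (\<phi> v)" .
  qed simp
  also have "\<dots> = (\<Sum>u\<in>words N m. (\<Sum>v\<in>words N n. prob (cyl N (u @ v))) * ln (\<phi> u)) +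
      (\<Sum>v\<in>words N n. (\<Sum>u\<in>words N m. prob (cyl N (u @ v))) * ln (\<phi> v))"
    unfolding distrib_left sum.distrib sum_distrib_right
    by (rule arg_cong2[where f = "(+)", OF refl sum.swap])
  also have "\<dots> = energy_sum \<phi> m + energy_sum \<phi> n"
    unfolding energy_sum_def
    by (intro arg_cong2[where f = "(+)"] sum.cong refl) (simp_all only: prob_prefix_sum prob_suffix_sum)
  finally show ?thesis .
qed

lemma
  assumes sub: "submultiplicative N \<phi>"
  shows energy_LIMSEQ: "(\<lambda>n. energy_sum \<phi> n / real n) \<longlonglongrightarrow> energy \<phi>"
    and energy_le: "real n * energy \<phi> \<le> energy_sum \<phi> n"
proof -
  interpret submultiplicative N \<phi> by fact
  obtain K where K: "\<And>n w. w \<in> words N n \<Longrightarrow> exp (- K * real n) \<le> \<phi> w" using lower by auto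
  have low: "- K * real n \<le> energy_sum \<phi> n" for n
  proof -
    have "(\<Sum>w\<in>words N n. prob (cyl N w) * (- K * real n)) \<le> energy_sum \<phi> n"
      unfolding energy_sum_def
    proof (intro sum_mono mult_left_mono)
      fix w assume w: "w \<in> words N n"
      show "- K * real n \<le> ln (\<phi> w)" using K[OF w] pos[OF w] by (simp add: ln_ge_iff)
    qed simp
    then show ?thesis by (simp only: sum_distrib_right[symmetric] sum_prob_cyl mult_1)
  qed
  obtain L where L: "(\<lambda>n. energy_sum \<phi> n / real n) \<longlonglongrightarrow> L" "\<And>n. real n * L \<le> energy_sum \<phi> n"
    using fekete[of "energy_sum \<phi>" K, OF energy_sum_add[OF sub] low] by blast
  moreover have "energy \<phi> = L" unfolding energy_def using L(1) by (rule limI)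
  ultimately show "(\<lambda>n. energy_sum \<phi> n / real n) \<longlonglongrightarrow> energy \<phi>" "real n * energy \<phi> \<le> energy_sum \<phi> n"
    by auto
qed

text \<open>One estimate behind both the variational principle and absolute continuity. Entropy and
  energy are at most their normalised values at length \<open>n\<close>, \<open>ln \<phi>\<close> is
  replaced by the logarithm of \<open>\<nu>\<close>, and the log sum inequality is applied
  separately to the words in \<open>V\<close> and outside it. The constant \<open>2\<close> pays for
  \<open>- q ln q \<le> 1\<close> on the two pieces, and the mass of \<open>\<nu>\<close> for the
  complement of \<open>V\<close>.\<close>

lemma free_energy_bound:
  assumes sub: "submultiplicative N \<phi>"
    and \<nu>: "finite_measure \<nu>" "sets \<nu> = sets (shift_borel N)"
    and C: "0 < C" "\<And>n w. w \<in> words N n \<Longrightarrow> \<phi> w \<le> C * exp (real n * P) * measure \<nu> (cyl N w)"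
  shows "real n * (entropy + energy \<phi> - P) \<le>
    ln C + 2 + measure \<nu> (space \<nu>) + prob (cylinders N n V) * ln (measure \<nu> (cylinders N n V))"
proof -
  interpret submultiplicative N \<phi> by fact
  interpret \<nu>: finite_measure \<nu> by fact
  define p m where "p = (\<lambda>w. prob (cyl N w))" and "m = (\<lambda>w. measure \<nu> (cyl N w))"
  have m0: "m w > 0" if "w \<in> words N n" for w
  proof -
    have "0 < C * exp (real n * P) * m w" using C(2)[OF that] pos[OF that] by (simp add: m_def)
    then show ?thesis by (rule zero_less_mult_pos) (simp add: C(1))
  qed
  have part: "(\<Sum>w\<in>X \<inter> words N n. p w * (ln (m w) - ln (p w)))
     \<le> prob (cylinders N n X) * ln (measure \<nu> (cylinders N n X)) + 1" for X
  proof -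
    have "(\<Sum>w\<in>X \<inter> words N n. p w * (ln (m w) - ln (p w)))
      \<le> sum p (X \<inter> words N n) * (ln (sum m (X \<inter> words N n)) - ln (sum p (X \<inter> words N n)))"
      using m0 by (intro log_sum_inequality) (auto simp: p_def)
    also have "sum p (X \<inter> words N n) = prob (cylinders N n X)"
      unfolding p_def by (rule prob_cylinders[symmetric])
    also have "sum m (X \<inter> words N n) = measure \<nu> (cylinders N n X)"
      unfolding m_def by (rule measure_cylinders[OF \<nu>, symmetric])
    also have "- (prob (cylinders N n X) * ln (prob (cylinders N n X))) \<le> 1"
    proof (cases "prob (cylinders N n X) = 0")
      case False
      define q where "q = prob (cylinders N n X)"
      have q: "q > 0" using False by (simp add: q_def order.strict_iff_order)
      have "ln (1 / q) \<le> 1 / q - 1" using q by (intro ln_le_minus_one) simp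
      then have "q * ln (1 / q) \<le> q * (1 / q - 1)" using q by (intro mult_left_mono) auto
      also have "\<dots> \<le> 1" using q by (simp add: field_simps)
      finally show ?thesis using q by (simp add: ln_div q_def)
    qed simp
    ultimately show ?thesis by (simp add: right_diff_distrib)
  qed
  have compl: "prob (cylinders N n (- V)) * ln (measure \<nu> (cylinders N n (- V))) \<le> measure \<nu> (space \<nu>)"
  proof -
    define y where "y = measure \<nu> (cylinders N n (- V))"
    have y: "0 \<le> y" "y \<le> measure \<nu> (space \<nu>)"
      unfolding y_def by (auto intro: \<nu>.bounded_measure)
    have "ln y \<le> y" using y(1) ln_le_minus_one[of y] by (cases "y = 0") auto
    then have "prob (cylinders N n (- V)) * ln y \<le> prob (cylinders N n (- V)) * y"
      by (intro mult_left_mono) auto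
    also have "\<dots> \<le> 1 * y" using y by (intro mult_right_mono) auto
    finally show ?thesis using y by (simp add: y_def)
  qed
  have split: "(\<Sum>w\<in>words N n. f w) = (\<Sum>w\<in>V \<inter> words N n. f w) + (\<Sum>w\<in>- V \<inter> words N n. f w)"
    for f :: "nat list \<Rightarrow> real"
    using sum.Int_Diff[of "words N n" f V] by (simp add: Diff_eq Int_commute)
  have "real n * (entropy + energy \<phi>) \<le> ent \<mu> (init_word n) + energy_sum \<phi> n"
    using entropy_le[of n] energy_le[OF sub, of n] by (simp add: distrib_left)
  also have "\<dots> = (\<Sum>w\<in>words N n. p w * (ln (\<phi> w) - ln (p w)))"
    by (simp add: ent_init_word energy_sum_def p_def right_diff_distrib sum_subtractf)
  also have "\<dots> \<le> (\<Sum>w\<in>words N n. p w * (ln C + real n * P) + p w * (ln (m w) - ln (p w)))"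
  proof (intro sum_mono)
    fix w assume w: "w \<in> words N n"
    have "ln (\<phi> w) \<le> ln (C * exp (real n * P) * m w)"
      using C(2)[OF w] pos[OF w] m0[OF w] C(1) by (simp add: m_def)
    also have "\<dots> = ln C + real n * P + ln (m w)" using C(1) m0[OF w] by (simp add: ln_mult)
    finally have "p w * (ln (\<phi> w) - ln (p w)) \<le> p w * (ln C + real n * P + ln (m w) - ln (p w))"
      by (intro mult_left_mono) (auto simp: p_def)
    then show "p w * (ln (\<phi> w) - ln (p w)) \<le> p w * (ln C + real n * P) + p w * (ln (m w) - ln (p w))"
      by (simp add: algebra_simps)
  qed
  also have "\<dots> = ln C + real n * P + (\<Sum>w\<in>words N n. p w * (ln (m w) - ln (p w)))"
    by (simp add: sum.distrib sum_distrib_right[symmetric] p_def sum_prob_cyl)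
  also have "(\<Sum>w\<in>words N n. p w * (ln (m w) - ln (p w)))
    \<le> prob (cylinders N n V) * ln (measure \<nu> (cylinders N n V)) + 1 + (measure \<nu> (space \<nu>) + 1)"
    unfolding split using part[of V] part[of "- V"] compl by linarith
  finally show ?thesis by (simp add: right_diff_distrib)
qed

text \<open>With \<open>V\<close> empty, the excess over \<open>P\<close> stays bounded after
  multiplication by every \<open>n\<close>, hence is not positive. If the excess is zero, a
  \<open>\<nu>\<close>-null set of positive measure would be approximated by cylinder sets of tiny
  \<open>\<nu>\<close> measure, which drives the right side of the estimate below zero.\<close>

theorem variational_principle:
  assumes sub: "submultiplicative N \<phi>"
    and \<nu>: "finite_measure \<nu>" "sets \<nu> = sets (shift_borel N)"
    and C: "0 < C" "\<And>n w. w \<in> words N n \<Longrightarrow> \<phi> w \<le> C * exp (real n * P) * measure \<nu> (cyl N w)"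
  shows "entropy + energy \<phi> \<le> P"
    and "entropy + energy \<phi> = P \<Longrightarrow> E \<in> sets \<mu> \<Longrightarrow> measure \<nu> E = 0 \<Longrightarrow> prob E = 0"
proof -
  interpret \<nu>: finite_measure \<nu> by fact
  define K where "K = ln C + 2 + measure \<nu> (space \<nu>)"
  have bound: "real n * (entropy + energy \<phi> - P) \<le> K + prob (cylinders N n V) * ln (measure \<nu> (cylinders N n V))"
    for n V using free_energy_bound[OF sub \<nu> C] by (simp add: K_def)
  show "entropy + energy \<phi> \<le> P"
  proof (rule ccontr)
    assume "\<not> entropy + energy \<phi> \<le> P"
    then have d: "entropy + energy \<phi> - P > 0" by simp
    then obtain n :: nat where "K / (entropy + energy \<phi> - P) < real n" using reals_Archimedean2 by blast
    then have "K < real n * (entropy + energy \<phi> - P)" using d by (simp add: field_simps)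
    moreover have "cylinders N n {} = {}" by (simp add: cylinders_def)
    ultimately show False using bound[of n "{}"] by simp
  qed
  show "prob E = 0" if eq: "entropy + energy \<phi> = P" and E: "E \<in> sets \<mu>" "measure \<nu> E = 0"
  proof (rule ccontr)
    assume "prob E \<noteq> 0"
    then have a: "prob E > 0" by (simp add: order.strict_iff_order)
    \<comment> \<open>Chosen so that the approximating cylinder set keeps at least half of the mass
      of \<open>E\<close>, while the logarithm of its \<open>\<nu>\<close> measure is so negative
      that the product of the two is at most \<open>- (\<bar>K\<bar> + 1)\<close>.\<close>
    define \<epsilon> where "\<epsilon> = min (prob E / 2) (exp (- ((\<bar>K\<bar> + 1) * 2 / prob E)))"
    have \<epsilon>: "0 < \<epsilon>" "\<epsilon> \<le> prob E / 2" "\<epsilon> \<le> exp (- ((\<bar>K\<bar> + 1) * 2 / prob E))"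
      using a by (auto simp: \<epsilon>_def)
    have "\<exists>n V. \<forall>\<rho>\<in>{\<mu>, \<nu>}. measure \<rho> (sym_diff E (cylinders N n V)) < \<epsilon>"
      by (rule approx_by_cylinders) (use \<nu> finite_measure_axioms sets_mu E \<epsilon> in auto)
    then obtain n V where "\<forall>\<rho>\<in>{\<mu>, \<nu>}. measure \<rho> (sym_diff E (cylinders N n V)) < \<epsilon>" by (elim exE)
    then have V: "prob (sym_diff E (cylinders N n V)) < \<epsilon>" "measure \<nu> (sym_diff E (cylinders N n V)) < \<epsilon>"
      by (simp_all only: ball_simps)
    define q m where "q = prob (cylinders N n V)" and "m = measure \<nu> (cylinders N n V)"
    have "\<bar>prob E - q\<bar> < \<epsilon>" "\<bar>measure \<nu> E - m\<bar> < \<epsilon>"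
      using V measure_sym_diff_le[OF finite_measure_axioms E(1), of "cylinders N n V"]
        measure_sym_diff_le[OF \<nu>(1), of E "cylinders N n V"] E(1)
      by (auto simp: q_def m_def \<nu>(2) sets_mu)
    then have q: "q \<ge> prob E / 2" and m: "m < \<epsilon>" using \<epsilon>(2) E(2) by linarith+
    show False
    proof (cases "m = 0")
      case True
      \<comment> \<open>Here \<open>ln 0 = 0\<close> would make the estimate worthless. But
        \<open>\<nu>\<close> charges the cylinder of every word, because \<open>\<phi>\<close> is
        positive, so \<open>V\<close> contains no word of length \<open>n\<close> over the
        alphabet.\<close>
      define h where "h = (\<Sum>w\<in>V \<inter> words N n. measure \<nu> (cyl N w))"
      have "h = 0" using True measure_cylinders[OF \<nu>, of n V] by (simp add: h_def m_def)
      then have z: "\<And>w. w \<in> V \<inter> words N n \<Longrightarrow> measure \<nu> (cyl N w) = 0"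
        unfolding h_def by (subst (asm) sum_nonneg_eq_0_iff) auto
      have "V \<inter> words N n = {}"
      proof (rule ccontr)
        assume "V \<inter> words N n \<noteq> {}"
        then obtain w where w: "w \<in> V \<inter> words N n" by blast
        then have "\<phi> w \<le> 0" using C(2)[of w n] z[OF w] by simp
        moreover have "\<phi> w > 0" using sub w unfolding submultiplicative_def by blast
        ultimately show False by simp
      qed
      then have "q = 0" unfolding q_def by (subst prob_cylinders) simp
      then show False using q a by simp
    next
      case False
      then have m0: "m > 0" by (simp add: m_def order.strict_iff_order)
      have "ln m \<le> ln (exp (- ((\<bar>K\<bar> + 1) * 2 / prob E)))"
        using m m0 \<epsilon>(3) by (subst ln_le_cancel_iff) auto
      then have ln: "ln m \<le> - ((\<bar>K\<bar> + 1) * 2 / prob E)" by simp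
      have "q * ln m \<le> q * (- ((\<bar>K\<bar> + 1) * 2 / prob E))"
        using ln q a by (intro mult_left_mono) auto
      also have "\<dots> \<le> prob E / 2 * (- ((\<bar>K\<bar> + 1) * 2 / prob E))"
        using q a by (intro mult_right_mono_neg) auto
      also have "\<dots> = - (\<bar>K\<bar> + 1)" using a by (simp add: field_simps)
      finally have "K + q * ln m < 0" by linarith
      then show False using bound[of n V] eq by (simp add: q_def m_def)
    qed
  qed
qed

end

section \<open>Mutual singularity of distinct ergodic measures\<close>

text \<open>A positive set \<open>Y\<close> of a Hahn decomposition maximises \<open>d\<close>, the
  difference of the two measures. Sets attaining the maximum are closed under preimages, finite
  unions and monotone limits, so the upper limit of the preimages of \<open>Y\<close> attains it
  too. That set is invariant and has \<open>d > 0\<close>, so ergodicity leaves only the values 1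
  and 0.\<close>

lemma ergodic_measures_singular:
  assumes mu: "ergodic_measure N \<mu>" and nu: "ergodic_measure N \<nu>" and neq: "\<mu> \<noteq> \<nu>"
  obtains E where "E \<in> sets (shift_borel N)" "measure \<mu> E = 1" "measure \<nu> E = 0"
proof -
  interpret \<mu>: shift_invariant N \<mu> by unfold_locales (use mu in \<open>simp add: ergodic_measure_def\<close>)
  interpret \<nu>: shift_invariant N \<nu> by unfold_locales (use nu in \<open>simp add: ergodic_measure_def\<close>)
  note sets = \<mu>.sets_mu \<nu>.sets_mu
  let ?S = "sets (shift_borel N)"
  define d where "d = (\<lambda>E. measure \<mu> E - measure \<nu> E)"
  have "sets \<nu> = sets \<mu>" by (simp add: sets)
  from finite_unsigned_Hahn_decomposition[OF \<mu>.finite_measure_axioms \<nu>.finite_measure_axioms this]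
  obtain Y where Y: "Y \<in> ?S"
    and Y1: "\<And>X. X \<in> ?S \<Longrightarrow> X \<subseteq> Y \<Longrightarrow> 0 \<le> d X" and Y2: "\<And>X. X \<in> ?S \<Longrightarrow> X \<inter> Y = {} \<Longrightarrow> d X \<le> 0"
    unfolding d_def sets \<mu>.emeasure_eq_measure \<nu>.emeasure_eq_measure by auto
  have d_Un: "d (A \<union> B) = d A + d B - d (A \<inter> B)" if "A \<in> ?S" "B \<in> ?S" for A B
    using that measure_Un3[of A \<mu> B] measure_Un3[of A \<nu> B]
    by (simp add: d_def \<mu>.fmeasurable_eq_sets \<nu>.fmeasurable_eq_sets sets)
  have d_empty: "d {} = 0" by (simp add: d_def)
  have max: "d X \<le> d Y" if X: "X \<in> ?S" for X
  proof -
    have "d X = d (X \<inter> Y) + d (X - Y)"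
      using d_Un[of "X \<inter> Y" "X - Y"] X Y d_empty by (simp add: Int_Diff_Un Int_Diff_disjoint)
    moreover have "d Y = d (Y \<inter> X) + d (Y - X)"
      using d_Un[of "Y \<inter> X" "Y - X"] X Y d_empty by (simp add: Int_Diff_Un Int_Diff_disjoint)
    moreover have "d (X - Y) \<le> 0" "0 \<le> d (Y - X)" using X Y by (auto intro: Y1 Y2)
    ultimately show ?thesis by (simp add: Int_commute)
  qed
  \<comment> \<open>If the maximum were not positive, \<open>\<mu>\<close> would be at most
    \<open>\<nu>\<close> on every set and, by passing to complements, equal to it.\<close>
  have pos: "0 < d Y"
  proof (rule ccontr)
    assume "\<not> 0 < d Y"
    then have le: "measure \<mu> X \<le> measure \<nu> X" if "X \<in> ?S" for X using max[OF that] by (simp add: d_def)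
    have "measure \<mu> X = measure \<nu> X" if X: "X \<in> ?S" for X
    proof -
      have "X \<in> sets \<mu>" "X \<in> sets \<nu>" using X by (auto simp: sets)
      moreover have "space \<mu> - X \<in> ?S" using sets.compl_sets[OF X] by (simp add: \<mu>.space_mu)
      from le[OF this] have "measure \<mu> (space \<mu> - X) \<le> measure \<nu> (space \<nu> - X)"
        by (simp add: \<mu>.space_mu \<nu>.space_mu)
      ultimately show ?thesis using le[OF X] by (simp add: \<mu>.prob_compl \<nu>.prob_compl)
    qed
    then have "\<mu> = \<nu>"
      by (intro measure_eqI) (simp_all add: sets \<mu>.emeasure_eq_measure \<nu>.emeasure_eq_measure)
    then show False using neq by simp
  qed
  let ?T = "\<lambda>i X. (shift ^^ i) -` X \<inter> shift_space N"
  have T_S: "?T i X \<in> ?S" if "X \<in> ?S" for i X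
    using measurable_sets[OF \<mu>.measurable_funpow, of X i] that by (simp add: sets \<mu>.space_mu)
  have d_T: "d (?T i X) = d X" if "X \<in> ?S" for i X
    using that \<mu>.prob_funpow[of X i] \<nu>.prob_funpow[of X i]
    by (simp add: d_def sets \<mu>.space_mu \<nu>.space_mu)
  define U where "U = (\<lambda>n. \<Union>i<n. ?T i Y)"
  have U_S: "U n \<in> ?S" for n unfolding U_def using T_S[OF Y] by blast
  have d_U: "d (U (Suc n)) = d Y" for n
  proof (induction n)
    case 0
    have "U (Suc 0) = ?T 0 Y" by (simp add: U_def lessThan_Suc)
    then show ?case using d_T[OF Y, of 0] by simp
  next
    case (Suc n)
    have eq: "U (Suc (Suc n)) = U (Suc n) \<union> ?T (Suc n) Y"
      unfolding U_def lessThan_Suc[of "Suc n"] by blast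
    \<comment> \<open>The values on union and intersection add up to \<open>2 * d Y\<close>, and
      neither exceeds \<open>d Y\<close>, so both equal it.\<close>
    have "d (U (Suc n) \<union> ?T (Suc n) Y) + d (U (Suc n) \<inter> ?T (Suc n) Y) = d Y + d Y"
      using d_Un[OF U_S[of "Suc n"] T_S[OF Y, of "Suc n"]] Suc d_T[OF Y, of "Suc n"] by linarith
    moreover have "d (U (Suc n) \<union> ?T (Suc n) Y) \<le> d Y" "d (U (Suc n) \<inter> ?T (Suc n) Y) \<le> d Y"
      by (intro max sets.Un sets.Int U_S T_S[OF Y])+
    ultimately show ?case unfolding eq by linarith
  qed
  define Z where "Z = (\<Union>n. U (Suc n))"
  have Z_S: "Z \<in> ?S" unfolding Z_def using U_S by blast
  have d_Z: "d Z = d Y"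
  proof -
    have inc: "incseq (\<lambda>n. U (Suc n))"
      unfolding incseq_def U_def by (intro allI impI UN_mono) auto
    have "(\<lambda>n. measure \<mu> (U (Suc n))) \<longlonglongrightarrow> measure \<mu> Z" "(\<lambda>n. measure \<nu> (U (Suc n))) \<longlonglongrightarrow> measure \<nu> Z"
      unfolding Z_def
      by (intro \<mu>.finite_Lim_measure_incseq \<nu>.finite_Lim_measure_incseq inc image_subsetI; unfold sets; rule U_S)+
    then have "(\<lambda>n. d (U (Suc n))) \<longlonglongrightarrow> d Z" unfolding d_def by (intro tendsto_diff)
    then show ?thesis unfolding d_U by (simp add: LIMSEQ_const_iff)
  qed
  have Z_eq: "Z = (\<Union>i. ?T i Y)" unfolding Z_def U_def by auto
  have TT: "?T 1 (?T i X) = ?T (Suc i) X" for i X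
    using shift_in_shift_space[of N] by (auto simp: funpow_swap1)
  have TZ: "?T (Suc i) Z \<subseteq> ?T i Z" for i
  proof
    fix x assume x: "x \<in> ?T (Suc i) Z"
    then obtain j where j: "(shift ^^ Suc i) x \<in> ?T j Y" unfolding Z_eq by blast
    have "(shift ^^ i) x \<in> shift_space N"
      using x funpow_in_space[OF shift_in_shift_space] by blast
    moreover have "(shift ^^ Suc j) ((shift ^^ i) x) = (shift ^^ j) ((shift ^^ Suc i) x)"
      by (simp add: funpow_swap1)
    ultimately have "(shift ^^ i) x \<in> ?T (Suc j) Y" using j by simp
    then show "x \<in> ?T i Z" using x unfolding Z_eq by blast
  qed
  \<comment> \<open>The points that visit \<open>Y\<close> infinitely often.\<close>
  define E where "E = (\<Inter>i. ?T i Z)"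
  have E_S: "E \<in> ?S" unfolding E_def using T_S[OF Z_S] by blast
  have dE: "d E = d Y"
  proof -
    have dec: "decseq (\<lambda>i. ?T i Z)" using TZ by (rule decseq_SucI)
    have "(\<lambda>i. measure \<mu> (?T i Z)) \<longlonglongrightarrow> measure \<mu> E" "(\<lambda>i. measure \<nu> (?T i Z)) \<longlonglongrightarrow> measure \<nu> E"
      unfolding E_def
      by (intro \<mu>.finite_Lim_measure_decseq \<nu>.finite_Lim_measure_decseq dec image_subsetI; unfold sets; rule T_S[OF Z_S])+
    then have "(\<lambda>i. d (?T i Z)) \<longlonglongrightarrow> d E" unfolding d_def by (intro tendsto_diff)
    then show ?thesis unfolding d_T[OF Z_S] d_Z by (simp add: LIMSEQ_const_iff)
  qed
  have inv: "shift -` E \<inter> shift_space N = E"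
  proof (intro equalityI subsetI)
    fix x assume x: "x \<in> shift -` E \<inter> shift_space N"
    have "x \<in> ?T (Suc i) Z" for i
    proof -
      have "shift x \<in> ?T i Z" using x unfolding E_def by blast
      then show ?thesis using x by (simp add: funpow_swap1)
    qed
    then have "x \<in> ?T i Z" for i using TZ by blast
    then show "x \<in> E" unfolding E_def by blast
  next
    fix x assume x: "x \<in> E"
    then have xs: "x \<in> shift_space N" unfolding E_def by blast
    have "shift x \<in> ?T i Z" for i
    proof -
      have "x \<in> ?T (Suc i) Z" using x unfolding E_def by blast
      then show ?thesis using shift_in_shift_space[of N] by (auto simp: funpow_swap1)
    qed
    then show "x \<in> shift -` E \<inter> shift_space N" using xs unfolding E_def by blast
  qed
  have "emeasure \<mu> E = 0 \<or> emeasure \<mu> E = 1" "emeasure \<nu> E = 0 \<or> emeasure \<nu> E = 1"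
    using mu nu inv E_S unfolding ergodic_measure_def by (auto simp: sets \<mu>.space_mu \<nu>.space_mu)
  then have "measure \<mu> E = 0 \<or> measure \<mu> E = 1" "measure \<nu> E = 0 \<or> measure \<nu> E = 1"
    by (auto simp: measure_def)
  moreover have "measure \<mu> E - measure \<nu> E > 0" using dE pos by (simp add: d_def)
  ultimately have "measure \<mu> E = 1" "measure \<nu> E = 0"
    using \<mu>.prob_le_1[of E] measure_nonneg[of \<nu> E] by auto
  then show thesis using E_S by (intro that)
qed

section \<open>Measures from consistent weights on words\<close>

lemma words_1: "words N (Suc 0) = (\<lambda>i. [i]) ` {1..N}"
  by (auto simp: words_def length_Suc_conv)

lemma sum_words_Suc: "(\<Sum>w\<in>words N (Suc n). f w) = (\<Sum>w\<in>words N n. \<Sum>i\<in>{1..N}. f (w @ [i]))"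
  using sum_words_add[of f N n "Suc 0"] by (simp add: words_1 sum.reindex inj_on_def)

lemma sum_words_Suc': "(\<Sum>w\<in>words N (Suc n). f w) = (\<Sum>w\<in>words N n. \<Sum>i\<in>{1..N}. f (i # w))"
  using sum_words_add[of f N "Suc 0" n] by (subst sum.swap) (simp add: words_1 sum.reindex inj_on_def)

lemma snoc_in_words: "w @ [i] \<in> words N (Suc n) \<longleftrightarrow> w \<in> words N n \<and> i \<in> {1..N}"
  by (auto simp: words_def)

text \<open>The unit interval is cut into intervals of length \<open>q w\<close>, nested like the words \<open>w\<close>. A point
  is sent to the sequence coding the intervals that contain it.\<close>

locale consistent_weights =
  fixes N :: nat and q :: "nat list \<Rightarrow> real"
  assumes nonneg: "w \<in> words N n \<Longrightarrow> 0 \<le> q w"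
    and total: "q [] = 1"
    and consistent: "w \<in> words N n \<Longrightarrow> (\<Sum>i\<in>{1..N}. q (w @ [i])) = q w"
begin

text \<open>The recursion runs over the reversed word, since the interval of \<open>w @ [i]\<close>
  is placed inside that of \<open>w\<close>, to the right of those belonging to smaller last
  letters.\<close>

primrec left_rev :: "nat list \<Rightarrow> real" where
  "left_rev [] = 0"
| "left_rev (i # w) = left_rev w + (\<Sum>j\<in>{1..<i}. q (rev w @ [j]))"

definition left :: "nat list \<Rightarrow> real" where "left w = left_rev (rev w)"

text \<open>Half-open intervals make each subdivision an exact partition, and a zero weight gives an
  empty interval.\<close>

definition ivl :: "nat list \<Rightarrow> real set" where "ivl w = {left w ..< left w + q w}"

lemma left_snoc: "left (w @ [i]) = left w + (\<Sum>j\<in>{1..<i}. q (w @ [j]))"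
  by (simp add: left_def)

lemma ivl_Nil: "ivl [] = {0..<1}"
  by (simp add: ivl_def left_def total)

lemma ivl_split:
  assumes w: "w \<in> words N n" and x: "x \<in> ivl w"
  shows "\<exists>!i. i \<in> {1..N} \<and> x \<in> ivl (w @ [i])"
proof -
  \<comment> \<open>The cut points inside \<open>ivl w\<close>; both \<open>S 0\<close> and
    \<open>S 1\<close> are its left endpoint.\<close>
  define S where "S = (\<lambda>i. left w + (\<Sum>j\<in>{1..<i}. q (w @ [j])))"
  have q0: "q (w @ [j]) \<ge> 0" if "j \<in> {1..N}" for j
    using nonneg[of "w @ [j]" "Suc n"] w that by (simp add: snoc_in_words)
  have S_Suc: "S (Suc i) = S i + q (w @ [i])" if "1 \<le> i" for i
    using that by (simp add: S_def)
  have mono: "S i \<le> S i'" if "i \<le> i'" "i' \<le> Suc N" for i i'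
    unfolding S_def using that q0 by (intro add_left_mono sum_mono2) auto
  have ivl: "ivl (w @ [i]) = {S i ..< S (Suc i)}" if "1 \<le> i" for i
    unfolding ivl_def left_snoc S_Suc[OF that] by (simp add: S_def add.assoc)
  have "x < S (Suc N)" "S 1 \<le> x"
    using x consistent[OF w] by (simp_all add: ivl_def S_def atLeastLessThanSuc_atLeastAtMost)
  define i where "i = (LEAST i. x < S (Suc i))"
  have i: "x < S (Suc i)" "i \<le> N"
    unfolding i_def using \<open>x < S (Suc N)\<close> by (auto intro: LeastI Least_le)
  have i1: "1 \<le> i"
  proof (rule ccontr)
    assume "\<not> 1 \<le> i"
    then have "i = 0" by simp
    then show False using i(1) \<open>S 1 \<le> x\<close> by simp
  qed
  have "\<not> x < S (Suc (i - 1))" 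
    using not_less_Least[of "i - 1" "\<lambda>i. x < S (Suc i)"] i1 unfolding i_def[symmetric] by simp
  then have "S i \<le> x" using i1 by simp
  show ?thesis
  proof (rule ex1I[of _ i])
    show "i \<in> {1..N} \<and> x \<in> ivl (w @ [i])" using i i1 \<open>S i \<le> x\<close> by (simp add: ivl)
    fix k assume k: "k \<in> {1..N} \<and> x \<in> ivl (w @ [k])"
    then have "S k \<le> x" "x < S (Suc k)" by (auto simp: ivl)
    show "k = i"
    proof (rule ccontr)
      assume "k \<noteq> i"
      then consider "Suc k \<le> i" | "Suc i \<le> k" by linarith
      then show False
      proof cases
        case 1
        then show False using mono[of "Suc k" i] i \<open>S i \<le> x\<close> \<open>x < S (Suc k)\<close> by simp
      next
        case 2
        then show False using mono[of "Suc i" k] i k \<open>S k \<le> x\<close> by simp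
      qed
    qed
  qed
qed

lemma ivl_snoc_subset:
  assumes w: "w \<in> words N n" and i: "i \<in> {1..N}"
  shows "ivl (w @ [i]) \<subseteq> ivl w"
proof -
  have q0: "q (w @ [j]) \<ge> 0" if "j \<in> {1..N}" for j
    using nonneg[of "w @ [j]" "Suc n"] w that by (simp add: snoc_in_words)
  have "(\<Sum>j\<in>{1..<i}. q (w @ [j])) + q (w @ [i]) = (\<Sum>j\<in>{1..<Suc i}. q (w @ [j]))"
    using i by simp
  also have "\<dots> \<le> (\<Sum>j\<in>{1..N}. q (w @ [j]))" using i q0 by (intro sum_mono2) auto
  finally have "left (w @ [i]) + q (w @ [i]) \<le> left w + q w"
    using consistent[OF w] by (simp add: left_snoc)
  moreover have "left w \<le> left (w @ [i])"
    unfolding left_snoc le_add_same_cancel1 by (intro sum_nonneg q0) (use i in auto)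
  ultimately show ?thesis by (auto simp: ivl_def)
qed

lemma ivl_unique:
  assumes "x \<in> {0..<1}"
  shows "\<exists>!w. w \<in> words N n \<and> x \<in> ivl w"
proof (induction n)
  case 0
  then show ?case using assms by (auto simp: ivl_Nil)
next
  case (Suc n)
  then obtain w where w': "w \<in> words N n \<and> x \<in> ivl w"
    and w_unique: "\<forall>v. v \<in> words N n \<and> x \<in> ivl v \<longrightarrow> v = w" by (rule ex1E)
  from w' have w: "w \<in> words N n" "x \<in> ivl w" by auto
  from ivl_split[OF w] obtain i where i: "i \<in> {1..N} \<and> x \<in> ivl (w @ [i])"
    and i_unique: "\<forall>k. k \<in> {1..N} \<and> x \<in> ivl (w @ [k]) \<longrightarrow> k = i"
    by (rule ex1E)
  show ?case
  proof (rule ex1I[of _ "w @ [i]"])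
    show "w @ [i] \<in> words N (Suc n) \<and> x \<in> ivl (w @ [i])" using w i by (simp add: snoc_in_words)
    fix v assume v: "v \<in> words N (Suc n) \<and> x \<in> ivl v"
    then have "v \<noteq> []" by (auto simp: words_def)
    then obtain u k where vu: "v = u @ [k]" by (meson rev_exhaust)
    have u: "u \<in> words N n" "k \<in> {1..N}" using v vu by (auto simp: snoc_in_words)
    have "x \<in> ivl u" using ivl_snoc_subset[OF u] v vu by auto
    then have "u = w" using w_unique[rule_format, of u] u by simp
    then show "v = w @ [i]" using i_unique[rule_format, of k] u v vu by simp
  qed
qed

definition code_word :: "nat \<Rightarrow> real \<Rightarrow> nat list" where
  "code_word n x = (THE w. w \<in> words N n \<and> x \<in> ivl w)"

definition code :: "real \<Rightarrow> nat \<Rightarrow> nat" where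
  "code x k = last (code_word (Suc k) x)"

lemma code_word:
  assumes "x \<in> {0..<1}"
  shows "code_word n x \<in> words N n" "x \<in> ivl (code_word n x)"
  using theI'[OF ivl_unique[OF assms, of n]] by (auto simp: code_word_def)

lemma code_word_eqI:
  assumes "x \<in> {0..<1}" "w \<in> words N n" "x \<in> ivl w"
  shows "code_word n x = w"
  using ivl_unique[OF assms(1), of n] code_word[OF assms(1), of n] assms by blast

lemma init_word_code:
  assumes x: "x \<in> {0..<1}"
  shows "init_word n (code x) = code_word n x"
proof (induction n)
  case 0
  then show ?case using code_word(1)[OF x, of 0] by (simp add: init_word_def)
next
  case (Suc n)
  have "code_word (Suc n) x \<noteq> []" using code_word(1)[OF x, of "Suc n"] by (auto simp: words_def)
  then obtain u k where uk: "code_word (Suc n) x = u @ [k]" by (meson rev_exhaust)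
  then have u: "u \<in> words N n" "k \<in> {1..N}"
    using code_word(1)[OF x, of "Suc n"] by (auto simp: snoc_in_words)
  then have "x \<in> ivl u" using code_word(2)[OF x, of "Suc n"] uk ivl_snoc_subset[OF u] by auto
  then have "code_word n x = u" using u x by (intro code_word_eqI)
  moreover have "code x n = k" using uk by (simp add: code_def)
  ultimately show ?case using Suc uk by (simp add: init_word_Suc)
qed

lemma code_in_shift_space:
  assumes x: "x \<in> {0..<1}"
  shows "code x \<in> shift_space N"
proof -
  have "code x k \<in> {1..N}" for k
  proof -
    have "set (code_word (Suc k) x) \<subseteq> {1..N}" "code_word (Suc k) x \<noteq> []"
      using code_word(1)[OF x, of "Suc k"] by (auto simp: words_def)
    then show ?thesis unfolding code_def using last_in_set by blast
  qed
  then show ?thesis by (simp add: shift_space_def)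
qed

lemma code_vimage_cyl:
  "code -` cyl N w \<inter> {0..<1} = (if w \<in> words N (length w) then ivl w \<inter> {0..<1} else {})"
proof -
  have "code x \<in> cyl N w \<longleftrightarrow> w \<in> words N (length w) \<and> x \<in> ivl w" if x: "x \<in> {0..<1}" for x
  proof -
    have "code x \<in> cyl N w \<longleftrightarrow> code_word (length w) x = w"
      using code_in_shift_space[OF x] by (simp add: cylinders_def init_word_code[OF x])
    also have "\<dots> \<longleftrightarrow> w \<in> words N (length w) \<and> x \<in> ivl w"
      using code_word[OF x, of "length w"] code_word_eqI[OF x, of w "length w"] by auto
    finally show ?thesis .
  qed
  then show ?thesis by auto
qed

lemma ivl_subset: "w \<in> words N n \<Longrightarrow> ivl w \<subseteq> {0..<1}"
proof (induction n arbitrary: w)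
  case 0
  then show ?case by (simp add: ivl_Nil)
next
  case (Suc n)
  then have "w \<noteq> []" by (auto simp: words_def)
  then obtain u k where vu: "w = u @ [k]" by (meson rev_exhaust)
  then have u: "u \<in> words N n" "k \<in> {1..N}" using Suc.prems by (auto simp: snoc_in_words)
  show ?case unfolding vu using ivl_snoc_subset[OF u] Suc.IH[OF u(1)] by (rule subset_trans)
qed

text \<open>Lebesgue measure on the unit interval is pushed forward by \<open>code\<close>, under
  which the cylinder of \<open>w\<close> pulls back to \<open>ivl w\<close>.\<close>

theorem ex_measure:
  "\<exists>\<mu>. prob_space \<mu> \<and> sets \<mu> = sets (shift_borel N) \<and>
     (\<forall>n. \<forall>w\<in>words N n. measure \<mu> (cyl N w) = q w)"
proof -
  define M where "M = restrict_space lborel {0..<1::real}"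
  have space: "space M = {0..<1}" by (simp add: M_def space_restrict_space)
  have sets_M: "X \<in> sets M \<longleftrightarrow> X \<in> sets borel \<and> X \<subseteq> {0..<1}" for X
    by (auto simp: M_def sets_restrict_space_iff)
  interpret M: prob_space M
    by (rule prob_spaceI) (simp add: M_def space_restrict_space emeasure_restrict_space)
  have code: "code \<in> measurable M (shift_borel N)"
  proof (rule measurable_sigma_sets[OF sets_shift_borel])
    show "range (cyl N) \<subseteq> Pow (shift_space N)" by (auto simp: cylinders_def)
    show "code \<in> space M \<rightarrow> shift_space N" by (auto simp: space code_in_shift_space)
    fix y assume "y \<in> range (cyl N)"
    then obtain w where y: "y = cyl N w" by auto
    show "code -` y \<inter> space M \<in> sets M"
      unfolding y space code_vimage_cyl by (auto simp: sets_M ivl_def)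
  qed
  define \<mu> where "\<mu> = distr M (shift_borel N) code"
  have "measure \<mu> (cyl N w) = q w" if w: "w \<in> words N n" for w n
  proof -
    have len: "length w = n" using w by (simp add: words_def)
    have "measure \<mu> (cyl N w) = measure M (code -` cyl N w \<inter> space M)"
      unfolding \<mu>_def by (rule measure_distr[OF code cylinders_in_sets])
    also have "code -` cyl N w \<inter> space M = ivl w"
      unfolding space code_vimage_cyl using w ivl_subset[OF w] by (simp add: len Int_absorb2)
    also have "measure M (ivl w) = measure lborel (ivl w)"
      unfolding M_def using ivl_subset[OF w] by (intro measure_restrict_space) auto
    also have "\<dots> = q w" using nonneg[OF w] by (simp add: ivl_def)
    finally show ?thesis .
  qed
  moreover have "prob_space \<mu>" unfolding \<mu>_def by (rule M.prob_space_distr[OF code])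
  ultimately show ?thesis by (intro exI[of _ \<mu>]) (auto simp: \<mu>_def)
qed

end

section \<open>Gibbs measures of quasi-multiplicative potentials\<close>

text \<open>A connecting word of bounded length replaces a lower bound for
  \<open>\<phi> (u @ v)\<close> itself, which fails for norms of matrix products when the directions
  do not match.\<close>

locale quasi_multiplicative = submultiplicative +
  assumes N_pos: "0 < N"
    and quasi: "\<exists>c>0. \<exists>L. \<forall>m n. \<forall>u\<in>words N m. \<forall>v\<in>words N n.
      \<exists>l\<le>L. \<exists>k\<in>words N l. c * \<phi> u * \<phi> v \<le> \<phi> (u @ k @ v)"
begin

section \<open>Partition function and pressure\<close>

definition Z :: "nat \<Rightarrow> real" where "Z n = (\<Sum>w\<in>words N n. \<phi> w)"

lemma words_nonempty: "words N n \<noteq> {}"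
proof -
  have "replicate n 1 \<in> words N n" using N_pos by (auto simp: words_def)
  then show ?thesis by blast
qed

lemma Z_pos: "0 < Z n"
  unfolding Z_def using words_nonempty pos by (intro sum_pos) auto

lemma Z_add_le: "Z (m + n) \<le> Z m * Z n"
proof -
  have "Z (m + n) \<le> (\<Sum>u\<in>words N m. \<Sum>v\<in>words N n. \<phi> u * \<phi> v)"
    unfolding Z_def sum_words_add by (intro sum_mono submult)
  then show ?thesis by (simp add: Z_def sum_product)
qed

text \<open>Sum the connecting inequality over all partners and all connecting words of length at
  most \<open>L\<close>. Moving the connecting word to the far end and splitting it off by
  submultiplicativity costs only the factor \<open>Q\<close>. Hence extending a word by
  \<open>n\<close> letters on either side multiplies its total weight by \<open>Z n\<close> up to a
  constant.\<close>

lemma ex_connecting_constant: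
  obtains D where "1 \<le> D"
    and "\<And>m n x. x \<in> words N m \<Longrightarrow> \<phi> x * Z n \<le> D * (\<Sum>b\<in>words N n. \<phi> (x @ b))"
    and "\<And>m n y. y \<in> words N m \<Longrightarrow> \<phi> y * Z n \<le> D * (\<Sum>a\<in>words N n. \<phi> (a @ y))"
proof -
  obtain c L where c: "c > 0" and quasi':
    "\<And>m n u v. u \<in> words N m \<Longrightarrow> v \<in> words N n \<Longrightarrow> \<exists>l\<le>L. \<exists>k\<in>words N l. c * \<phi> u * \<phi> v \<le> \<phi> (u @ k @ v)"
    using quasi by blast
  define Q where "Q = (\<Sum>l\<le>L. Z l)"
  have Q: "Q > 0" unfolding Q_def using Z_pos by (intro sum_pos) auto
  have uv: "c * \<phi> u * \<phi> v \<le> (\<Sum>l\<le>L. \<Sum>k\<in>words N l. \<phi> (u @ k @ v))"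
    if u: "u \<in> words N m" and v: "v \<in> words N n" for u v m n
  proof -
    obtain l k where lk: "l \<le> L" "k \<in> words N l" "c * \<phi> u * \<phi> v \<le> \<phi> (u @ k @ v)"
      using quasi'[OF u v] by blast
    have nn: "0 \<le> \<phi> (u @ k @ v)" if "k \<in> words N l" for k l
      using pos[OF append_in_words[OF u append_in_words[OF that v]]] by simp
    have "\<phi> (u @ k @ v) \<le> (\<Sum>k\<in>words N l. \<phi> (u @ k @ v))"
      using lk nn by (intro member_le_sum) auto
    also have "\<dots> \<le> (\<Sum>l\<le>L. \<Sum>k\<in>words N l. \<phi> (u @ k @ v))"
      using lk nn by (intro member_le_sum[of l "{..L}" "\<lambda>l. \<Sum>k\<in>words N l. \<phi> (u @ k @ v)"]) (auto intro!: sum_nonneg)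
    finally show ?thesis using lk by linarith
  qed
  have right: "c * (\<phi> x * Z n) \<le> Q * (\<Sum>b\<in>words N n. \<phi> (x @ b))" if x: "x \<in> words N m" for m n x
  proof -
    have "c * (\<phi> x * Z n) = (\<Sum>b\<in>words N n. c * \<phi> x * \<phi> b)"
      by (simp add: Z_def sum_distrib_left mult.assoc)
    also have "\<dots> \<le> (\<Sum>b\<in>words N n. \<Sum>l\<le>L. \<Sum>k\<in>words N l. \<phi> (x @ k @ b))"
      using uv[OF x] by (intro sum_mono) blast
    also have "\<dots> = (\<Sum>l\<le>L. \<Sum>b\<in>words N n. \<Sum>k\<in>words N l. \<phi> (x @ k @ b))" by (rule sum.swap)
    \<comment> \<open>Pairs in either order enumerate the words of length \<open>l + n\<close>, so
      the connecting word may be moved behind \<open>b\<close>.\<close>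
    also have "\<dots> = (\<Sum>l\<le>L. \<Sum>b\<in>words N n. \<Sum>k\<in>words N l. \<phi> (x @ b @ k))"
    proof (rule sum.cong[OF refl])
      fix l
      have "(\<Sum>b\<in>words N n. \<Sum>k\<in>words N l. \<phi> (x @ k @ b)) = (\<Sum>w\<in>words N (l + n). \<phi> (x @ w))"
        unfolding sum_words_add by (rule sum.swap)
      also have "l + n = n + l" by simp
      finally show "(\<Sum>b\<in>words N n. \<Sum>k\<in>words N l. \<phi> (x @ k @ b)) = (\<Sum>b\<in>words N n. \<Sum>k\<in>words N l. \<phi> (x @ b @ k))"
        unfolding sum_words_add .
    qed
    also have "\<dots> \<le> (\<Sum>l\<le>L. \<Sum>b\<in>words N n. \<Sum>k\<in>words N l. \<phi> (x @ b) * \<phi> k)"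
      using submult[OF append_in_words[OF x]] by (intro sum_mono) (metis append_assoc)
    also have "\<dots> = Q * (\<Sum>b\<in>words N n. \<phi> (x @ b))"
      by (simp add: Q_def Z_def sum_distrib_left[symmetric] sum_distrib_right[symmetric] mult.commute)
    finally show ?thesis .
  qed
  have left: "c * (\<phi> y * Z n) \<le> Q * (\<Sum>a\<in>words N n. \<phi> (a @ y))" if y: "y \<in> words N m" for m n y
  proof -
    have "c * (\<phi> y * Z n) = (\<Sum>a\<in>words N n. c * \<phi> a * \<phi> y)"
      by (simp add: Z_def sum_distrib_left mult_ac)
    also have "\<dots> \<le> (\<Sum>a\<in>words N n. \<Sum>l\<le>L. \<Sum>k\<in>words N l. \<phi> (a @ k @ y))"
      using uv[OF _ y] by (intro sum_mono) blast
    also have "\<dots> = (\<Sum>l\<le>L. \<Sum>a\<in>words N n. \<Sum>k\<in>words N l. \<phi> (a @ k @ y))" by (rule sum.swap)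
    also have "\<dots> = (\<Sum>l\<le>L. \<Sum>a\<in>words N n. \<Sum>k\<in>words N l. \<phi> (k @ a @ y))"
    proof (rule sum.cong[OF refl])
      fix l
      have "(\<Sum>a\<in>words N n. \<Sum>k\<in>words N l. \<phi> (a @ k @ y)) = (\<Sum>w\<in>words N (n + l). \<phi> (w @ y))"
        unfolding sum_words_add by simp
      also have "n + l = l + n" by simp
      also have "(\<Sum>w\<in>words N (l + n). \<phi> (w @ y)) = (\<Sum>k\<in>words N l. \<Sum>a\<in>words N n. \<phi> (k @ a @ y))"
        unfolding sum_words_add by simp
      also have "\<dots> = (\<Sum>a\<in>words N n. \<Sum>k\<in>words N l. \<phi> (k @ a @ y))" by (rule sum.swap)
      finally show "(\<Sum>a\<in>words N n. \<Sum>k\<in>words N l. \<phi> (a @ k @ y)) = (\<Sum>a\<in>words N n. \<Sum>k\<in>words N l. \<phi> (k @ a @ y))" .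
    qed
    also have "\<dots> \<le> (\<Sum>l\<le>L. \<Sum>a\<in>words N n. \<Sum>k\<in>words N l. \<phi> k * \<phi> (a @ y))"
      using submult[OF _ append_in_words[OF _ y]] by (intro sum_mono) blast
    also have "\<dots> = Q * (\<Sum>a\<in>words N n. \<phi> (a @ y))"
      by (simp add: Q_def Z_def sum_distrib_left[symmetric] sum_distrib_right[symmetric])
    finally show ?thesis .
  qed
  define D where "D = max 1 (Q / c)"
  have D: "1 \<le> D" "Q / c \<le> D" by (auto simp: D_def)
  have nn: "0 \<le> (\<Sum>b\<in>words N n. \<phi> (x @ b))" "0 \<le> (\<Sum>b\<in>words N n. \<phi> (b @ x))" if "x \<in> words N m" for x m n
    by (rule sum_nonneg, rule less_imp_le,
        (erule pos[OF append_in_words[OF that]] | erule pos[OF append_in_words[OF _ that]]))+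
  show thesis
  proof (rule that[OF D(1)])
    fix m n x assume x: "x \<in> words N m"
    have "\<phi> x * Z n \<le> Q / c * (\<Sum>b\<in>words N n. \<phi> (x @ b))"
      using right[OF x, of n] c by (simp add: field_simps)
    also have "\<dots> \<le> D * (\<Sum>b\<in>words N n. \<phi> (x @ b))"
      using D(2) nn(1)[OF x] by (rule mult_right_mono)
    finally show "\<phi> x * Z n \<le> D * (\<Sum>b\<in>words N n. \<phi> (x @ b))" .
    have "\<phi> x * Z n \<le> Q / c * (\<Sum>b\<in>words N n. \<phi> (b @ x))"
      using left[OF x, of n] c by (simp add: field_simps)
    also have "\<dots> \<le> D * (\<Sum>b\<in>words N n. \<phi> (b @ x))"
      using D(2) nn(2)[OF x] by (rule mult_right_mono)
    finally show "\<phi> x * Z n \<le> D * (\<Sum>b\<in>words N n. \<phi> (b @ x))" .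
  qed
qed

definition press :: real where "press = lim (\<lambda>n. ln (Z n) / real n)"

text \<open>\<open>ln (Z n)\<close> is subadditive and, up to the constant \<open>ln D\<close>,
  superadditive. Fekete's lemma applied to \<open>ln (Z n)\<close> and to
  \<open>ln D - ln (Z n)\<close> bounds it from both sides, and the two limits are opposite.\<close>

lemma
  shows press_LIMSEQ: "(\<lambda>n. ln (Z n) / real n) \<longlonglongrightarrow> press"
    and ex_Z_bounds: "\<exists>D\<ge>1. \<forall>n. exp (real n * press) \<le> Z n \<and> Z n \<le> D * exp (real n * press)"
proof -
  obtain D where D: "1 \<le> D"
    and right: "\<And>m n x. x \<in> words N m \<Longrightarrow> \<phi> x * Z n \<le> D * (\<Sum>b\<in>words N n. \<phi> (x @ b))"
    by (rule ex_connecting_constant) (rule that, assumption+)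
  have ZZ: "Z m * Z n \<le> D * Z (m + n)" for m n
  proof -
    have "Z m * Z n = (\<Sum>x\<in>words N m. \<phi> x * Z n)" by (simp add: Z_def sum_distrib_right)
    also have "\<dots> \<le> (\<Sum>x\<in>words N m. D * (\<Sum>b\<in>words N n. \<phi> (x @ b)))" by (intro sum_mono right)
    also have "\<dots> = D * Z (m + n)" unfolding Z_def sum_words_add by (simp add: sum_distrib_left)
    finally show ?thesis .
  qed
  have sub: "ln (Z (m + n)) \<le> ln (Z m) + ln (Z n)" for m n
  proof -
    have "ln (Z (m + n)) \<le> ln (Z m * Z n)" using Z_add_le[of m n] Z_pos by simp
    then show ?thesis using Z_pos[of m] Z_pos[of n] by (simp add: ln_mult)
  qed
  have sup: "ln (Z m) + ln (Z n) \<le> ln D + ln (Z (m + n))" for m n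
  proof -
    have "ln (Z m * Z n) \<le> ln (D * Z (m + n))"
      using ZZ[of m n] Z_pos[of m] Z_pos[of n] Z_pos[of "m + n"] D by (subst ln_le_cancel_iff) auto
    then show ?thesis using Z_pos[of m] Z_pos[of n] Z_pos[of "m + n"] D by (simp add: ln_mult)
  qed
  obtain K where K: "\<And>n w. w \<in> words N n \<Longrightarrow> exp (- K * real n) \<le> \<phi> w" using lower by auto
  have low: "- K * real n \<le> ln (Z n)" for n
  proof -
    obtain w where w: "w \<in> words N n" using words_nonempty by blast
    have "exp (- K * real n) \<le> \<phi> w" using K[OF w] .
    also have "\<dots> \<le> Z n" unfolding Z_def using w pos by (intro member_le_sum less_imp_le) auto
    finally show ?thesis using Z_pos[of n] by (simp add: ln_ge_iff)
  qed
  obtain L where L: "(\<lambda>n. ln (Z n) / real n) \<longlonglongrightarrow> L" "\<And>n. real n * L \<le> ln (Z n)"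
    using fekete[of "\<lambda>n. ln (Z n)" K, OF sub low] by blast
  have "press = L" unfolding press_def using L(1) by (rule limI)
  then show "(\<lambda>n. ln (Z n) / real n) \<longlonglongrightarrow> press" using L by simp
  have up: "ln (Z n) \<le> ln (Z 0) + real n * ln (Z 1)" for n
  proof (induction n)
    case (Suc n)
    then show ?case using sub[of n 1] by (simp add: algebra_simps)
  qed simp
  \<comment> \<open>The linear lower bound required for the second use of Fekete's lemma; at
    \<open>n = 0\<close> it says \<open>Z 0 \<le> D\<close>.\<close>
  have up': "- (\<bar>ln D - ln (Z 0)\<bar> + \<bar>ln (Z 1)\<bar>) * real n \<le> ln D - ln (Z n)" for n
  proof (cases "n = 0")
    case True
    then show ?thesis using sup[of 0 0] by simp
  next
    case False
    have "ln (Z 1) * real n \<le> \<bar>ln (Z 1)\<bar> * real n" by (intro mult_right_mono) auto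
    moreover have "\<bar>ln D - ln (Z 0)\<bar> * 1 \<le> \<bar>ln D - ln (Z 0)\<bar> * real n"
      using False by (intro mult_left_mono) auto
    moreover have "- \<bar>ln D - ln (Z 0)\<bar> \<le> ln D - ln (Z 0)" by linarith
    moreover have "- (\<bar>ln D - ln (Z 0)\<bar> + \<bar>ln (Z 1)\<bar>) * real n =
        - (\<bar>ln D - ln (Z 0)\<bar> * real n) - \<bar>ln (Z 1)\<bar> * real n" by (simp add: algebra_simps)
    moreover have "real n * ln (Z 1) = ln (Z 1) * real n" by simp
    ultimately show ?thesis using up[of n] unfolding mult_1_right by linarith
  qed
  have sub': "ln D - ln (Z (m + n)) \<le> (ln D - ln (Z m)) + (ln D - ln (Z n))" for m n
    using sup[of m n] by linarith
  obtain L' where L': "(\<lambda>n. (ln D - ln (Z n)) / real n) \<longlonglongrightarrow> L'" "\<And>n. real n * L' \<le> ln D - ln (Z n)"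
    using fekete[of "\<lambda>n. ln D - ln (Z n)", OF sub' up'] by blast
  have "(\<lambda>n. ln D * inverse (real n) - ln (Z n) / real n) \<longlonglongrightarrow> ln D * 0 - L"
    by (intro tendsto_intros L(1) lim_inverse_n)
  then have "(\<lambda>n. (ln D - ln (Z n)) / real n) \<longlonglongrightarrow> - L"
    by (simp add: divide_inverse left_diff_distrib)
  from LIMSEQ_unique[OF L'(1) this] have "L' = - L" .
  have "exp (real n * press) \<le> Z n \<and> Z n \<le> D * exp (real n * press)" for n
  proof
    show "exp (real n * press) \<le> Z n"
      using L(2)[of n] Z_pos[of n] \<open>press = L\<close> by (simp add: ln_ge_iff)
    have "ln (Z n) \<le> ln (D * exp (real n * press))"
      using L'(2)[of n] D \<open>press = L\<close> \<open>L' = - L\<close> by (simp add: ln_mult)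
    then show "Z n \<le> D * exp (real n * press)" using Z_pos[of n] D by simp
  qed
  then show "\<exists>D\<ge>1. \<forall>n. exp (real n * press) \<le> Z n \<and> Z n \<le> D * exp (real n * press)" using D by blast
qed

end

lemma cyl_disjoint:
  assumes "v \<in> words N n" "v' \<in> words N n" "v \<noteq> v'"
  shows "cyl N v \<inter> cyl N v' = {}"
  using assms unfolding cylinders_def words_def by auto

section \<open>Existence of Gibbs measures\<close>

context quasi_multiplicative
begin

definition gibbs :: "(nat \<Rightarrow> nat) measure \<Rightarrow> bool" where
  "gibbs \<mu> \<longleftrightarrow> invariant_measure N \<mu> \<and> (\<exists>C\<ge>1. \<forall>n. \<forall>w\<in>words N n.
     \<phi> w \<le> C * exp (real n * press) * measure \<mu> (cyl N w) \<and>
     exp (real n * press) * measure \<mu> (cyl N w) \<le> C * \<phi> w)"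

text \<open>The total weight of the words in which \<open>u\<close> occurs at position
  \<open>j\<close> with \<open>r\<close> letters after it. Divided by the partition function, it is
  the probability of that occurrence in a random word drawn with weights
  \<open>\<phi>\<close>.\<close>

definition ext_sum :: "nat list \<Rightarrow> nat \<Rightarrow> nat \<Rightarrow> real" where
  "ext_sum u j r = (\<Sum>a\<in>words N j. \<Sum>b\<in>words N r. \<phi> (a @ u @ b))"

lemma ext_sum_nonneg: "u \<in> words N l \<Longrightarrow> 0 \<le> ext_sum u j r"
  unfolding ext_sum_def
proof (intro sum_nonneg)
  fix a b assume "u \<in> words N l" "a \<in> words N j" "b \<in> words N r"
  then show "0 \<le> \<phi> (a @ u @ b)" using pos[of "a @ u @ b" "j + (l + r)"] append_in_words by simp
qed

lemma ext_sum_le: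
  assumes u: "u \<in> words N l"
  shows "ext_sum u j r \<le> Z j * \<phi> u * Z r"
proof -
  have "ext_sum u j r \<le> (\<Sum>a\<in>words N j. \<Sum>b\<in>words N r. \<phi> a * (\<phi> u * \<phi> b))"
    unfolding ext_sum_def
  proof (intro sum_mono)
    fix a b assume ab: "a \<in> words N j" "b \<in> words N r"
    have "\<phi> (a @ u @ b) \<le> \<phi> a * \<phi> (u @ b)" by (rule submult[OF ab(1) append_in_words[OF u ab(2)]])
    also have "\<dots> \<le> \<phi> a * (\<phi> u * \<phi> b)"
      using pos[OF ab(1)] submult[OF u ab(2)] by (intro mult_left_mono) auto
    finally show "\<phi> (a @ u @ b) \<le> \<phi> a * (\<phi> u * \<phi> b)" .
  qed
  also have "\<dots> = Z j * \<phi> u * Z r"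
    by (simp add: Z_def sum_distrib_left[symmetric] sum_distrib_right[symmetric] mult.assoc)
  finally show ?thesis .
qed

lemma ext_sum_snoc: "(\<Sum>i\<in>{1..N}. ext_sum (u @ [i]) j r) = ext_sum u j (Suc r)"
proof -
  have "(\<Sum>i\<in>{1..N}. ext_sum (u @ [i]) j r)
      = (\<Sum>a\<in>words N j. \<Sum>i\<in>{1..N}. \<Sum>b\<in>words N r. \<phi> (a @ (u @ [i]) @ b))"
    unfolding ext_sum_def by (rule sum.swap)
  also have "\<dots> = (\<Sum>a\<in>words N j. \<Sum>b\<in>words N r. \<Sum>i\<in>{1..N}. \<phi> (a @ (u @ [i]) @ b))"
    by (intro sum.cong refl sum.swap)
  finally show ?thesis unfolding ext_sum_def sum_words_Suc' by simp
qed

lemma ext_sum_Cons: "(\<Sum>i\<in>{1..N}. ext_sum (i # u) j r) = ext_sum u (Suc j) r"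
proof -
  have "(\<Sum>i\<in>{1..N}. ext_sum (i # u) j r)
      = (\<Sum>a\<in>words N j. \<Sum>i\<in>{1..N}. \<Sum>b\<in>words N r. \<phi> (a @ (i # u) @ b))"
    unfolding ext_sum_def by (rule sum.swap)
  then show ?thesis unfolding ext_sum_def sum_words_Suc by simp
qed

lemma ext_sum_Nil: "ext_sum [] j r = Z (j + r)"
  by (simp add: ext_sum_def Z_def sum_words_add)

lemma ext_sum_le_Z:
  assumes u: "u \<in> words N l"
  shows "ext_sum u j r \<le> Z (j + l + r)"
proof -
  have "Z (j + l + r) = (\<Sum>a\<in>words N j. \<Sum>x\<in>words N l. \<Sum>b\<in>words N r. \<phi> (a @ x @ b))"
    unfolding Z_def add.assoc sum_words_add ..
  also have "\<dots> \<ge> ext_sum u j r" unfolding ext_sum_def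
  proof (rule sum_mono)
    fix a assume a: "a \<in> words N j"
    have "0 \<le> \<phi> (a @ x @ b)" if "x \<in> words N l" "b \<in> words N r" for x b
      using pos[OF append_in_words[OF a append_in_words[OF that]]] by simp
    then show "(\<Sum>b\<in>words N r. \<phi> (a @ u @ b)) \<le> (\<Sum>x\<in>words N l. \<Sum>b\<in>words N r. \<phi> (a @ x @ b))"
      by (intro member_le_sum[of u "words N l" "\<lambda>x. \<Sum>b\<in>words N r. \<phi> (a @ x @ b)"] u sum_nonneg) auto
  qed
  finally show ?thesis .
qed

lemma average_bounds:
  fixes a b :: real
  assumes n: "0 < n" and T: "\<And>j. j < n \<Longrightarrow> a \<le> T j \<and> T j \<le> b"
  shows "a \<le> (\<Sum>j<n. T j) / real n" "(\<Sum>j<n. T j) / real n \<le> b"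
proof -
  have "of_nat (card {..<n}) * a \<le> (\<Sum>j<n. T j)" using T by (intro sum_bounded_below) auto
  then show "a \<le> (\<Sum>j<n. T j) / real n" using n by (simp add: field_simps)
  have "(\<Sum>j<n. T j) \<le> of_nat (card {..<n}) * b" using T by (intro sum_bounded_above) auto
  then show "(\<Sum>j<n. T j) / real n \<le> b" using n by (simp add: field_simps)
qed

text \<open>Draw a word of length \<open>2 * n\<close> with weights \<open>\<phi>\<close> and look
  for \<open>u\<close> at a position chosen uniformly among the first \<open>n\<close>. A pointwise
  limit along a subsequence gives weights on words. Consistency on the right holds already at finite
  \<open>n\<close>; consistency on the left appears only in the limit and is invariance. Each
  position obeys the Gibbs bounds with one constant, so the limit does.\<close>

theorem ex_gibbs: "\<exists>\<mu>. gibbs \<mu>"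
proof -
  obtain D1 where D1: "1 \<le> D1"
    and right: "\<And>m n x. x \<in> words N m \<Longrightarrow> \<phi> x * Z n \<le> D1 * (\<Sum>b\<in>words N n. \<phi> (x @ b))"
    and left: "\<And>m n y. y \<in> words N m \<Longrightarrow> \<phi> y * Z n \<le> D1 * (\<Sum>a\<in>words N n. \<phi> (a @ y))"
    by (rule ex_connecting_constant) (rule that, assumption+)
  obtain D2 where D2: "D2 \<ge> 1" and Zb: "\<And>n. exp (real n * press) \<le> Z n" "\<And>n. Z n \<le> D2 * exp (real n * press)"
    using ex_Z_bounds by blast
  have ext_sum_ge: "\<phi> u * Z j * Z r \<le> D1 * D1 * ext_sum u j r" if u: "u \<in> words N l" for u l j r
  proof -
    have "\<phi> u * Z r * Z j \<le> D1 * (\<Sum>b\<in>words N r. \<phi> (u @ b)) * Z j"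
      using right[OF u] Z_pos[of j] by (intro mult_right_mono) auto
    also have "\<dots> = D1 * (\<Sum>b\<in>words N r. \<phi> (u @ b) * Z j)" by (simp add: sum_distrib_right)
    also have "\<dots> \<le> D1 * (\<Sum>b\<in>words N r. D1 * (\<Sum>a\<in>words N j. \<phi> (a @ u @ b)))"
      using D1 left[OF append_in_words[OF u]] by (intro mult_left_mono sum_mono) auto
    also have "\<dots> = D1 * D1 * ext_sum u j r"
      unfolding ext_sum_def by (subst sum.swap) (simp add: sum_distrib_left mult.assoc)
    finally show ?thesis by (simp add: mult_ac)
  qed
  \<comment> \<open>The first summand serves the upper estimate, which loses \<open>D2\<close> for
    each of the two flanks. The second serves the lower one, which loses \<open>D1\<close> on each
    side and \<open>D2\<close> for the normalisation.\<close>
  define K where "K = D2 * D2 + D1 * D1 * D2"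
  have K: "K \<ge> 1" "D2 * D2 \<le> K" "D1 * D1 * D2 \<le> K"
  proof -
    have "1 * 1 \<le> D2 * D2" using D2 by (intro mult_mono) auto
    moreover have "0 \<le> D1 * D1 * D2" using D1 D2 by simp
    ultimately show "K \<ge> 1" "D2 * D2 \<le> K" "D1 * D1 * D2 \<le> K" unfolding K_def by linarith+
  qed
  \<comment> \<open>Length \<open>2 * n\<close> leaves room for positions and words up to
    \<open>n\<close>, so that the subtraction of naturals is not truncated.\<close>
  define G where "G = (\<lambda>n u j. ext_sum u j (2 * n - j - length u) / Z (2 * n))"
  \<comment> \<open>The value 0 for words longer than \<open>n\<close> keeps \<open>f n\<close>
    bounded on all words; it disappears in the limit.\<close>
  define f where "f = (\<lambda>n u. if length u \<le> n then (\<Sum>j<n. G n u j) / real n else 0)"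
  have G01: "0 \<le> G n u j \<and> G n u j \<le> 1" if "u \<in> words N l" "l \<le> n" "j \<le> n" for n u j l
  proof -
    have len: "length u = l" using that by (simp add: words_def)
    have "ext_sum u j (2 * n - j - l) \<le> Z (2 * n)"
      using ext_sum_le_Z[OF that(1), of j "2 * n - j - l"] that(2,3) by simp
    then show ?thesis using ext_sum_nonneg[OF that(1)] Z_pos[of "2 * n"] by (simp add: G_def len)
  qed
  have G_bounds: "exp (- (real l * press)) * \<phi> u / K \<le> G n u j \<and> G n u j \<le> K * (exp (- (real l * press)) * \<phi> u)"
    if "u \<in> words N l" "l \<le> n" "j < n" for n u j l
  proof -
    have len: "length u = l" using that by (simp add: words_def)
    define r where "r = 2 * n - j - l"
    have jr: "j + r + l = 2 * n" using that by (simp add: r_def)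
    have "real (2 * n) = real j + real r + real l" unfolding jr[symmetric] by simp
    then have e: "exp (real j * press) * exp (real r * press) = exp (real (2 * n) * press) * exp (- (real l * press))"
      by (simp add: exp_add[symmetric] algebra_simps)
    have ph: "\<phi> u > 0" using pos that by blast
    have Zn: "Z (2 * n) > 0" by (rule Z_pos)
    have "ext_sum u j r \<le> Z j * \<phi> u * Z r" by (rule ext_sum_le[OF that(1)])
    also have "\<dots> \<le> (D2 * exp (real j * press)) * \<phi> u * (D2 * exp (real r * press))"
      using Zb(2)[of j] Zb(2)[of r] Z_pos[of j] Z_pos[of r] ph D2 by (intro mult_mono) auto
    also have "\<dots> = D2 * D2 * \<phi> u * (exp (real j * press) * exp (real r * press))" by (simp add: mult_ac)
    also have "\<dots> = D2 * D2 * (exp (- (real l * press)) * \<phi> u) * exp (real (2 * n) * press)"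
      unfolding e by (simp add: mult_ac)
    also have "\<dots> \<le> K * (exp (- (real l * press)) * \<phi> u) * Z (2 * n)"
      using K Zb(1)[of "2 * n"] ph D2 by (intro mult_mono) auto
    finally have 1: "ext_sum u j r \<le> K * (exp (- (real l * press)) * \<phi> u) * Z (2 * n)" .
    have "(exp (- (real l * press)) * \<phi> u) * Z (2 * n) \<le> (exp (- (real l * press)) * \<phi> u) * (D2 * exp (real (2 * n) * press))"
      using Zb(2)[of "2 * n"] ph by (intro mult_left_mono) auto
    also have "\<dots> = D2 * (\<phi> u * (exp (real j * press) * exp (real r * press)))"
      unfolding e by (simp add: mult_ac)
    also have "\<dots> \<le> D2 * (\<phi> u * (Z j * Z r))"
      using Zb(1)[of j] Zb(1)[of r] ph D2 Z_pos[of j] by (intro mult_left_mono mult_mono) auto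
    also have "\<dots> \<le> D2 * (D1 * D1 * ext_sum u j r)"
      using ext_sum_ge[OF that(1), of j r] D2 by (intro mult_left_mono) (auto simp: mult.assoc)
    also have "\<dots> = (D1 * D1 * D2) * ext_sum u j r" by (simp add: mult_ac)
    also have "\<dots> \<le> K * ext_sum u j r" using K ext_sum_nonneg[OF that(1)] by (intro mult_right_mono) auto
    finally have 2: "(exp (- (real l * press)) * \<phi> u) * Z (2 * n) \<le> K * ext_sum u j r" .
    have G: "G n u j = ext_sum u j r / Z (2 * n)" by (simp add: G_def r_def len)
    show ?thesis unfolding G using 1 2 K(1) Zn by (simp add: field_simps)
  qed
  have f_bounds: "norm (f n u) \<le> 1" if "u \<in> (\<Union>l. words N l)" for n u
  proof (cases "length u \<le> n \<and> 0 < n")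
    case True
    have u: "u \<in> words N (length u)" using that by (auto simp: words_def)
    have "0 \<le> (\<Sum>j<n. G n u j) / real n" "(\<Sum>j<n. G n u j) / real n \<le> 1"
      by (rule average_bounds[of n 0 "G n u" 1]; use True G01[OF u, of n] in simp)+
    then have "\<bar>(\<Sum>j<n. G n u j) / real n\<bar> \<le> 1" by (simp only: abs_of_nonneg)
    moreover have "f n u = (\<Sum>j<n. G n u j) / real n" using True by (simp add: f_def)
    ultimately show ?thesis by (simp only: real_norm_def)
  qed (auto simp: f_def)
  have "countable (\<Union>l. words N l)" by simp
  \<comment> \<open>Diagonal extraction over the countable set of words.\<close>
  then obtain k :: "nat \<Rightarrow> nat" where k: "strict_mono k"
    and conv: "\<And>u. u \<in> (\<Union>l. words N l) \<Longrightarrow> \<exists>l. (\<lambda>n. f (k n) u) \<longlonglongrightarrow> l"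
    by (rule function_convergent_subsequence[where f = f and S = "\<Union>l. words N l" and M = 1, OF _ f_bounds])
      (assumption, rule that, assumption+)
  define q where "q = (\<lambda>u. lim (\<lambda>n. f (k n) u))"
  have q: "(\<lambda>n. f (k n) u) \<longlonglongrightarrow> q u" if u: "u \<in> words N l" for u l
  proof -
    have "\<exists>x. (\<lambda>n. f (k n) u) \<longlonglongrightarrow> x" by (rule conv[of u]) (use u in blast)
    then obtain x where "(\<lambda>n. f (k n) u) \<longlonglongrightarrow> x" by (rule exE)
    then show ?thesis unfolding q_def by (simp add: limI)
  qed
  have k_large: "\<forall>\<^sub>F n in sequentially. m \<le> k n" for m
    using eventually_ge_at_top[of m] by eventually_elim (rule order_trans[OF _ seq_suble[OF k]])
  have q_bounds: "exp (- (real l * press)) * \<phi> u / K \<le> q u" "q u \<le> K * (exp (- (real l * press)) * \<phi> u)" "0 \<le> q u"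
    if u: "u \<in> words N l" for u l
  proof -
    have len: "length u = l" using u by (simp add: words_def)
    have ev: "exp (- (real l * press)) * \<phi> u / K \<le> f n u \<and> f n u \<le> K * (exp (- (real l * press)) * \<phi> u)"
      if n: "Suc l \<le> n" for n
      using average_bounds[of n "exp (- (real l * press)) * \<phi> u / K" "G n u" "K * (exp (- (real l * press)) * \<phi> u)"]
        G_bounds[OF u, of n] n by (simp add: f_def len)
    have "\<forall>\<^sub>F n in sequentially. exp (- (real l * press)) * \<phi> u / K \<le> f (k n) u"
      using k_large[of "Suc l"] by eventually_elim (use ev in blast)
    from tendsto_lowerbound[OF q[OF u] this sequentially_bot]
    show low: "exp (- (real l * press)) * \<phi> u / K \<le> q u" .
    have "\<forall>\<^sub>F n in sequentially. f (k n) u \<le> K * (exp (- (real l * press)) * \<phi> u)"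
      using k_large[of "Suc l"] by eventually_elim (use ev in blast)
    from tendsto_upperbound[OF q[OF u] this sequentially_bot]
    show "q u \<le> K * (exp (- (real l * press)) * \<phi> u)" .
    have "0 \<le> exp (- (real l * press)) * \<phi> u / K" using pos[OF u] K(1) by simp
    then show "0 \<le> q u" using low by linarith
  qed
  have snoc: "(\<Sum>i\<in>{1..N}. q (u @ [i])) = q u" if u: "u \<in> words N l" for u l
  proof -
    have len: "length u = l" using u by (simp add: words_def)
    have "(\<lambda>n. \<Sum>i\<in>{1..N}. f (k n) (u @ [i])) \<longlonglongrightarrow> (\<Sum>i\<in>{1..N}. q (u @ [i]))"
      by (intro tendsto_sum q[of _ "Suc l"]) (use u in \<open>simp add: snoc_in_words\<close>)
    moreover have fn: "(\<Sum>i\<in>{1..N}. f n (u @ [i])) = f n u" if n: "Suc l \<le> n" for n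
    proof -
      have "(\<Sum>i\<in>{1..N}. G n (u @ [i]) j) = G n u j" if j: "j < n" for j
      proof -
        have eq: "2 * n - j - l = Suc (2 * n - j - Suc l)" using j n by simp
        have "(\<Sum>i\<in>{1..N}. G n (u @ [i]) j) = (\<Sum>i\<in>{1..N}. ext_sum (u @ [i]) j (2 * n - j - Suc l)) / Z (2 * n)"
          by (simp add: G_def len sum_divide_distrib)
        then show ?thesis unfolding ext_sum_snoc G_def len eq .
      qed
      then have "(\<Sum>j<n. \<Sum>i\<in>{1..N}. G n (u @ [i]) j) = (\<Sum>j<n. G n u j)" by simp
      moreover have "(\<Sum>i\<in>{1..N}. f n (u @ [i])) = (\<Sum>i\<in>{1..N}. \<Sum>j<n. G n (u @ [i]) j) / real n"
        using n by (simp add: f_def len sum_divide_distrib[symmetric])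
      ultimately show ?thesis using n by (subst (asm) sum.swap) (simp add: f_def len)
    qed
    have "\<forall>\<^sub>F n in sequentially. (\<Sum>i\<in>{1..N}. f (k n) (u @ [i])) = f (k n) u"
      using k_large[of "Suc l"] by eventually_elim (use fn in blast)
    ultimately have "(\<lambda>n. f (k n) u) \<longlonglongrightarrow> (\<Sum>i\<in>{1..N}. q (u @ [i]))"
      by (simp add: tendsto_cong)
    then show ?thesis by (rule LIMSEQ_unique[OF _ q[OF u]])
  qed
  have cons: "(\<Sum>i\<in>{1..N}. q (i # u)) = q u" if u: "u \<in> words N l" for u l
  proof -
    have len: "length u = l" using u by (simp add: words_def)
    have "(\<lambda>n. \<Sum>i\<in>{1..N}. f (k n) (i # u)) \<longlonglongrightarrow> (\<Sum>i\<in>{1..N}. q (i # u))"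
      by (intro tendsto_sum q[of _ "Suc l"]) (use u in \<open>auto simp: words_def\<close>)
    from tendsto_diff[OF this q[OF u]]
    have lim: "(\<lambda>n. (\<Sum>i\<in>{1..N}. f (k n) (i # u)) - f (k n) u) \<longlonglongrightarrow> (\<Sum>i\<in>{1..N}. q (i # u)) - q u" .
    \<comment> \<open>Prepending a letter moves the occurrence by one position, so the two averages
      telescope and differ by at most \<open>1 / n\<close>.\<close>
    have fn: "norm ((\<Sum>i\<in>{1..N}. f n (i # u)) - f n u) \<le> 1 / real n" if n: "Suc l \<le> n" for n
    proof -
      have "(\<Sum>i\<in>{1..N}. G n (i # u) j) = G n u (Suc j)" if j: "j < n" for j
      proof -
        have eq: "2 * n - j - Suc l = 2 * n - Suc j - l" using j n by simp
        have "(\<Sum>i\<in>{1..N}. G n (i # u) j) = (\<Sum>i\<in>{1..N}. ext_sum (i # u) j (2 * n - j - Suc l)) / Z (2 * n)"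
          by (simp add: G_def len sum_divide_distrib)
        then show ?thesis unfolding ext_sum_Cons G_def len eq .
      qed
      then have "(\<Sum>j<n. \<Sum>i\<in>{1..N}. G n (i # u) j) = (\<Sum>j<n. G n u (Suc j))" by simp
      moreover have "(\<Sum>i\<in>{1..N}. f n (i # u)) = (\<Sum>i\<in>{1..N}. \<Sum>j<n. G n (i # u) j) / real n"
        using n by (simp add: f_def len sum_divide_distrib[symmetric])
      ultimately have "(\<Sum>i\<in>{1..N}. f n (i # u)) - f n u = ((\<Sum>j<n. G n u (Suc j)) - (\<Sum>j<n. G n u j)) / real n"
        using n by (subst (asm) sum.swap) (simp add: f_def len diff_divide_distrib)
      also have "(\<Sum>j<n. G n u (Suc j)) - (\<Sum>j<n. G n u j) = G n u n - G n u 0"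
        by (simp add: sum_subtractf[symmetric] sum_lessThan_telescope)
      finally have "(\<Sum>i\<in>{1..N}. f n (i # u)) - f n u = (G n u n - G n u 0) / real n" .
      moreover have "\<bar>G n u n - G n u 0\<bar> \<le> 1"
        using G01[OF u, of n n] G01[OF u, of n 0] n by (simp add: abs_le_iff)
      ultimately show ?thesis by (simp add: divide_right_mono)
    qed
    have "\<forall>\<^sub>F n in sequentially. norm ((\<Sum>i\<in>{1..N}. f (k n) (i # u)) - f (k n) u) \<le> 1 / real n"
      using k_large[of "Suc l"] eventually_gt_at_top[of 0]
    proof eventually_elim
      case (elim n)
      have "1 / real (k n) \<le> 1 / real n" using seq_suble[OF k, of n] elim by (simp add: frac_le)
      then show ?case using fn[OF elim(1)] by linarith
    qed
    then have "(\<lambda>n. (\<Sum>i\<in>{1..N}. f (k n) (i # u)) - f (k n) u) \<longlonglongrightarrow> 0"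
      by (rule Lim_null_comparison) (rule lim_1_over_n)
    from LIMSEQ_unique[OF lim this] show ?thesis by simp
  qed
  have q_Nil: "q [] = 1"
  proof -
    have "f n [] = 1" if "0 < n" for n
    proof -
      have "G n [] j = 1" if "j < n" for j
        using that Z_pos[of "2 * n"] by (simp add: G_def ext_sum_Nil)
      then show ?thesis using that by (simp add: f_def)
    qed
    then have "\<forall>\<^sub>F n in sequentially. f (k n) [] = 1"
      using k_large[of 1] by (auto elim: eventually_mono)
    then have "(\<lambda>n. f (k n) []) \<longlonglongrightarrow> 1" by (rule tendsto_eventually)
    then show ?thesis using LIMSEQ_unique[OF q[of "[]" 0]] by simp
  qed
  interpret consistent_weights N q
  proof
    show "0 \<le> q w" if "w \<in> words N n" for w n using q_bounds(3)[OF that] .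
    show "(\<Sum>i\<in>{1..N}. q (w @ [i])) = q w" if "w \<in> words N n" for w n using snoc[OF that] .
  qed (rule q_Nil)
  from ex_measure obtain \<mu> where *: "prob_space \<mu> \<and> sets \<mu> = sets (shift_borel N) \<and>
     (\<forall>n. \<forall>w\<in>words N n. measure \<mu> (cyl N w) = q w)" by (rule exE)
  then have \<mu>: "prob_space \<mu>" "sets \<mu> = sets (shift_borel N)"
    and cyl: "\<And>n w. w \<in> words N n \<Longrightarrow> measure \<mu> (cyl N w) = q w"
    by simp_all
  interpret prob_space \<mu> by fact
  have space: "space \<mu> = shift_space N" using sets_eq_imp_space_eq[OF \<mu>(2)] by simp
  have shift: "shift \<in> measurable \<mu> \<mu>"
    using shift_measurable[of N] measurable_cong_sets[OF \<mu>(2) \<mu>(2)] by simp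
  have inv: "distr \<mu> \<mu> shift = \<mu>"
  proof (rule measure_eq_on_cylinders)
    show "finite_measure (distr \<mu> \<mu> shift)"
      using prob_space_distr[OF shift] by (rule prob_space.finite_measure)
    show "sets (distr \<mu> \<mu> shift) = sets (shift_borel N)" using \<mu>(2) by simp
    fix n w assume w: "w \<in> words N n"
    then have len: "length w = n" by (simp add: words_def)
    have "measure (distr \<mu> \<mu> shift) (cyl N w) = measure \<mu> (shift -` cyl N w \<inter> space \<mu>)"
      by (rule measure_distr[OF shift]) (simp add: \<mu>(2))
    also have "shift -` cyl N w \<inter> space \<mu> = cylinders N (Suc n) ((\<lambda>i. i # w) ` {1..N})"
      using shift_in_shift_space[of N]
      by (auto simp: space cylinders_def len init_word_Suc' shift_space_def)
    also have "measure \<mu> \<dots> = (\<Sum>v\<in>((\<lambda>i. i # w) ` {1..N}) \<inter> words N (Suc n). measure \<mu> (cyl N v))"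
      by (rule measure_cylinders[OF finite_measure_axioms \<mu>(2)])
    also have "((\<lambda>i. i # w) ` {1..N}) \<inter> words N (Suc n) = (\<lambda>i. i # w) ` {1..N}"
      using w by (auto simp: words_def)
    also have "(\<Sum>v\<in>(\<lambda>i. i # w) ` {1..N}. measure \<mu> (cyl N v)) = (\<Sum>i\<in>{1..N}. measure \<mu> (cyl N (i # w)))"
      by (subst sum.reindex) (simp_all add: inj_on_def)
    also have "\<dots> = (\<Sum>i\<in>{1..N}. q (i # w))"
    proof (rule sum.cong[OF refl])
      fix i assume "i \<in> {1..N}"
      then have "i # w \<in> words N (Suc n)" using w by (auto simp: words_def)
      then show "measure \<mu> (cyl N (i # w)) = q (i # w)" by (rule cyl)
    qed
    also have "\<dots> = measure \<mu> (cyl N w)" using cons[OF w] cyl[OF w] by simp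
    finally show "measure (distr \<mu> \<mu> shift) (cyl N w) = measure \<mu> (cyl N w)" .
  qed (use \<mu> finite_measure_axioms in auto)
  have "invariant_measure N \<mu>"
    unfolding invariant_measure_def
  proof (intro conjI ballI)
    fix B assume B: "B \<in> sets \<mu>"
    have "emeasure (distr \<mu> \<mu> shift) B = emeasure \<mu> (shift -` B \<inter> space \<mu>)"
      using shift B by (rule emeasure_distr)
    then show "emeasure \<mu> (shift -` B \<inter> space \<mu>) = emeasure \<mu> B" unfolding inv by simp
  qed (use \<mu> in auto)
  moreover have "\<phi> w \<le> K * exp (real n * press) * measure \<mu> (cyl N w) \<and>
     exp (real n * press) * measure \<mu> (cyl N w) \<le> K * \<phi> w" if w: "w \<in> words N n" for n w
  proof -
    define e where "e = exp (real n * press)"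
    have "0 < e" by (simp add: e_def)
    moreover have "1 / e * \<phi> w / K \<le> q w" "q w \<le> K * (1 / e * \<phi> w)"
      using q_bounds(1,2)[OF w] by (simp_all add: e_def exp_minus inverse_eq_divide)
    ultimately show ?thesis
      using K(1) unfolding cyl[OF w] e_def[symmetric] by (simp add: field_simps)
  qed
  ultimately show ?thesis unfolding gibbs_def using K(1) by blast
qed

lemma gibbs_pos:
  assumes "gibbs \<mu>" "w \<in> words N n"
  shows "0 < measure \<mu> (cyl N w)"
proof -
  obtain C where C: "C \<ge> 1" "\<phi> w \<le> C * exp (real n * press) * measure \<mu> (cyl N w)"
    using assms unfolding gibbs_def by blast
  have "0 < C * exp (real n * press) * measure \<mu> (cyl N w)" using C(2) pos[OF assms(2)] by linarith
  then show ?thesis by (rule zero_less_mult_pos) (use C(1) in simp)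
qed

lemma gibbs_fully_supported:
  assumes g: "gibbs \<mu>"
  shows "fully_supported N \<mu>"
  unfolding fully_supported_def
proof (intro allI impI)
  fix U assume U: "openin (top_of_set (shift_space N)) U \<and> U \<noteq> {}"
  then obtain T where T: "open T" "U = shift_space N \<inter> T" by (auto simp: openin_open)
  obtain x where x: "x \<in> U" using U by blast
  then obtain n where n: "cylinders N n {init_word n x} \<subseteq> T"
    using open_contains_cylinder[OF T(1), of x] T(2) by blast
  interpret shift_invariant N \<mu> by unfold_locales (use g in \<open>simp add: gibbs_def\<close>)
  have "cyl N (init_word n x) \<subseteq> U" using n T(2) by (auto simp: cylinders_def)
  moreover have "U \<in> sets \<mu>" unfolding sets_mu using T by (auto simp: sets_restrict_space)
  ultimately have "prob (cyl N (init_word n x)) \<le> prob U" by (rule finite_measure_mono)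
  moreover have "0 < prob (cyl N (init_word n x))"
    by (rule gibbs_pos[OF g, of _ n]) (use x T in simp)
  ultimately show "0 < emeasure \<mu> U" by (simp add: emeasure_eq_measure)
qed

section \<open>Ergodicity of Gibbs measures\<close>

text \<open>Connecting words give an inequality of mixing type: a constant times the product of the
  measures of two cylinders is at most a sum, over boundedly many time gaps, of the measure of
  meeting first the one and then the other. It passes to cylinder sets, then to an invariant set
  \<open>E\<close> in the second place, where the gap no longer matters, and finally to the
  complement of \<open>E\<close> in the first place, where the right side vanishes.\<close>

theorem gibbs_ergodic:
  assumes g: "gibbs \<mu>"
  shows "ergodic_measure N \<mu>"
proof -
  interpret shift_invariant N \<mu> by unfold_locales (use g in \<open>simp add: gibbs_def\<close>)
  obtain C where C: "C \<ge> 1"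
    and lo: "\<And>n w. w \<in> words N n \<Longrightarrow> \<phi> w \<le> C * exp (real n * press) * prob (cyl N w)"
    and up: "\<And>n w. w \<in> words N n \<Longrightarrow> exp (real n * press) * prob (cyl N w) \<le> C * \<phi> w"
    using g unfolding gibbs_def by blast
  obtain c L where c: "c > 0" and conn:
    "\<And>m n u v. u \<in> words N m \<Longrightarrow> v \<in> words N n \<Longrightarrow> \<exists>l\<le>L. \<exists>k\<in>words N l. c * \<phi> u * \<phi> v \<le> \<phi> (u @ k @ v)"
    using quasi by blast
  \<comment> \<open>Three factors \<open>C\<close> come from the Gibbs bounds for \<open>u\<close>,
    \<open>v\<close> and the joined word; the exponential bounds the effect of at most
    \<open>L\<close> connecting letters, whatever the sign of \<open>press\<close>.\<close>
  define \<kappa> where "\<kappa> = c / (C * C * C * exp (real L * \<bar>press\<bar>))"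
  have \<kappa>: "\<kappa> > 0" using c C by (simp add: \<kappa>_def)
  let ?T = "\<lambda>i X. (shift ^^ i) -` X \<inter> space \<mu>"
  have T_ev: "?T i X \<in> events" if "X \<in> events" for i X using measurable_sets[OF measurable_funpow that] .
  have cyl_cyl: "\<kappa> * prob (cyl N u) * prob (cyl N v) \<le> (\<Sum>l\<le>L. prob (cyl N u \<inter> ?T (m + l) (cyl N v)))"
    if u: "u \<in> words N m" and v: "v \<in> words N n" for u v m n
  proof -
    obtain l k where l: "l \<le> L" and k: "k \<in> words N l" and ukv: "c * \<phi> u * \<phi> v \<le> \<phi> (u @ k @ v)"
      using conn[OF u v] by blast
    have w: "u @ k @ v \<in> words N (m + (l + n))" by (intro append_in_words u k v)
    have E: "exp (real (m + (l + n)) * press) = exp (real m * press) * exp (real n * press) * exp (real l * press)"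
      by (simp add: exp_add[symmetric] algebra_simps)
    have "c * ((exp (real m * press) * prob (cyl N u)) * (exp (real n * press) * prob (cyl N v)))
        \<le> c * ((C * \<phi> u) * (C * \<phi> v))"
      by (intro mult_left_mono mult_mono[OF up[OF u] up[OF v]]) (use c C pos[OF u] in auto)
    also have "\<dots> = C * C * (c * \<phi> u * \<phi> v)" by (simp add: mult_ac)
    also have "\<dots> \<le> C * C * (C * exp (real (m + (l + n)) * press) * prob (cyl N (u @ k @ v)))"
      using C ukv lo[OF w] by (intro mult_left_mono) auto
    also have "\<dots> = (exp (real m * press) * exp (real n * press)) *
        (C * C * C * exp (real l * press) * prob (cyl N (u @ k @ v)))" unfolding E by (simp add: mult_ac)
    finally have "(exp (real m * press) * exp (real n * press)) * (c * prob (cyl N u) * prob (cyl N v)) \<le>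
      (exp (real m * press) * exp (real n * press)) * (C * C * C * exp (real l * press) * prob (cyl N (u @ k @ v)))"
      by (simp add: mult_ac)
    then have "c * prob (cyl N u) * prob (cyl N v) \<le> C * C * C * exp (real l * press) * prob (cyl N (u @ k @ v))"
      by (subst (asm) mult_le_cancel_left_pos) auto
    also have "\<dots> \<le> C * C * C * exp (real L * \<bar>press\<bar>) * prob (cyl N (u @ k @ v))"
    proof (intro mult_right_mono mult_left_mono)
      have "real l * press \<le> real l * \<bar>press\<bar>" by (intro mult_left_mono) auto
      also have "\<dots> \<le> real L * \<bar>press\<bar>" using l by (intro mult_right_mono) auto
      finally have "real l * press \<le> real L * \<bar>press\<bar>" .
      then show "exp (real l * press) \<le> exp (real L * \<bar>press\<bar>)" by simp
    qed (use C in auto)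
    finally have "\<kappa> * prob (cyl N u) * prob (cyl N v) \<le> prob (cyl N (u @ k @ v))"
      using C by (simp add: \<kappa>_def field_simps)
    also have "\<dots> \<le> prob (cyl N u \<inter> ?T (m + l) (cyl N v))"
    proof (rule finite_measure_mono)
      have len: "length u = m" "length k = l" "length v = n" using u k v by (auto simp: words_def)
      show "cyl N (u @ k @ v) \<subseteq> cyl N u \<inter> ?T (m + l) (cyl N v)"
      proof
        fix x assume x: "x \<in> cyl N (u @ k @ v)"
        then have xs: "x \<in> shift_space N" and eq: "init_word (m + (l + n)) x = u @ k @ v"
          by (auto simp: cylinders_def len)
        have "init_word m x = u" using arg_cong[OF eq, of "take m"] by (simp add: take_init_word len)
        moreover have "init_word n ((shift ^^ (m + l)) x) = v"
          using arg_cong[OF eq, of "drop (m + l)"] init_word_add[of "m + l" n x]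
          by (simp add: len shift_funpow add.assoc)
        ultimately show "x \<in> cyl N u \<inter> ?T (m + l) (cyl N v)"
          using xs funpow_in_space[OF shift_in_shift_space xs, of "m + l"]
          by (simp add: cylinders_def len space_mu)
      qed
    qed (intro sets.Int T_ev cylinders_events)
    also have "\<dots> \<le> (\<Sum>l\<le>L. prob (cyl N u \<inter> ?T (m + l) (cyl N v)))"
      using l by (intro member_le_sum[of l "{..L}" "\<lambda>l. prob (cyl N u \<inter> ?T (m + l) (cyl N v))"]) auto
    finally show ?thesis .
  qed
  have cyl_cylinders: "\<kappa> * prob (cyl N u) * prob (cylinders N n V) \<le>
      (\<Sum>l\<le>L. prob (cyl N u \<inter> ?T (m + l) (cylinders N n V)))"
    if u: "u \<in> words N m" for u V m n
  proof -
    have "\<kappa> * prob (cyl N u) * prob (cylinders N n V) = (\<Sum>v\<in>V \<inter> words N n. \<kappa> * prob (cyl N u) * prob (cyl N v))"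
      by (subst prob_cylinders) (simp add: sum_distrib_left)
    also have "\<dots> \<le> (\<Sum>v\<in>V \<inter> words N n. \<Sum>l\<le>L. prob (cyl N u \<inter> ?T (m + l) (cyl N v)))"
      by (intro sum_mono cyl_cyl[OF u]) auto
    also have "\<dots> = (\<Sum>l\<le>L. \<Sum>v\<in>V \<inter> words N n. prob (cyl N u \<inter> ?T (m + l) (cyl N v)))" by (rule sum.swap)
    also have "\<dots> = (\<Sum>l\<le>L. prob (cyl N u \<inter> ?T (m + l) (cylinders N n V)))"
    proof (rule sum.cong[OF refl])
      fix l
      have "disjoint_family_on (\<lambda>v. cyl N u \<inter> ?T (m + l) (cyl N v)) (V \<inter> words N n)"
        unfolding disjoint_family_on_def
      proof (intro ballI impI)
        fix v v' assume "v \<in> V \<inter> words N n" "v' \<in> V \<inter> words N n" "v \<noteq> v'"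
        then have "cyl N v \<inter> cyl N v' = {}" by (intro cyl_disjoint[of _ N n]) auto
        then show "cyl N u \<inter> ?T (m + l) (cyl N v) \<inter> (cyl N u \<inter> ?T (m + l) (cyl N v')) = {}" by blast
      qed
      then have "(\<Sum>v\<in>V \<inter> words N n. prob (cyl N u \<inter> ?T (m + l) (cyl N v))) =
          prob (\<Union>v\<in>V \<inter> words N n. cyl N u \<inter> ?T (m + l) (cyl N v))"
        by (intro finite_measure_finite_Union[symmetric] image_subsetI sets.Int T_ev cylinders_events) auto
      also have "(\<Union>v\<in>V \<inter> words N n. cyl N u \<inter> ?T (m + l) (cyl N v)) =
          cyl N u \<inter> ?T (m + l) (\<Union>v\<in>V \<inter> words N n. cyl N v)" by blast
      also have "(\<Union>v\<in>V \<inter> words N n. cyl N v) = cylinders N n V" by (rule cylinders_UNION[symmetric])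
      finally show "(\<Sum>v\<in>V \<inter> words N n. prob (cyl N u \<inter> ?T (m + l) (cyl N v))) =
          prob (cyl N u \<inter> ?T (m + l) (cylinders N n V))" .
    qed
    finally show ?thesis .
  qed
  have "prob E = 0 \<or> prob E = 1" if E: "E \<in> events" "shift -` E \<inter> space \<mu> = E" for E
  proof -
    have inv: "?T i E = E" for i
    proof (induction i)
      case 0
      then show ?case using sets.sets_into_space[OF E(1)] by auto
    next
      case (Suc i)
      have "?T (Suc i) E = ?T i (shift -` E \<inter> space \<mu>)"
        using funpow_in_space[OF T_space] by auto
      then show ?case using Suc E(2) by (simp only:)
    qed
    have cyl_E: "\<kappa> * prob (cyl N u) * prob E \<le> real (Suc L) * prob (cyl N u \<inter> E)" if u: "u \<in> words N m" for u m
    proof (rule field_le_epsilon)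
      fix e :: real assume e: "0 < e"
      \<comment> \<open>Replacing \<open>E\<close> by a cylinder set costs at most
        \<open>\<kappa> * \<epsilon>\<close> on the left and \<open>\<epsilon>\<close> in each of
        the \<open>L + 1\<close> terms on the right.\<close>
      define \<epsilon> where "\<epsilon> = e / (\<kappa> + real (Suc L))"
      have \<epsilon>: "\<epsilon> > 0" using e \<kappa> by (simp add: \<epsilon>_def)
      have "\<exists>n V. \<forall>\<rho>\<in>{\<mu>}. measure \<rho> (sym_diff E (cylinders N n V)) < \<epsilon>"
        by (rule approx_by_cylinders) (use E \<epsilon> sets_mu finite_measure_axioms in auto)
      then obtain n V where "\<forall>\<rho>\<in>{\<mu>}. measure \<rho> (sym_diff E (cylinders N n V)) < \<epsilon>"
        by (elim exE)
      then have V: "prob (sym_diff E (cylinders N n V)) < \<epsilon>" by (simp only: ball_simps)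
      have "prob (cyl N u \<inter> ?T i (cylinders N n V)) \<le> prob (cyl N u \<inter> E) + \<epsilon>" for i
      proof -
        have "prob (cyl N u \<inter> ?T i (cylinders N n V)) \<le> prob ((cyl N u \<inter> E) \<union> ?T i (sym_diff E (cylinders N n V)))"
        proof (rule finite_measure_mono)
          have "cyl N u \<inter> ?T i (cylinders N n V) \<subseteq> (cyl N u \<inter> ?T i E) \<union> ?T i (sym_diff E (cylinders N n V))" by blast
          then show "cyl N u \<inter> ?T i (cylinders N n V) \<subseteq> (cyl N u \<inter> E) \<union> ?T i (sym_diff E (cylinders N n V))"
            unfolding inv .
        qed (intro sets.Un sets.Int T_ev sets.Diff cylinders_events E(1))
        also have "\<dots> \<le> prob (cyl N u \<inter> E) + prob (?T i (sym_diff E (cylinders N n V)))"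
          by (intro measure_Un_le sets.Int T_ev sets.Un sets.Diff cylinders_events E(1))
        also have "prob (?T i (sym_diff E (cylinders N n V))) = prob (sym_diff E (cylinders N n V))"
          by (intro prob_funpow sets.Un sets.Diff cylinders_events E(1))
        finally show ?thesis using V by linarith
      qed
      then have "(\<Sum>l\<le>L. prob (cyl N u \<inter> ?T (m + l) (cylinders N n V))) \<le> (\<Sum>l\<le>L. prob (cyl N u \<inter> E) + \<epsilon>)"
        by (intro sum_mono)
      then have 1: "\<kappa> * prob (cyl N u) * prob (cylinders N n V) \<le> real (Suc L) * (prob (cyl N u \<inter> E) + \<epsilon>)"
        using cyl_cylinders[OF u, of n V] by simp
      have "prob E \<le> prob (cylinders N n V) + \<epsilon>"
        using measure_sym_diff_le[OF finite_measure_axioms E(1) cylinders_events, of n V] V by linarith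
      then have "\<kappa> * prob (cyl N u) * prob E \<le> \<kappa> * prob (cyl N u) * (prob (cylinders N n V) + \<epsilon>)"
        using \<kappa> by (intro mult_left_mono) auto
      also have "\<dots> = \<kappa> * prob (cyl N u) * prob (cylinders N n V) + \<kappa> * \<epsilon> * prob (cyl N u)" by (simp add: algebra_simps)
      also have "\<kappa> * \<epsilon> * prob (cyl N u) \<le> \<kappa> * \<epsilon> * 1" using \<kappa> \<epsilon> by (intro mult_left_mono) auto
      finally have "\<kappa> * prob (cyl N u) * prob E \<le> real (Suc L) * prob (cyl N u \<inter> E) + (\<kappa> + real (Suc L)) * \<epsilon>"
        using 1 by (simp add: algebra_simps)
      also have "(\<kappa> + real (Suc L)) * \<epsilon> = e" using \<kappa> by (simp add: \<epsilon>_def)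
      finally show "\<kappa> * prob (cyl N u) * prob E \<le> real (Suc L) * prob (cyl N u \<inter> E) + e" .
    qed
    have cylinders_E: "\<kappa> * prob (cylinders N n U) * prob E \<le> real (Suc L) * prob (cylinders N n U \<inter> E)" for n U
    proof -
      have "\<kappa> * prob (cylinders N n U) * prob E = (\<Sum>u\<in>U \<inter> words N n. \<kappa> * prob (cyl N u) * prob E)"
        by (subst prob_cylinders) (simp add: sum_distrib_left sum_distrib_right)
      also have "\<dots> \<le> (\<Sum>u\<in>U \<inter> words N n. real (Suc L) * prob (cyl N u \<inter> E))"
        by (intro sum_mono cyl_E) auto
      also have "\<dots> = real (Suc L) * (\<Sum>u\<in>U \<inter> words N n. prob (cyl N u \<inter> E))" by (simp only: sum_distrib_left)
      also have "(\<Sum>u\<in>U \<inter> words N n. prob (cyl N u \<inter> E)) = prob (\<Union>u\<in>U \<inter> words N n. cyl N u \<inter> E)"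
      proof (rule finite_measure_finite_Union[symmetric])
        show "disjoint_family_on (\<lambda>u. cyl N u \<inter> E) (U \<inter> words N n)"
          unfolding disjoint_family_on_def
        proof (intro ballI impI)
          fix v v' assume "v \<in> U \<inter> words N n" "v' \<in> U \<inter> words N n" "v \<noteq> v'"
          then have "cyl N v \<inter> cyl N v' = {}" by (intro cyl_disjoint[of _ N n]) auto
          then show "cyl N v \<inter> E \<inter> (cyl N v' \<inter> E) = {}" by blast
        qed
      qed (auto intro: E(1))
      also have "(\<Union>u\<in>U \<inter> words N n. cyl N u \<inter> E) = (\<Union>u\<in>U \<inter> words N n. cyl N u) \<inter> E" by blast
      also have "(\<Union>u\<in>U \<inter> words N n. cyl N u) = cylinders N n U" by (rule cylinders_UNION[symmetric])
      finally show ?thesis .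
    qed
    define F where "F = space \<mu> - E"
    have F: "F \<in> events" unfolding F_def using E(1) by blast
    have "\<kappa> * prob F * prob E \<le> 0 + e" if e: "0 < e" for e
    proof -
      define \<epsilon> where "\<epsilon> = e / (\<kappa> + real (Suc L))"
      have \<epsilon>: "\<epsilon> > 0" using e \<kappa> by (simp add: \<epsilon>_def)
      have "\<exists>n V. \<forall>\<rho>\<in>{\<mu>}. measure \<rho> (sym_diff F (cylinders N n V)) < \<epsilon>"
        by (rule approx_by_cylinders) (use F \<epsilon> sets_mu finite_measure_axioms in auto)
      then obtain n V where "\<forall>\<rho>\<in>{\<mu>}. measure \<rho> (sym_diff F (cylinders N n V)) < \<epsilon>"
        by (elim exE)
      then have V: "prob (sym_diff F (cylinders N n V)) < \<epsilon>" by (simp only: ball_simps)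
      have "prob (cylinders N n V \<inter> E) \<le> prob (sym_diff F (cylinders N n V))"
      proof (rule finite_measure_mono)
        show "cylinders N n V \<inter> E \<subseteq> sym_diff F (cylinders N n V)" unfolding F_def by blast
      qed (intro sets.Un sets.Diff F cylinders_events)
      then have 1: "real (Suc L) * prob (cylinders N n V \<inter> E) \<le> real (Suc L) * \<epsilon>"
        using V by (intro mult_left_mono) auto
      have "prob F \<le> prob (cylinders N n V) + \<epsilon>"
        using measure_sym_diff_le[OF finite_measure_axioms F cylinders_events, of n V] V by linarith
      then have "\<kappa> * prob F * prob E \<le> \<kappa> * (prob (cylinders N n V) + \<epsilon>) * prob E"
        using \<kappa> by (intro mult_right_mono mult_left_mono) auto
      also have "\<dots> = \<kappa> * prob (cylinders N n V) * prob E + \<kappa> * \<epsilon> * prob E" by (simp add: algebra_simps)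
      also have "\<kappa> * \<epsilon> * prob E \<le> \<kappa> * \<epsilon> * 1" using \<kappa> \<epsilon> by (intro mult_left_mono) auto
      finally have "\<kappa> * prob F * prob E \<le> (\<kappa> + real (Suc L)) * \<epsilon>"
        using 1 cylinders_E[of n V] by (simp add: algebra_simps)
      also have "(\<kappa> + real (Suc L)) * \<epsilon> = e" using \<kappa> by (simp add: \<epsilon>_def)
      finally show ?thesis by simp
    qed
    then have "\<kappa> * prob F * prob E \<le> 0" by (rule field_le_epsilon)
    have "prob F * prob E = 0"
    proof (rule ccontr)
      assume "prob F * prob E \<noteq> 0"
      then have "0 < prob F * prob E" by (simp add: order.strict_iff_order)
      then have "0 < \<kappa> * (prob F * prob E)" using \<kappa> by (rule mult_pos_pos[rotated])
      then show False using \<open>\<kappa> * prob F * prob E \<le> 0\<close> by (simp add: mult.assoc)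
    qed
    moreover have "prob F = 1 - prob E" unfolding F_def by (rule prob_compl[OF E(1)])
    ultimately show ?thesis by auto
  qed
  then show ?thesis
    using invariant unfolding ergodic_measure_def
    by (auto simp: emeasure_eq_measure)
qed

end

section \<open>Equilibrium states of a maximum of two potentials\<close>

text \<open>Applied to two Gibbs measures it is a finite measure of mass 2, which bounds the maximum
  of the potentials as each Gibbs measure bounds its own.\<close>

definition sum_measure :: "'a measure \<Rightarrow> 'a measure \<Rightarrow> 'a measure" where
  "sum_measure \<mu> \<nu> = measure_of (space \<mu>) (sets \<mu>) (\<lambda>E. emeasure \<mu> E + emeasure \<nu> E)"

lemma sets_sum_measure [simp]: "sets (sum_measure \<mu> \<nu>) = sets \<mu>"
  by (simp add: sum_measure_def)

lemma emeasure_sum_measure: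
  assumes "sets \<nu> = sets \<mu>" "E \<in> sets \<mu>"
  shows "emeasure (sum_measure \<mu> \<nu>) E = emeasure \<mu> E + emeasure \<nu> E"
  unfolding sum_measure_def
proof (rule emeasure_measure_of_sigma)
  show "sigma_algebra (space \<mu>) (sets \<mu>)" by (rule sets.sigma_algebra_axioms)
  show "positive (sets \<mu>) (\<lambda>E. emeasure \<mu> E + emeasure \<nu> E)" by (simp add: positive_def)
  show "countably_additive (sets \<mu>) (\<lambda>E. emeasure \<mu> E + emeasure \<nu> E)"
  proof (rule countably_additiveI)
    fix A :: "nat \<Rightarrow> 'a set" assume A: "range A \<subseteq> sets \<mu>" "disjoint_family A"
    then show "(\<Sum>i. emeasure \<mu> (A i) + emeasure \<nu> (A i)) = emeasure \<mu> (\<Union>i. A i) + emeasure \<nu> (\<Union>i. A i)"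
      using assms(1) by (simp add: suminf_add[symmetric] suminf_emeasure)
  qed
qed fact

lemma measure_sum_measure:
  assumes "finite_measure \<mu>" "finite_measure \<nu>" "sets \<nu> = sets \<mu>" "E \<in> sets \<mu>"
  shows "measure (sum_measure \<mu> \<nu>) E = measure \<mu> E + measure \<nu> E"
proof (rule measure_eq_emeasure_eq_ennreal)
  show "emeasure (sum_measure \<mu> \<nu>) E = ennreal (measure \<mu> E + measure \<nu> E)"
    unfolding emeasure_sum_measure[OF assms(3,4)] finite_measure.emeasure_eq_measure[OF assms(1)]
      finite_measure.emeasure_eq_measure[OF assms(2)] by simp
qed simp

lemma finite_sum_measure:
  assumes "finite_measure \<mu>" "finite_measure \<nu>" "sets \<nu> = sets \<mu>"
  shows "finite_measure (sum_measure \<mu> \<nu>)"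
proof (rule finite_measureI)
  have "space (sum_measure \<mu> \<nu>) = space \<mu>" by (rule sets_eq_imp_space_eq) simp
  then show "emeasure (sum_measure \<mu> \<nu>) (space (sum_measure \<mu> \<nu>)) \<noteq> \<infinity>"
    using emeasure_sum_measure[OF assms(3) sets.top] assms(1,2)
    by (simp add: finite_measure.emeasure_finite)
qed

lemma submultiplicative_max:
  assumes "submultiplicative N f" "submultiplicative N g"
  shows "submultiplicative N (\<lambda>w. max (f w) (g w))"
proof -
  interpret f: submultiplicative N f by fact
  interpret g: submultiplicative N g by fact
  show ?thesis
  proof
    fix w n assume "w \<in> words N n"
    then show "0 < max (f w) (g w)" using f.pos by (simp add: less_max_iff_disj)
  next
    fix u v m n assume uv: "u \<in> words N m" "v \<in> words N n"
    have "f u * f v \<le> max (f u) (g u) * max (f v) (g v)" "g u * g v \<le> max (f u) (g u) * max (f v) (g v)"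
      using f.pos[OF uv(1)] f.pos[OF uv(2)] g.pos[OF uv(1)] g.pos[OF uv(2)] by (auto intro!: mult_mono)
    then show "max (f (u @ v)) (g (u @ v)) \<le> max (f u) (g u) * max (f v) (g v)"
      using f.submult[OF uv] g.submult[OF uv] by simp
  next
    obtain K where "\<forall>n. \<forall>w\<in>words N n. exp (- K * real n) \<le> f w" using f.lower by blast
    then show "\<exists>K. \<forall>n. \<forall>w\<in>words N n. exp (- K * real n) \<le> max (f w) (g w)"
      by (intro exI[of _ K]) (simp add: le_max_iff_disj)
  qed
qed

text \<open>The upper Gibbs bound is a lower bound for \<open>ln \<phi>\<close> minus the logarithm
  of the measure of the cylinder. Averaging over words and dividing by \<open>n\<close> turns it
  into the inequality opposite to the variational principle.\<close>

lemma (in shift_invariant) free_energy_ge: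
  assumes sub: "submultiplicative N \<phi>" and C: "0 < C"
    and up: "\<And>n w. w \<in> words N n \<Longrightarrow> exp (real n * P) * prob (cyl N w) \<le> C * \<phi> w"
  shows "P \<le> entropy + energy \<phi>"
proof -
  interpret submultiplicative N \<phi> by fact
  have bound: "real n * P - ln C \<le> ent \<mu> (init_word n) + energy_sum \<phi> n" for n
  proof -
    have "real n * P - ln C = (\<Sum>w\<in>words N n. prob (cyl N w) * (real n * P - ln C))"
      by (simp only: sum_distrib_right[symmetric] sum_prob_cyl mult_1)
    also have "\<dots> \<le> (\<Sum>w\<in>words N n. prob (cyl N w) * (ln (\<phi> w) - ln (prob (cyl N w))))"
    proof (rule sum_mono)
      fix w assume w: "w \<in> words N n"
      show "prob (cyl N w) * (real n * P - ln C) \<le> prob (cyl N w) * (ln (\<phi> w) - ln (prob (cyl N w)))"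
      proof (cases "prob (cyl N w) = 0")
        case False
        then have p: "prob (cyl N w) > 0" by (simp add: order.strict_iff_order)
        have "ln (exp (real n * P) * prob (cyl N w)) \<le> ln (C * \<phi> w)"
          using up[OF w] p C pos[OF w] by (subst ln_le_cancel_iff) auto
        then have "real n * P - ln C \<le> ln (\<phi> w) - ln (prob (cyl N w))"
          using p C pos[OF w] by (simp add: ln_mult)
        then show ?thesis by (intro mult_left_mono) auto
      qed simp
    qed
    also have "\<dots> = ent \<mu> (init_word n) + energy_sum \<phi> n"
      by (simp add: ent_init_word energy_sum_def right_diff_distrib sum_subtractf)
    finally show ?thesis .
  qed
  have "(\<lambda>n. P - ln C * inverse (real n)) \<longlonglongrightarrow> P - ln C * 0"
    by (intro tendsto_intros lim_inverse_n)
  moreover have "(\<lambda>n. ent \<mu> (init_word n) / real n + energy_sum \<phi> n / real n) \<longlonglongrightarrow> entropy + energy \<phi>"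
    by (intro tendsto_add entropy_LIMSEQ energy_LIMSEQ[OF sub])
  moreover have "\<forall>n\<ge>1. P - ln C * inverse (real n) \<le> ent \<mu> (init_word n) / real n + energy_sum \<phi> n / real n"
  proof (intro allI impI)
    fix n :: nat assume n: "n \<ge> 1"
    have "(real n * P - ln C) / real n \<le> (ent \<mu> (init_word n) + energy_sum \<phi> n) / real n"
      using bound by (rule divide_right_mono) simp
    then show "P - ln C * inverse (real n) \<le> ent \<mu> (init_word n) / real n + energy_sum \<phi> n / real n"
      using n by (simp add: diff_divide_distrib add_divide_distrib) (simp add: divide_inverse)
  qed
  ultimately have "P - ln C * 0 \<le> entropy + energy \<phi>" by (intro LIMSEQ_le) auto
  then show ?thesis by simp
qed

theorem equilibrium_states_max:
  assumes q1: "quasi_multiplicative N f" and q2: "quasi_multiplicative N g"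
    and Z_eq: "\<And>n. (\<Sum>w\<in>words N n. f w) = (\<Sum>w\<in>words N n. g w)"
    and incomparable: "\<And>C. \<exists>n. \<exists>w\<in>words N n. C * g w < f w"
  shows "\<exists>\<mu> \<nu>. \<mu> \<noteq> \<nu> \<and> fully_supported N \<mu> \<and> fully_supported N \<nu> \<and>
    {\<rho>. ergodic_measure N \<rho> \<and>
      shift_invariant.entropy \<rho> + shift_invariant.energy N \<rho> (\<lambda>w. max (f w) (g w)) = quasi_multiplicative.press N f}
    = {\<mu>, \<nu>}"
proof -
  interpret f: quasi_multiplicative N f by fact
  interpret g: quasi_multiplicative N g by fact
  define \<phi> where "\<phi> = (\<lambda>w. max (f w) (g w))"
  have sub: "submultiplicative N \<phi>"
    unfolding \<phi>_def by (rule submultiplicative_max[OF f.submultiplicative_axioms g.submultiplicative_axioms])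
  define P where "P = f.press"
  have "g.press = P" by (simp add: P_def f.press_def g.press_def f.Z_def g.Z_def Z_eq)
  obtain \<mu> where \<mu>: "f.gibbs \<mu>" using f.ex_gibbs by blast
  obtain \<nu> where \<nu>: "g.gibbs \<nu>" using g.ex_gibbs by blast
  obtain C1 where C1: "C1 \<ge> 1"
    and \<mu>_lo: "\<And>n w. w \<in> words N n \<Longrightarrow> f w \<le> C1 * exp (real n * P) * measure \<mu> (cyl N w)"
    and \<mu>_up: "\<And>n w. w \<in> words N n \<Longrightarrow> exp (real n * P) * measure \<mu> (cyl N w) \<le> C1 * f w"
    using \<mu> unfolding f.gibbs_def P_def by blast
  obtain C2 where C2: "C2 \<ge> 1"
    and \<nu>_lo: "\<And>n w. w \<in> words N n \<Longrightarrow> g w \<le> C2 * exp (real n * P) * measure \<nu> (cyl N w)"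
    and \<nu>_up: "\<And>n w. w \<in> words N n \<Longrightarrow> exp (real n * P) * measure \<nu> (cyl N w) \<le> C2 * g w"
    using \<nu> unfolding g.gibbs_def \<open>g.press = P\<close> by blast
  have erg: "ergodic_measure N \<mu>" "ergodic_measure N \<nu>"
    by (rule f.gibbs_ergodic[OF \<mu>], rule g.gibbs_ergodic[OF \<nu>])
  interpret \<mu>: shift_invariant N \<mu> by unfold_locales (use erg in \<open>simp add: ergodic_measure_def\<close>)
  interpret \<nu>: shift_invariant N \<nu> by unfold_locales (use erg in \<open>simp add: ergodic_measure_def\<close>)
  have sets: "sets \<nu> = sets \<mu>" by (simp add: \<mu>.sets_mu \<nu>.sets_mu)
  \<comment> \<open>Equal Gibbs measures would bound \<open>f\<close> by
    \<open>C1 * C2 * g\<close>.\<close>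
  have neq: "\<mu> \<noteq> \<nu>"
  proof
    assume eq: "\<mu> = \<nu>"
    obtain n w where w: "w \<in> words N n" "C1 * C2 * g w < f w" using incomparable by blast
    have "f w \<le> C1 * (exp (real n * P) * measure \<nu> (cyl N w))" using \<mu>_lo[OF w(1)] eq by (simp add: mult.assoc)
    also have "\<dots> \<le> C1 * (C2 * g w)" using \<nu>_up[OF w(1)] C1 by (intro mult_left_mono) auto
    finally show False using w(2) by simp
  qed
  define \<rho> where "\<rho> = sum_measure \<mu> \<nu>"
  have \<rho>: "finite_measure \<rho>" "sets \<rho> = sets (shift_borel N)"
    unfolding \<rho>_def
    by (rule finite_sum_measure[OF \<mu>.finite_measure_axioms \<nu>.finite_measure_axioms sets]) (simp add: \<mu>.sets_mu)
  have \<rho>_eq: "measure \<rho> E = measure \<mu> E + measure \<nu> E" if "E \<in> sets \<mu>" for E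
    unfolding \<rho>_def by (rule measure_sum_measure[OF \<mu>.finite_measure_axioms \<nu>.finite_measure_axioms sets that])
  have \<phi>_le: "\<phi> w \<le> (C1 * C2) * exp (real n * P) * measure \<rho> (cyl N w)" if w: "w \<in> words N n" for n w
  proof -
    have C: "C1 * 1 \<le> C1 * C2" "1 * C2 \<le> C1 * C2" using C1 C2 by (intro mult_mono; simp)+
    have e: "C1 * exp (real n * P) \<le> C1 * C2 * exp (real n * P)" "C2 * exp (real n * P) \<le> C1 * C2 * exp (real n * P)"
      using C by (intro mult_right_mono; simp)+
    have m: "measure \<mu> (cyl N w) \<le> measure \<rho> (cyl N w)" "measure \<nu> (cyl N w) \<le> measure \<rho> (cyl N w)"
      by (simp_all add: \<rho>_eq)
    have "C1 * exp (real n * P) * measure \<mu> (cyl N w) \<le> (C1 * C2) * exp (real n * P) * measure \<rho> (cyl N w)"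
      by (rule mult_mono[OF e(1) m(1)]) (use C1 C2 in auto)
    moreover have "C2 * exp (real n * P) * measure \<nu> (cyl N w) \<le> (C1 * C2) * exp (real n * P) * measure \<rho> (cyl N w)"
      by (rule mult_mono[OF e(2) m(2)]) (use C1 C2 in auto)
    ultimately show ?thesis using \<mu>_lo[OF w] \<nu>_lo[OF w] unfolding \<phi>_def by linarith
  qed
  have C12: "0 < C1 * C2" using C1 C2 by simp
  have "{\<rho>. ergodic_measure N \<rho> \<and> shift_invariant.entropy \<rho> + shift_invariant.energy N \<rho> \<phi> = P} = {\<mu>, \<nu>}"
  proof (intro equalityI subsetI)
    fix \<tau> assume "\<tau> \<in> {\<mu>, \<nu>}"
    moreover have "\<mu>.entropy + \<mu>.energy \<phi> = P"
    proof (rule antisym)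
      show "\<mu>.entropy + \<mu>.energy \<phi> \<le> P" by (rule \<mu>.variational_principle(1)[OF sub \<rho> C12 \<phi>_le])
      show "P \<le> \<mu>.entropy + \<mu>.energy \<phi>"
      proof (rule \<mu>.free_energy_ge[OF sub])
        fix n w assume w: "w \<in> words N n"
        have "C1 * f w \<le> C1 * \<phi> w" using C1 by (intro mult_left_mono) (auto simp: \<phi>_def)
        then show "exp (real n * P) * measure \<mu> (cyl N w) \<le> C1 * \<phi> w" using \<mu>_up[OF w] by linarith
      qed (use C1 in simp)
    qed
    moreover have "\<nu>.entropy + \<nu>.energy \<phi> = P"
    proof (rule antisym)
      show "\<nu>.entropy + \<nu>.energy \<phi> \<le> P" by (rule \<nu>.variational_principle(1)[OF sub \<rho> C12 \<phi>_le])
      show "P \<le> \<nu>.entropy + \<nu>.energy \<phi>"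
      proof (rule \<nu>.free_energy_ge[OF sub])
        fix n w assume w: "w \<in> words N n"
        have "C2 * g w \<le> C2 * \<phi> w" using C2 by (intro mult_left_mono) (auto simp: \<phi>_def)
        then show "exp (real n * P) * measure \<nu> (cyl N w) \<le> C2 * \<phi> w" using \<nu>_up[OF w] by linarith
      qed (use C2 in simp)
    qed
    ultimately show "\<tau> \<in> {\<rho>. ergodic_measure N \<rho> \<and> shift_invariant.entropy \<rho> + shift_invariant.energy N \<rho> \<phi> = P}"
      using erg by auto
  next
    fix \<tau> assume \<tau>: "\<tau> \<in> {\<rho>. ergodic_measure N \<rho> \<and> shift_invariant.entropy \<rho> + shift_invariant.energy N \<rho> \<phi> = P}"
    then have erg_\<tau>: "ergodic_measure N \<tau>" by simp
    interpret \<tau>: shift_invariant N \<tau> by unfold_locales (use erg_\<tau> in \<open>simp add: ergodic_measure_def\<close>)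
    have eq: "\<tau>.entropy + \<tau>.energy \<phi> = P" using \<tau> by simp
    \<comment> \<open>Otherwise \<open>\<tau>\<close> is carried by a set that is null for both
      Gibbs measures, hence for \<open>\<rho>\<close>, against absolute continuity.\<close>
    show "\<tau> \<in> {\<mu>, \<nu>}"
    proof (rule ccontr)
      assume "\<tau> \<notin> {\<mu>, \<nu>}"
      then have n1: "\<tau> \<noteq> \<mu>" and n2: "\<tau> \<noteq> \<nu>" by auto
      obtain E1 where E1: "E1 \<in> sets (shift_borel N)" "measure \<tau> E1 = 1" "measure \<mu> E1 = 0"
        using ergodic_measures_singular[OF erg_\<tau> erg(1) n1] by blast
      obtain E2 where E2: "E2 \<in> sets (shift_borel N)" "measure \<tau> E2 = 1" "measure \<nu> E2 = 0"
        using ergodic_measures_singular[OF erg_\<tau> erg(2) n2] by blast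
      have E: "E1 \<inter> E2 \<in> sets (shift_borel N)" using E1 E2 by auto
      have "measure \<mu> (E1 \<inter> E2) \<le> measure \<mu> E1"
        by (rule \<mu>.finite_measure_mono) (use E1(1) in \<open>auto simp: \<mu>.sets_mu\<close>)
      moreover have "measure \<nu> (E1 \<inter> E2) \<le> measure \<nu> E2"
        by (rule \<nu>.finite_measure_mono) (use E2(1) in \<open>auto simp: \<nu>.sets_mu\<close>)
      ultimately have "measure \<rho> (E1 \<inter> E2) = 0"
        using \<rho>_eq[of "E1 \<inter> E2"] E E1(3) E2(3) measure_nonneg[of \<mu> "E1 \<inter> E2"] measure_nonneg[of \<nu> "E1 \<inter> E2"]
        by (simp add: \<mu>.sets_mu)
      then have "measure \<tau> (E1 \<inter> E2) = 0"
        using \<tau>.variational_principle(2)[OF sub \<rho> C12 \<phi>_le eq] E by (simp add: \<tau>.sets_mu)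
      moreover have "AE x in \<tau>. x \<in> E1" "AE x in \<tau>. x \<in> E2"
        using E1 E2 \<tau>.prob_eq_1[of E1] \<tau>.prob_eq_1[of E2] by (simp_all add: \<tau>.sets_mu)
      then have "AE x in \<tau>. x \<in> E1 \<inter> E2" by auto
      then have "measure \<tau> (E1 \<inter> E2) = 1" using \<tau>.prob_eq_1[of "E1 \<inter> E2"] E by (simp add: \<tau>.sets_mu)
      ultimately show False by simp
    qed
  qed
  then show ?thesis
    using neq f.gibbs_fully_supported[OF \<mu>] g.gibbs_fully_supported[OF \<nu>]
    unfolding \<phi>_def P_def by (intro exI[of _ \<mu>] exI[of _ \<nu>]) blast
qed

section \<open>Singular values of Kronecker products\<close>

definition kron :: "real ^ 2 ^ 2 \<Rightarrow> real ^ 2 ^ 2 \<Rightarrow> real ^ 4 ^ 4" where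
  "kron X Y = block_matrix (X \<otimes>\<^sub>K Y)"

lemma block_index_simps [simp]:
  "block_index 1 = (1, 1)" "block_index 2 = (1, 2)" "block_index 3 = (2, 1)" "block_index 4 = (2, 2)"
  "block_index 0 = (2, 2)"
  by (simp_all add: block_index_def)

lemma kron_nth: "kron X Y $ i $ j = X $ fst (block_index i) $ fst (block_index j) * Y $ snd (block_index i) $ snd (block_index j)"
  by (simp add: kron_def block_matrix_def kronecker_def)

lemma kron_mult: "kron X Y ** kron X' Y' = kron (X ** X') (Y ** Y')"
  by (simp add: vec_eq_iff forall_4 matrix_matrix_mult_def sum_4 sum_2 kron_nth algebra_simps)

lemma kron_one: "kron (mat 1) (mat 1) = mat 1"
  by (simp add: vec_eq_iff forall_4 kron_nth mat_def)

lemma transpose_kron: "transpose (kron X Y) = kron (transpose X) (transpose Y)"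
  by (simp add: vec_eq_iff forall_4 kron_nth transpose_def)

definition diag4 :: "real \<Rightarrow> real \<Rightarrow> real \<Rightarrow> real \<Rightarrow> real ^ 4 ^ 4" where
  "diag4 a b c d = (\<chi> i j. if i = j then (if i = 1 then a else if i = 2 then b else if i = 3 then c else d) else 0)"

lemma diag4_off: "i \<noteq> j \<Longrightarrow> diag4 a b c d $ i $ j = 0"
  by (simp add: diag4_def)

lemma diag4_nth:
  "diag4 a b c d $ 1 $ 1 = a" "diag4 a b c d $ 2 $ 2 = b" "diag4 a b c d $ 3 $ 3 = c" "diag4 a b c d $ 4 $ 4 = d"
  by (simp_all add: diag4_def)

lemma diag2_nth [simp]:
  "diag2 a b $ 1 $ 1 = a" "diag2 a b $ 1 $ 2 = 0" "diag2 a b $ 2 $ 1 = 0" "diag2 a b $ 2 $ 2 = b"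
  by (simp_all add: diag2_def)

lemma kron_diag2: "kron (diag2 a b) (diag2 c d) = diag4 (a * c) (a * d) (b * c) (b * d)"
  by (simp add: vec_eq_iff forall_4 kron_nth diag4_def)

section \<open>Characteristic polynomials under orthogonal conjugation\<close>

definition poly_matrix :: "real ^ 'd ^ 'd \<Rightarrow> real poly ^ 'd ^ 'd" where
  "poly_matrix M = (\<chi> i j. [:M $ i $ j:])"

lemma poly_matrix_nth: "poly_matrix M $ i $ j = [:M $ i $ j:]"
  by (simp add: poly_matrix_def)

lemma mat_nth: "mat k $ i $ j = (if i = j then k else 0)"
  by (simp add: mat_def)

lemma charpoly_eq: "charpoly M = det (mat [:0, 1:] - poly_matrix M)"
  unfolding charpoly_def poly_matrix_def ..

lemma sum_const_poly: "(\<Sum>i\<in>A. [:f i:]) = [:\<Sum>i\<in>A. f i:]"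
  by (induction A rule: infinite_finite_induct) auto

lemma poly_matrix_mult: "poly_matrix (A ** B) = poly_matrix A ** poly_matrix B"
  by (simp add: poly_matrix_def matrix_matrix_mult_def vec_eq_iff sum_const_poly mult.commute)

lemma poly_matrix_one: "poly_matrix (mat 1) = mat 1"
  by (simp add: poly_matrix_def mat_def vec_eq_iff)

lemma matrix_diff_ldistrib:
  fixes A :: "'a :: ring_1 ^ 'n ^ 'm" and B C :: "'a ^ 'p ^ 'n"
  shows "A ** (B - C) = A ** B - A ** C"
  by (simp add: vec_eq_iff matrix_matrix_mult_def right_diff_distrib sum_subtractf)

lemma matrix_diff_rdistrib:
  fixes A B :: "'a :: ring_1 ^ 'n ^ 'm" and C :: "'a ^ 'p ^ 'n"
  shows "(A - B) ** C = A ** C - B ** C"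
  by (simp add: vec_eq_iff matrix_matrix_mult_def left_diff_distrib sum_subtractf)

lemma inner_matrix_vector_mult:
  fixes A :: "real ^ 'n ^ 'm"
  shows "(A *v x) \<bullet> (A *v y) = x \<bullet> ((transpose A ** A) *v y)"
proof -
  have "(A *v x) \<bullet> (A *v y) = (x v* transpose A) \<bullet> (A *v y)" by simp
  then show ?thesis by (simp only: dot_lmul_matrix matrix_vector_mul_assoc)
qed

text \<open>Scalar matrices over the polynomial ring commute with everything, so conjugation passes
  through the characteristic matrix, and the two outer determinants multiply to 1.\<close>

lemma charpoly_similar:
  fixes M Q :: "real ^ 'd ^ 'd"
  assumes Q: "transpose Q ** Q = mat 1"
  shows "charpoly (transpose Q ** M ** Q) = charpoly M"
proof -
  let ?P = "poly_matrix (transpose Q)" and ?R = "poly_matrix Q"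
  have PR: "?P ** ?R = mat 1"
    using Q by (simp only: poly_matrix_mult[symmetric] poly_matrix_one)
  have comm: "?P ** mat x ** ?R = mat x" for x
  proof -
    have "?P ** mat x = mat x ** ?P"
      by (simp add: vec_eq_iff matrix_matrix_mult_def mat_def if_distrib if_distribR cong: if_cong)
    then have "?P ** mat x ** ?R = mat x ** (?P ** ?R)" by (simp only: matrix_mul_assoc)
    then show ?thesis by (simp only: PR matrix_mul_rid)
  qed
  have "mat [:0, 1:] - poly_matrix (transpose Q ** M ** Q) = ?P ** (mat [:0, 1:] - poly_matrix M) ** ?R"
    by (simp only: poly_matrix_mult matrix_diff_ldistrib matrix_diff_rdistrib comm)
  then have "det (mat [:0, 1:] - poly_matrix (transpose Q ** M ** Q)) = det ?P * det (mat [:0, 1:] - poly_matrix M) * det ?R"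
    by (simp only: det_mul)
  moreover have "det ?P * d * det ?R = d" for d
  proof -
    have "det ?P * d * det ?R = d * det (?P ** ?R)" 
      unfolding det_mul mult.assoc[of "det ?P"] by (rule mult.left_commute)
    then show ?thesis unfolding PR det_I mult_1_right .
  qed
  ultimately show ?thesis unfolding charpoly_eq by (rule trans)
qed

lemma prod_4:
  fixes f :: "4 \<Rightarrow> 'a :: comm_monoid_mult"
  shows "prod f UNIV = f 1 * (f 2 * (f 3 * f 4))"
  unfolding UNIV_4 by (simp add: ac_simps)

lemma linear_factor_nonzero: "[:- x, 1:] \<noteq> (0 :: real poly)" by (simp only: pCons_eq_0_iff one_neq_zero simp_thms)

lemma proots_minus_linear_factor: "proots ([:- x, 1:] :: real poly) = {#x#}" by (simp only: proots_linear_factor minus_minus)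

lemma proots_linear_factor_mult: "q \<noteq> 0 \<Longrightarrow> proots ([:- x, 1:] * q :: real poly) = {#x#} + proots q" unfolding proots_mult[OF linear_factor_nonzero] proots_minus_linear_factor ..

lemma linear_factor_mult_nonzero: "q \<noteq> 0 \<Longrightarrow> [:- x, 1:] * q \<noteq> (0::real poly)" by (rule no_zero_divisors[OF linear_factor_nonzero])

lemma charmatrix_diag4_off: "i \<noteq> j \<Longrightarrow> (mat [:0, 1:] - poly_matrix (diag4 a b c d)) $ i $ j = 0" by (simp add: mat_nth poly_matrix_nth diag4_off)

lemma charmatrix_diag4_diag: "(mat [:0, 1:] - poly_matrix (diag4 a b c d)) $ i $ i = [:- (diag4 a b c d $ i $ i), 1:]" by (simp add: mat_nth poly_matrix_nth)

lemma charpoly_diag4: "charpoly (diag4 a b c d) = [:- a, 1:] * ([:- b, 1:] * ([:- c, 1:] * [:- d, 1:]))"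
proof -
  define P where "P = mat [:0, 1:] - poly_matrix (diag4 a b c d)"
  have "det P = prod (\<lambda>i. P $ i $ i) UNIV" unfolding P_def by (rule det_diagonal) (rule charmatrix_diag4_off)
  also have "\<dots> = [:- a, 1:] * ([:- b, 1:] * ([:- c, 1:] * [:- d, 1:]))"
    unfolding prod_4 unfolding P_def charmatrix_diag4_diag diag4_nth ..
  finally show ?thesis unfolding charpoly_eq P_def .
qed

lemma proots_charpoly_diag4: "proots (charpoly (diag4 a b c d)) = {#a, b, c, d#}"
proof -
  have cd: "[:- c, 1:] * [:- d, 1:] \<noteq> 0" by (rule linear_factor_mult_nonzero[OF linear_factor_nonzero])
  have bcd: "[:- b, 1:] * ([:- c, 1:] * [:- d, 1:]) \<noteq> 0" by (rule linear_factor_mult_nonzero[OF cd])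
  show ?thesis unfolding charpoly_diag4 proots_linear_factor_mult[OF bcd] proots_linear_factor_mult[OF cd] proots_linear_factor_mult[OF linear_factor_nonzero] proots_minus_linear_factor by simp
qed

text \<open>The hypotheses leave \<open>b\<close> and \<open>c\<close> unordered, which is the
  origin of \<open>max\<close> and \<open>min\<close> in the middle positions.\<close>

lemma singular_values_diag4:
  fixes A Q :: "real ^ 4 ^ 4"
  assumes "transpose Q ** Q = mat 1" "transpose Q ** (transpose A ** A) ** Q = diag4 a b c d"
    and "d \<le> b" "d \<le> c" "b \<le> a" "c \<le> a"
  shows "singular_values A = map sqrt [a, max b c, min b c, d]"
proof -
  have "charpoly (transpose A ** A) = charpoly (diag4 a b c d)"
    using charpoly_similar[OF assms(1), of "transpose A ** A"] unfolding assms(2) by (rule sym)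
  then have "proots (charpoly (transpose A ** A)) = {#a, b, c, d#}"
    by (simp only: proots_charpoly_diag4)
  also have "\<dots> = mset [d, min b c, max b c, a]" by (rule multiset_eqI) (simp add: min_def max_def)
  finally have "sorted_list_of_multiset (proots (charpoly (transpose A ** A))) = sort [d, min b c, max b c, a]"
    by (simp only: sorted_list_of_multiset_mset)
  also have "\<dots> = [d, min b c, max b c, a]" using assms by (intro sorted_sort_id) auto
  finally show ?thesis by (simp add: singular_values_def)
qed

section \<open>Singular values in dimension two and of Kronecker products\<close>

text \<open>Rotation by half the polar angle of \<open>(a - d, 2 * b)\<close> removes the
  off-diagonal entry. The radius \<open>r\<close> is the difference of the two eigenvalues, which
  gives their order.\<close>

lemma symmetric_diagonalisable_2:
  fixes S :: "real ^ 2 ^ 2"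
  assumes sym: "transpose S = S"
  obtains Q l m where "transpose Q ** Q = mat 1" "transpose Q ** S ** Q = diag2 l m" "m \<le> l"
proof -
  define a b d where "a = S $ 1 $ 1" and "b = S $ 1 $ 2" and "d = S $ 2 $ 2"
  have b': "S $ 2 $ 1 = b" using arg_cong[OF sym, of "\<lambda>M. M $ 1 $ 2"] by (simp add: transpose_def b_def)
  define r where "r = sqrt ((a - d)\<^sup>2 + (2 * b)\<^sup>2)"
  have "\<exists>t. a - d = r * cos t \<and> 2 * b = r * sin t"
  proof (cases "r = 0")
    case True
    then have "(a - d)\<^sup>2 + (2 * b)\<^sup>2 = 0" by (simp add: r_def)
    then have "a - d = 0 \<and> 2 * b = 0" by (simp only: sum_power2_eq_zero_iff)
    then show ?thesis using True by simp
  next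
    case False
    have r2: "r\<^sup>2 = (a - d)\<^sup>2 + (2 * b)\<^sup>2" by (simp add: r_def)
    have "((a - d) / r)\<^sup>2 + (2 * b / r)\<^sup>2 = ((a - d)\<^sup>2 + (2 * b)\<^sup>2) / r\<^sup>2"
      by (simp add: power_divide add_divide_distrib)
    also have "\<dots> = 1" unfolding r2[symmetric] using False by simp
    finally obtain t where "(a - d) / r = cos t" "2 * b / r = sin t"
      using sincos_total_2pi by blast
    then show ?thesis using False by (intro exI[of _ t]) (simp add: field_simps)
  qed
  then obtain t where t: "a - d = r * cos t" "2 * b = r * sin t" by blast
  define x where "x = t / 2"
  have tx: "t = x + x" by (simp add: x_def)
  have c: "a - d = r * (cos x * cos x - sin x * sin x)" and s: "b = r * (sin x * cos x)"
    using t unfolding tx cos_add sin_add by (simp_all add: algebra_simps)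
  have one: "cos x * cos x + sin x * sin x = 1" using sin_cos_squared_add[of x] by (simp add: power2_eq_square)
  define Q where "Q = rotation2 x"
  have Q: "Q $ 1 $ 1 = cos x" "Q $ 1 $ 2 = - sin x" "Q $ 2 $ 1 = sin x" "Q $ 2 $ 2 = cos x"
    by (simp_all add: Q_def rotation2_def)
  define C Sn where "C = cos x" and "Sn = sin x"
  have one': "Sn * Sn = 1 - C * C" using one unfolding C_def Sn_def by linarith
  have c': "a = d + r * (C * C - Sn * Sn)" using c by (simp add: C_def Sn_def)
  have s': "b = r * (Sn * C)" using s by (simp add: C_def Sn_def)
  define l m where "l = d + r * (C * C)" and "m = d - r * (Sn * Sn)"
  have "transpose Q ** Q = mat 1"
    using one by (simp add: vec_eq_iff forall_2 matrix_matrix_mult_def transpose_def sum_2 mat_def Q algebra_simps)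
  moreover have "transpose Q ** S ** Q = diag2 l m"
  proof -
    have 1: "C * (a * C + b * Sn) + Sn * (b * C + d * Sn) = l"
    proof -
      have "C * (a * C + b * Sn) + Sn * (b * C + d * Sn) = d * (C * C + Sn * Sn) + r * (C * C) * (C * C - Sn * Sn) + 2 * r * (C * C) * (Sn * Sn)"
        unfolding c' s' by (simp add: algebra_simps)
      also have "\<dots> = l" unfolding one' l_def by (simp add: algebra_simps)
      finally show ?thesis .
    qed
    have 2: "Sn * (a * Sn - b * C) - C * (b * Sn - d * C) = m"
    proof -
      have "Sn * (a * Sn - b * C) - C * (b * Sn - d * C) = d * (C * C + Sn * Sn) + r * (Sn * Sn) * (C * C - Sn * Sn) - 2 * r * (C * C) * (Sn * Sn)"
        unfolding c' s' by (simp add: algebra_simps)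
      also have "\<dots> = m" unfolding one' m_def by (simp add: algebra_simps)
      finally show ?thesis .
    qed
    have 3: "C * (b * C - a * Sn) + Sn * (d * C - b * Sn) = 0"
    proof -
      have "C * (b * C - a * Sn) + Sn * (d * C - b * Sn) = r * (Sn * C) * (C * C - Sn * Sn) - r * (Sn * C) * (C * C - Sn * Sn)"
        unfolding c' s' by (simp add: algebra_simps)
      then show ?thesis by simp
    qed
    show ?thesis
      using 1 2 3 unfolding C_def Sn_def
      by (simp add: vec_eq_iff forall_2 matrix_matrix_mult_def transpose_def sum_2 Q b'
          a_def[symmetric] b_def[symmetric] d_def[symmetric] algebra_simps)
  qed
  moreover have "m \<le> l"
  proof -
    have "r \<ge> 0" by (simp add: r_def)
    moreover have "l = m + r" unfolding l_def m_def one' by (simp add: algebra_simps)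
    ultimately show ?thesis by simp
  qed
  ultimately show thesis by (rule that)
qed

definition opnorm :: "real ^ 'n ^ 'm \<Rightarrow> real" where "opnorm A = onorm ((*v) A)"

lemma opnorm_mult: "opnorm (A ** B) \<le> opnorm A * opnorm B"
proof -
  have "(*v) (A ** B) = (*v) A \<circ> (*v) B" by (auto simp: matrix_vector_mul_assoc)
  then show ?thesis unfolding opnorm_def
    by (simp add: onorm_compose matrix_vector_mul_bounded_linear)
qed

lemma opnorm_pos:
  fixes A :: "real ^ 'n ^ 'm"
  assumes "A \<noteq> 0"
  shows "0 < opnorm A"
proof -
  obtain x where "A *v x \<noteq> 0" using assms unfolding matrix_eq[of A 0] by auto
  then show ?thesis unfolding opnorm_def
    by (subst onorm_pos_lt) (auto simp: matrix_vector_mul_bounded_linear)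
qed

lemma norm_matrix_vector_le: "norm (A *v x) \<le> opnorm A * norm x"
  unfolding opnorm_def by (rule onorm) (rule matrix_vector_mul_bounded_linear)

lemma det_nonzero_imp_nonzero: "det B \<noteq> 0 \<Longrightarrow> B \<noteq> (0 :: real ^ 2 ^ 2)"
  by (auto simp: det_2)

text \<open>The larger eigenvalue of \<open>transpose B ** B\<close> is the square of the operator
  norm, as seen in the rotated coordinates, and the determinant fixes the product of the
  two.\<close>

lemma singular_decomposition_2:
  fixes B :: "real ^ 2 ^ 2"
  assumes det: "det B \<noteq> 0"
  obtains Q where "transpose Q ** Q = mat 1"
    "transpose Q ** (transpose B ** B) ** Q = diag2 ((opnorm B)\<^sup>2) ((\<bar>det B\<bar> / opnorm B)\<^sup>2)"
    "\<bar>det B\<bar> / opnorm B \<le> opnorm B"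
proof -
  have "transpose (transpose B ** B) = transpose B ** B" by (simp add: matrix_transpose_mul)
  from symmetric_diagonalisable_2[OF this] obtain Q l m where
    Q: "transpose Q ** Q = mat 1" and D: "transpose Q ** (transpose B ** B) ** Q = diag2 l m" and ml: "m \<le> l"
    by blast
  have nonneg: "B \<noteq> 0" using det by (rule det_nonzero_imp_nonzero)
  then have n: "0 < opnorm B" by (rule opnorm_pos)
  have QQ: "Q ** transpose Q = mat 1" using Q by (simp add: matrix_left_right_inverse)
  have normQ: "norm (Q *v y) = norm y" for y
  proof -
    have "(Q *v y) \<bullet> (Q *v y) = y \<bullet> ((transpose Q ** Q) *v y)" by (rule inner_matrix_vector_mult)
    then show ?thesis unfolding Q norm_eq_sqrt_inner by simp
  qed
  have BQ: "(norm (B *v (Q *v y)))\<^sup>2 = l * (y $ 1)\<^sup>2 + m * (y $ 2)\<^sup>2" for y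
  proof -
    have "(norm (B *v (Q *v y)))\<^sup>2 = ((B ** Q) *v y) \<bullet> ((B ** Q) *v y)"
      by (simp add: power2_norm_eq_inner matrix_vector_mul_assoc)
    also have "\<dots> = y \<bullet> ((transpose (B ** Q) ** (B ** Q)) *v y)" by (rule inner_matrix_vector_mult)
    also have "transpose (B ** Q) ** (B ** Q) = diag2 l m"
      unfolding D[symmetric] by (simp add: matrix_transpose_mul matrix_mul_assoc)
    also have "y \<bullet> (diag2 l m *v y) = l * (y $ 1)\<^sup>2 + m * (y $ 2)\<^sup>2"
      by (simp add: inner_vec_def sum_2 matrix_vector_mult_def power2_eq_square algebra_simps)
    finally show ?thesis .
  qed
  have norm2: "(norm y)\<^sup>2 = (y $ 1)\<^sup>2 + (y $ 2)\<^sup>2" for y :: "real ^ 2"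
    unfolding power2_norm_eq_inner by (simp add: inner_vec_def sum_2 power2_eq_square)
  have l: "l = (opnorm B)\<^sup>2"
  proof (rule antisym)
    have "(norm (B *v (Q *v axis 1 1)))\<^sup>2 = l" by (simp add: BQ axis_def)
    moreover have "norm (B *v (Q *v axis 1 1)) \<le> opnorm B * 1"
      using norm_matrix_vector_le[of B "Q *v axis 1 1"] by (simp add: normQ norm_axis_1)
    ultimately show "l \<le> (opnorm B)\<^sup>2"
      using power_mono[of "norm (B *v (Q *v axis 1 1))" "opnorm B" 2] by simp
    have l0: "0 \<le> l" unfolding \<open>(norm (B *v (Q *v axis 1 1)))\<^sup>2 = l\<close>[symmetric] by simp
    have "opnorm B \<le> sqrt l" unfolding opnorm_def
    proof (rule onorm_le)
      fix x :: "real ^ 2"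
      define y where "y = transpose Q *v x"
      have x: "x = Q *v y" unfolding y_def matrix_vector_mul_assoc QQ by simp
      have "(norm (B *v x))\<^sup>2 = l * (y $ 1)\<^sup>2 + m * (y $ 2)\<^sup>2" unfolding x by (rule BQ)
      also have "\<dots> \<le> l * (y $ 1)\<^sup>2 + l * (y $ 2)\<^sup>2" using ml by (intro add_left_mono mult_right_mono) auto
      also have "\<dots> = l * (norm x)\<^sup>2" unfolding x normQ norm2 by (simp add: distrib_left)
      also have "\<dots> = (sqrt l * norm x)\<^sup>2" using l0 by (simp add: power_mult_distrib)
      finally show "norm (B *v x) \<le> sqrt l * norm x"
        by (rule power2_le_imp_le) (use l0 in simp)
    qed
    then have "(opnorm B)\<^sup>2 \<le> (sqrt l)\<^sup>2" using n by (intro power_mono) auto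
    then show "(opnorm B)\<^sup>2 \<le> l" using l0 by simp
  qed
  have detQ: "det Q * det Q = 1" using arg_cong[OF Q, of det] by (simp add: det_mul)
  have "det (diag2 l m) = (det B)\<^sup>2"
    unfolding D[symmetric] using detQ by (simp add: det_mul power2_eq_square mult_ac)
  then have lm: "l * m = (det B)\<^sup>2" by (simp add: det_2)
  then have m: "m = (\<bar>det B\<bar> / opnorm B)\<^sup>2"
    using n by (simp add: l power_divide field_simps)
  have "(\<bar>det B\<bar> / opnorm B)\<^sup>2 \<le> (opnorm B)\<^sup>2" using ml unfolding l m .
  then have "\<bar>det B\<bar> / opnorm B \<le> opnorm B" by (rule power2_le_imp_le) (use n in simp)
  then show thesis using Q D unfolding l m by (intro that)
qed

text \<open>The Kronecker product of the two orthogonal diagonalising matrices is orthogonal and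
  diagonalises \<open>transpose (kron B C) ** kron B C\<close>.\<close>

lemma singular_values_kron:
  assumes B: "det B \<noteq> 0" and C: "det C \<noteq> 0"
  defines "b1 \<equiv> opnorm B" and "b2 \<equiv> \<bar>det B\<bar> / opnorm B" and "c1 \<equiv> opnorm C" and "c2 \<equiv> \<bar>det C\<bar> / opnorm C"
  shows "singular_values (kron B C) = [b1 * c1, max (b1 * c2) (b2 * c1), min (b1 * c2) (b2 * c1), b2 * c2]"
proof -
  obtain Q where Q: "transpose Q ** Q = mat 1" "transpose Q ** (transpose B ** B) ** Q = diag2 (b1\<^sup>2) (b2\<^sup>2)"
    and b: "b2 \<le> b1"
    using singular_decomposition_2[OF B] unfolding b1_def b2_def by blast
  obtain R where R: "transpose R ** R = mat 1" "transpose R ** (transpose C ** C) ** R = diag2 (c1\<^sup>2) (c2\<^sup>2)"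
    and c: "c2 \<le> c1"
    using singular_decomposition_2[OF C] unfolding c1_def c2_def by blast
  have "B \<noteq> 0" "C \<noteq> 0" using B C by (simp_all add: det_nonzero_imp_nonzero)
  then have pos: "0 < b1" "0 \<le> b2" "0 < c1" "0 \<le> c2"
    unfolding b1_def b2_def c1_def c2_def using opnorm_pos[of B] opnorm_pos[of C] by auto
  have sq: "x\<^sup>2 * y\<^sup>2 = (x * y)\<^sup>2" for x y :: real by (simp add: power_mult_distrib)
  have sv: "singular_values (kron B C) =
      map sqrt [(b1 * c1)\<^sup>2, max ((b1 * c2)\<^sup>2) ((b2 * c1)\<^sup>2), min ((b1 * c2)\<^sup>2) ((b2 * c1)\<^sup>2), (b2 * c2)\<^sup>2]"
  proof (rule singular_values_diag4)
    show "transpose (kron Q R) ** kron Q R = mat 1"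
      by (simp add: transpose_kron kron_mult Q(1) R(1) kron_one)
    show "transpose (kron Q R) ** (transpose (kron B C) ** kron B C) ** kron Q R =
        diag4 ((b1 * c1)\<^sup>2) ((b1 * c2)\<^sup>2) ((b2 * c1)\<^sup>2) ((b2 * c2)\<^sup>2)"
      by (simp add: transpose_kron kron_mult Q(2) R(2) kron_diag2 sq)
  qed (use pos b c in \<open>auto intro!: power_mono mult_mono\<close>)
  have sqrt: "sqrt (max (x\<^sup>2) (y\<^sup>2)) = max x y" "sqrt (min (x\<^sup>2) (y\<^sup>2)) = min x y" if "0 \<le> x" "0 \<le> y" for x y :: real
  proof -
    have "x\<^sup>2 \<le> y\<^sup>2 \<longleftrightarrow> x \<le> y" using that by (simp add: power_mono_iff)
    then show "sqrt (max (x\<^sup>2) (y\<^sup>2)) = max x y" "sqrt (min (x\<^sup>2) (y\<^sup>2)) = min x y"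
      using that by (simp_all add: max_def min_def)
  qed
  show ?thesis unfolding sv using pos by (simp add: sqrt)
qed

text \<open>On \<open>1 < s < 3\<close> the singular value function of a Kronecker product is the maximum of two
  functions, each of which depends only on the norms and the determinants of the factors.\<close>

definition factor_potential :: "real \<Rightarrow> real ^ 2 ^ 2 \<Rightarrow> real ^ 2 ^ 2 \<Rightarrow> real" where
  "factor_potential s X Y = opnorm X powr (2 - \<bar>s - 2\<bar>) * opnorm Y powr \<bar>s - 2\<bar> *
     \<bar>det X\<bar> powr max 0 (s - 2) * \<bar>det Y\<bar> powr min 1 (s - 1)"

text \<open>In logarithmic variables the singular value function is affine apart from one maximum,
  which has coefficient \<open>s - 1\<close> up to 2 and \<open>3 - s\<close> above, that is
  \<open>1 - \<bar>s - 2\<bar>\<close> in both ranges. A positive coefficient lets the maximum be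
  moved outside, and its two branches are the two orders of the factors.\<close>

lemma sv_function_kron:
  assumes B: "det B \<noteq> 0" and C: "det C \<noteq> 0" and s: "1 < s" "s < 3"
  shows "sv_function s (kron B C) = max (factor_potential s B C) (factor_potential s C B)"
proof -
  have nz: "B \<noteq> 0" "C \<noteq> 0" using B C by (simp_all add: det_nonzero_imp_nonzero)
  define x y u v where "x = ln (opnorm B)" and "y = ln (opnorm C)" and "u = ln \<bar>det B\<bar>" and "v = ln \<bar>det C\<bar>"
  have e: "opnorm B = exp x" "opnorm C = exp y" "\<bar>det B\<bar> = exp u" "\<bar>det C\<bar> = exp v"
    using opnorm_pos[OF nz(1)] opnorm_pos[OF nz(2)] B C by (simp_all add: x_def y_def u_def v_def)
  have powr: "exp a powr b = exp (b * a)" for a b :: real by (simp add: powr_def)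
  have max_exp: "max (exp a) (exp b) = exp (max a b)" and min_exp: "min (exp a) (exp b) = exp (min a b)" for a b :: real
    by (auto simp: max_def min_def)
  have sv: "singular_values (kron B C) = [exp (x + y), exp (max (x + v - y) (u - x + y)), exp (min (x + v - y) (u - x + y)), exp (u - x + v - y)]"
  proof -
    have "exp x * exp y = exp (x + y)" "exp u / exp x * exp y = exp (u - x + y)"
      "exp x * (exp v / exp y) = exp (x + v - y)" "exp u / exp x * (exp v / exp y) = exp (u - x + v - y)"
      by (simp_all add: exp_add exp_diff)
    then show ?thesis unfolding singular_values_kron[OF B C] e by (simp only: max_exp min_exp)
  qed
  have pot: "factor_potential s B C = exp ((2 - \<bar>s - 2\<bar>) * x + \<bar>s - 2\<bar> * y + max 0 (s - 2) * u + min 1 (s - 1) * v)"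
    "factor_potential s C B = exp ((2 - \<bar>s - 2\<bar>) * y + \<bar>s - 2\<bar> * x + max 0 (s - 2) * v + min 1 (s - 1) * u)"
    unfolding factor_potential_def e powr exp_add by simp_all
  have sv1: "singular_value 1 (kron B C) = exp (x + y)"
    and sv2: "singular_value 2 (kron B C) = exp (max (x + v - y) (u - x + y))"
    and sv3: "singular_value 3 (kron B C) = exp (min (x + v - y) (u - x + y))"
    by (simp_all add: singular_value_def sv)
  have prod2: "(\<Prod>k = 1..2::nat. f k) = f 1 * f 2" for f :: "nat \<Rightarrow> real"
    by (simp add: numeral_2_eq_2)
  consider "s < 2" | "s = 2" | "2 < s" by linarith
  then show ?thesis
  proof cases
    case 1
    have fl: "\<lfloor>s\<rfloor> = 1" "\<lceil>s\<rceil> = 2" using s 1 by linarith+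
    have "s \<notin> \<int>"
    proof
      assume "s \<in> \<int>"
      then have "\<lfloor>s\<rfloor> = \<lceil>s\<rceil>" by (auto elim: Ints_cases)
      then show False using fl by simp
    qed
    then have "sv_function s (kron B C) = exp (x + y) * exp (max (x + v - y) (u - x + y)) powr (s - 1)"
      using s sv1 sv2 by (simp add: sv_function_def fl)
    also have "\<dots> = exp (x + y + (s - 1) * max (x + v - y) (u - x + y))" by (simp add: powr exp_add)
    also have "(s - 1) * max (x + v - y) (u - x + y) = max ((s - 1) * (x + v - y)) ((s - 1) * (u - x + y))"
      using s by (simp add: max_mult_distrib_left)
    also have "x + y + \<dots> = max (x + y + (s - 1) * (x + v - y)) (x + y + (s - 1) * (u - x + y))"
      by (simp add: max_add_distrib_right)
    finally show ?thesis unfolding pot max_exp using 1 s by (simp add: algebra_simps)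
  next
    case 2
    then have "sv_function s (kron B C) = (\<Prod>k = 1..2. singular_value k (kron B C))"
      by (simp add: sv_function_def)
    also have "\<dots> = exp (x + y) * exp (max (x + v - y) (u - x + y))"
      unfolding prod2 sv1 sv2 ..
    also have "\<dots> = exp (max (x + y + (x + v - y)) (x + y + (u - x + y)))"
      by (simp only: exp_add[symmetric] max_add_distrib_right)
    finally show ?thesis unfolding pot max_exp using 2 by (simp add: algebra_simps)
  next
    case 3
    have fl: "\<lfloor>s\<rfloor> = 2" "\<lceil>s\<rceil> = 3" using s 3 by linarith+
    have "s \<notin> \<int>"
    proof
      assume "s \<in> \<int>"
      then have "\<lfloor>s\<rfloor> = \<lceil>s\<rceil>" by (auto elim: Ints_cases)
      then show False using fl by simp
    qed
    then have "sv_function s (kron B C) = (\<Prod>k = 1..2. singular_value k (kron B C)) * singular_value 3 (kron B C) powr (s - 2)"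
      using s by (simp add: sv_function_def fl)
    also have "\<dots> = exp (x + y) * exp (max (x + v - y) (u - x + y)) * exp (min (x + v - y) (u - x + y)) powr (s - 2)"
      unfolding prod2 sv1 sv2 sv3 ..
    also have "\<dots> = exp (x + y + max (x + v - y) (u - x + y) + (s - 2) * min (x + v - y) (u - x + y))"
      by (simp add: powr exp_add)
    \<comment> \<open>The two middle exponents add up to \<open>u + v\<close>, so the smaller one
      can be eliminated in favour of the larger.\<close>
    also have "x + y + max (x + v - y) (u - x + y) + (s - 2) * min (x + v - y) (u - x + y)
      = x + y + (s - 2) * (u + v) + (3 - s) * max (x + v - y) (u - x + y)"
      by (cases "x + v - y \<le> u - x + y") (simp_all add: max_def min_def algebra_simps)
    also have "(3 - s) * max (x + v - y) (u - x + y) = max ((3 - s) * (x + v - y)) ((3 - s) * (u - x + y))"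
      using s by (simp add: max_mult_distrib_left)
    also have "x + y + (s - 2) * (u + v) + \<dots> =
       max (x + y + (s - 2) * (u + v) + (3 - s) * (x + v - y)) (x + y + (s - 2) * (u + v) + (3 - s) * (u - x + y))"
      by (simp add: max_add_distrib_right)
    finally show ?thesis unfolding pot max_exp using 3 s by (simp add: algebra_simps)
  qed
qed

section \<open>Strong irreducibility\<close>

text \<open>A real vector space is not a finite union of proper subspaces: two of the infinitely
  many points on a line in direction \<open>x\<close> share a subspace, which then contains
  \<open>x\<close>.\<close>

lemma subspace_Union_cover:
  fixes W :: "'a :: real_vector set"
  assumes "finite F" "subspace W" "\<And>V. V \<in> F \<Longrightarrow> subspace V" "W \<subseteq> \<Union>F"
  shows "\<exists>V\<in>F. W \<subseteq> V"
  using assms(1,3,4)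
proof (induction F)
  case empty
  then show ?case using subspace_0[OF assms(2)] by auto
next
  case (insert V F)
  have V: "subspace V" using insert.prems(1) by simp
  show ?case
  proof (rule ccontr)
    assume no: "\<not> (\<exists>U\<in>insert V F. W \<subseteq> U)"
    then have "\<not> W \<subseteq> V" by simp
    then obtain y where y: "y \<in> W" "y \<notin> V" by (meson subsetI)
    have "\<not> W \<subseteq> \<Union>F"
    proof
      assume "W \<subseteq> \<Union>F"
      then have "\<exists>U\<in>F. W \<subseteq> U" using insert.IH insert.prems(1) by simp
      then show False using no by simp
    qed
    then obtain x where x: "x \<in> W" "x \<notin> \<Union>F" by (meson subsetI)
    then have xV: "x \<in> V" using insert.prems(2) by (metis Union_insert UnE subsetD)
    \<comment> \<open>The line avoids \<open>V\<close> because \<open>x\<close> lies in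
      \<open>V\<close> and \<open>y\<close> does not, so each of its points has to be covered by
      \<open>F\<close>.\<close>
    define g where "g = (\<lambda>t::nat. SOME U. U \<in> F \<and> y + real t *\<^sub>R x \<in> U)"
    have g: "g t \<in> F \<and> y + real t *\<^sub>R x \<in> g t" for t
      unfolding g_def
    proof (rule someI_ex)
      have "y + real t *\<^sub>R x \<in> W" using x y assms(2) by (simp add: subspace_add subspace_mul)
      moreover have "y + real t *\<^sub>R x \<notin> V"
      proof
        assume "y + real t *\<^sub>R x \<in> V"
        then have "(y + real t *\<^sub>R x) - real t *\<^sub>R x \<in> V" using V xV by (intro subspace_diff subspace_mul)
        then show False using y by simp
      qed
      ultimately show "\<exists>U. U \<in> F \<and> y + real t *\<^sub>R x \<in> U" using insert.prems(2) by (metis Union_iff Union_insert UnE subsetD)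
    qed
    have "finite (g ` UNIV)" using g insert.hyps(1) by (intro finite_subset[OF _ insert.hyps(1)]) auto
    then obtain t0 where "infinite {t. g t = g t0}"
      using pigeonhole_infinite[of UNIV g] infinite_UNIV_nat by auto
    then have "infinite ({t. g t = g t0} - {t0})" by simp
    then obtain t where t: "g t = g t0" "t \<noteq> t0" using infinite_imp_nonempty by blast
    have U: "subspace (g t0)" using g[of t0] insert.prems(1) by simp
    have "(y + real t *\<^sub>R x) - (y + real t0 *\<^sub>R x) \<in> g t0"
      using g[of t] g[of t0] t(1) by (intro subspace_diff[OF U]) simp_all
    then have "(real t - real t0) *\<^sub>R x \<in> g t0" by (simp add: scaleR_left_diff_distrib)
    then have "inverse (real t - real t0) *\<^sub>R ((real t - real t0) *\<^sub>R x) \<in> g t0" by (rule subspace_mul[OF U])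
    then have "x \<in> g t0" using t(2) by simp
    then show False using x g[of t0] by blast
  qed
qed

text \<open>An injective self-map of a finite set is a permutation, and the product of the
  individual periods is a common period.\<close>

lemma finite_inj_periodic:
  assumes fin: "finite W" and f: "f \<in> W \<rightarrow> W" and inj: "inj_on f W"
  shows "\<exists>n>0. \<forall>V\<in>W. (f ^^ n) V = V"
proof -
  have fn: "(f ^^ n) V \<in> W" if "V \<in> W" for n V by (rule funpow_in_space[OF f that])
  have inj_n: "U = V" if "(f ^^ n) U = (f ^^ n) V" "U \<in> W" "V \<in> W" for n U V
    using that
  proof (induction n)
    case (Suc n)
    have "(f ^^ n) U = (f ^^ n) V" using inj_onD[OF inj] Suc.prems fn by simp
    then show ?case using Suc by simp
  qed simp
  have one: "\<exists>n>0. (f ^^ n) V = V" if V: "V \<in> W" for V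
  proof -
    have "finite (range (\<lambda>n. (f ^^ n) V))" by (rule finite_subset[OF _ fin]) (use fn V in auto)
    then obtain i where "infinite {n. (f ^^ n) V = (f ^^ i) V}"
      using pigeonhole_infinite[of UNIV "\<lambda>n. (f ^^ n) V"] infinite_UNIV_nat by auto
    then obtain j where j: "(f ^^ j) V = (f ^^ i) V" "j > i"
      unfolding infinite_nat_iff_unbounded by blast
    have "(f ^^ i) ((f ^^ (j - i)) V) = (f ^^ (i + (j - i))) V" by (simp only: funpow_add comp_apply)
    then have "(f ^^ i) ((f ^^ (j - i)) V) = (f ^^ i) V" using j by simp
    then have "(f ^^ (j - i)) V = V" by (rule inj_n[OF _ fn[OF V] V])
    then show ?thesis using j(2) by (intro exI[of _ "j - i"]) simp
  qed
  then obtain n where n: "\<And>V. V \<in> W \<Longrightarrow> n V > 0 \<and> (f ^^ n V) V = V" by metis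
  have iter: "(f ^^ (k * n V)) V = V" if V: "V \<in> W" for k V
    by (induction k) (use n[OF V] in \<open>simp_all add: funpow_add\<close>)
  define M where "M = (\<Prod>V\<in>W. n V)"
  have "M > 0" unfolding M_def using n by (simp add: prod_pos)
  moreover have "(f ^^ M) V = V" if V: "V \<in> W" for V
  proof -
    have "n V dvd M" unfolding M_def using fin V by (rule dvd_prodI)
    then obtain k where "M = k * n V" by (metis dvd_def mult.commute)
    then show ?thesis using iter[OF V] by simp
  qed
  ultimately show ?thesis by blast
qed

lemma diag2_mult: "diag2 a b ** diag2 c d = diag2 (a * c) (b * d)"
  by (simp add: vec_eq_iff forall_2 matrix_matrix_mult_def sum_2)

lemma rotation2_nth [simp]:
  "rotation2 t $ 1 $ 1 = cos t" "rotation2 t $ 1 $ 2 = - sin t"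
  "rotation2 t $ 2 $ 1 = sin t" "rotation2 t $ 2 $ 2 = cos t"
  by (simp_all add: rotation2_def)

lemma rotation2_mult: "rotation2 s ** rotation2 t = rotation2 (s + t)"
  by (simp add: vec_eq_iff forall_2 matrix_matrix_mult_def sum_2 cos_add sin_add)

lemma kron_add_left: "kron (X + X') Y = kron X Y + kron X' Y"
  by (simp add: vec_eq_iff kron_nth algebra_simps)

lemma kron_add_right: "kron X (Y + Y') = kron X Y + kron X Y'"
  by (simp add: vec_eq_iff kron_nth algebra_simps)

lemma kron_scaleR_left: "kron (r *\<^sub>R X) Y = r *\<^sub>R kron X Y"
  by (simp add: vec_eq_iff kron_nth)

lemma kron_scaleR_right: "kron X (r *\<^sub>R Y) = r *\<^sub>R kron X Y"
  by (simp add: vec_eq_iff kron_nth)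

text \<open>\<open>J\<close> stands for the Kronecker product with its factors in either order. The characteristic
  polynomial of the second diagonal block of \<open>J (diag a b) \<rho>\<close> kills that block but not the first
  one, which produces the projection \<open>J (diag 1 0) 1\<close>; its conjugate by a rotation then gives all of
  \<open>J X 1\<close>.\<close>

lemma kronecker_algebra:
  fixes J :: "real ^ 2 ^ 2 \<Rightarrow> real ^ 2 ^ 2 \<Rightarrow> real ^ 4 ^ 4" and \<A> :: "(real ^ 4 ^ 4) set"
  assumes mult: "\<And>X Y X' Y'. J X Y ** J X' Y' = J (X ** X') (Y ** Y')"
    and addl: "\<And>X X' Y. J (X + X') Y = J X Y + J X' Y" and addr: "\<And>X Y Y'. J X (Y + Y') = J X Y + J X Y'"
    and sl: "\<And>r X Y. J (r *\<^sub>R X) Y = r *\<^sub>R J X Y" and sr: "\<And>r X Y. J X (r *\<^sub>R Y) = r *\<^sub>R J X Y"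
    and A_mult: "\<And>M M'. M \<in> \<A> \<Longrightarrow> M' \<in> \<A> \<Longrightarrow> M ** M' \<in> \<A>"
    and A_add: "\<And>M M'. M \<in> \<A> \<Longrightarrow> M' \<in> \<A> \<Longrightarrow> M + M' \<in> \<A>"
    and A_scale: "\<And>r M. M \<in> \<A> \<Longrightarrow> r *\<^sub>R M \<in> \<A>"
    and A_one: "J (mat 1) (mat 1) \<in> \<A>"
    and conj: "\<And>X X'. J X (mat 1) \<in> \<A> \<Longrightarrow> X' ** rotation2 \<theta> = rotation2 \<theta> ** X \<Longrightarrow> J X' (mat 1) \<in> \<A>"
    and cs: "cos \<theta> * sin \<theta> \<noteq> 0"
    and ab: "\<bar>a\<bar> \<noteq> \<bar>b\<bar>" and mem: "J (diag2 a b) (rotation2 t) \<in> \<A>"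
  shows "J X (mat 1) \<in> \<A>"
proof -
  define M where "M = J (diag2 a b) (rotation2 t)"
  \<comment> \<open>\<open>Y\<close> represents the complex number \<open>x + i y\<close>. It is the
    value at \<open>a *\<^sub>R rotation2 t\<close> of the characteristic polynomial of
    \<open>b *\<^sub>R rotation2 t\<close>.\<close>
  define x y where "x = (2 * a\<^sup>2 - 2 * a * b) * (cos t)\<^sup>2 + b\<^sup>2 - a\<^sup>2"
    and "y = (2 * a\<^sup>2 - 2 * a * b) * (cos t * sin t)"
  define Y :: "real ^ 2 ^ 2" where "Y = vector [vector [x, - y], vector [y, x]]"
  have Y [simp]: "Y $ 1 $ 1 = x" "Y $ 1 $ 2 = - y" "Y $ 2 $ 1 = y" "Y $ 2 $ 2 = x"
    by (simp_all add: Y_def)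
  have a_ne: "a\<^sup>2 \<noteq> b\<^sup>2" using ab by (simp add: power2_eq_iff abs_eq_iff)
  have R2: "rotation2 t ** rotation2 t = (2 * cos t) *\<^sub>R rotation2 t + (-1) *\<^sub>R mat 1"
    using sin_cos_squared_add[of t]
    by (simp add: vec_eq_iff forall_2 matrix_matrix_mult_def sum_2 mat_def power2_eq_square algebra_simps)
  have split: "diag2 p q = p *\<^sub>R diag2 1 0 + q *\<^sub>R diag2 0 1" for p q
    by (simp add: vec_eq_iff forall_2)
  have one: "mat 1 = diag2 1 1" by (simp add: vec_eq_iff forall_2 mat_def)
  have "M ** M + (- 2 * b * cos t) *\<^sub>R M + (b\<^sup>2) *\<^sub>R J (mat 1) (mat 1) = J (diag2 1 0) Y"
  proof -
    have "M ** M = J (diag2 (a\<^sup>2) (b\<^sup>2)) (rotation2 t ** rotation2 t)"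
      by (simp add: M_def mult diag2_mult power2_eq_square)
    then have MM: "M ** M = (a\<^sup>2) *\<^sub>R J (diag2 1 0) (rotation2 t ** rotation2 t) + (b\<^sup>2) *\<^sub>R J (diag2 0 1) (rotation2 t ** rotation2 t)"
      unfolding split[of "a\<^sup>2"] by (simp only: addl sl)
    have M1: "M = a *\<^sub>R J (diag2 1 0) (rotation2 t) + b *\<^sub>R J (diag2 0 1) (rotation2 t)"
      unfolding M_def split[of a] by (simp only: addl sl)
    have I1: "J (mat 1) (mat 1) = J (diag2 1 0) (mat 1) + J (diag2 0 1) (mat 1)"
      unfolding one using split[of 1 1] addl[of "diag2 1 0" "diag2 0 1"] by simp
    have Yeq: "Y = (a\<^sup>2 * 2 * cos t - 2 * a * b * cos t) *\<^sub>R rotation2 t + (b\<^sup>2 - a\<^sup>2) *\<^sub>R mat 1"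
      by (simp add: vec_eq_iff forall_2 mat_def x_def y_def power2_eq_square algebra_simps)
    show ?thesis
      unfolding MM I1 R2 addr sr unfolding M1 Yeq addr sr
      by (simp add: algebra_simps power2_eq_square)
  qed
  moreover have "M ** M + (- 2 * b * cos t) *\<^sub>R M + (b\<^sup>2) *\<^sub>R J (mat 1) (mat 1) \<in> \<A>"
    using mem A_one unfolding M_def by (intro A_add A_mult A_scale)
  ultimately have F: "J (diag2 1 0) Y \<in> \<A>" by simp
  \<comment> \<open>The eigenvalues of the two blocks have moduli \<open>\<bar>a\<bar>\<close> and
    \<open>\<bar>b\<bar>\<close>, so none is shared and the polynomial does not vanish on the first
    block.\<close>
  have "y \<noteq> 0 \<or> x \<noteq> 0"
  proof (cases "y = 0")
    case True
    have "2 * a\<^sup>2 - 2 * a * b = 0 \<or> cos t = 0 \<or> sin t = 0" using True by (auto simp: y_def)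
    then show ?thesis
    proof (elim disjE)
      assume "2 * a\<^sup>2 - 2 * a * b = 0"
      then have "x = b\<^sup>2 - a\<^sup>2" by (simp add: x_def)
      then show ?thesis using a_ne by simp
    next
      assume "cos t = 0"
      then have "x = b\<^sup>2 - a\<^sup>2" by (simp add: x_def)
      then show ?thesis using a_ne by simp
    next
      assume "sin t = 0"
      then have "(cos t)\<^sup>2 = 1" using sin_cos_squared_add[of t] by simp
      then have "x = (a - b)\<^sup>2" by (simp add: x_def power2_eq_square algebra_simps)
      then show ?thesis using ab by auto
    qed
  qed simp
  then have xy: "x\<^sup>2 + y\<^sup>2 \<noteq> 0" by (simp add: sum_power2_eq_zero_iff) blast
  have E11: "J (diag2 1 0) (mat 1) \<in> \<A>"
  proof -
    \<comment> \<open>Cayley-Hamilton for \<open>Y\<close>, of trace \<open>2 * x\<close> and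
      determinant \<open>x\<^sup>2 + y\<^sup>2\<close>. As the determinant is nonzero, the identity
      in the second argument can be solved for.\<close>
    have Y2: "Y ** Y = (2 * x) *\<^sub>R Y + (- (x\<^sup>2 + y\<^sup>2)) *\<^sub>R mat 1"
      by (simp add: vec_eq_iff forall_2 matrix_matrix_mult_def sum_2 mat_def power2_eq_square algebra_simps)
    have FF: "J (diag2 1 0) Y ** J (diag2 1 0) Y = (2 * x) *\<^sub>R J (diag2 1 0) Y + (- (x\<^sup>2 + y\<^sup>2)) *\<^sub>R J (diag2 1 0) (mat 1)"
      unfolding mult diag2_mult Y2 addr sr by simp
    have "(1 / (x\<^sup>2 + y\<^sup>2)) *\<^sub>R ((2 * x) *\<^sub>R J (diag2 1 0) Y + (-1) *\<^sub>R (J (diag2 1 0) Y ** J (diag2 1 0) Y)) \<in> \<A>"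
      using F by (intro A_scale A_add A_mult)
    also have "(2 * x) *\<^sub>R J (diag2 1 0) Y + (-1) *\<^sub>R (J (diag2 1 0) Y ** J (diag2 1 0) Y) = (x\<^sup>2 + y\<^sup>2) *\<^sub>R J (diag2 1 0) (mat 1)"
      unfolding FF by (simp add: algebra_simps)
    finally have scaled: "(1 / (x\<^sup>2 + y\<^sup>2)) *\<^sub>R ((x\<^sup>2 + y\<^sup>2) *\<^sub>R J (diag2 1 0) (mat 1)) \<in> \<A>" .
    have sc: "(1 / k) *\<^sub>R (k *\<^sub>R L) = L" if "k \<noteq> 0" for k :: real and L :: "real ^ 4 ^ 4"
      using that by simp
    show ?thesis using scaled unfolding sc[OF xy] .
  qed
  have E22: "J (diag2 0 1) (mat 1) \<in> \<A>"
  proof -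
    have "J (mat 1) (mat 1) + (-1) *\<^sub>R J (diag2 1 0) (mat 1) \<in> \<A>"
      using A_one E11 by (intro A_scale A_add)
    also have "J (mat 1) (mat 1) + (-1) *\<^sub>R J (diag2 1 0) (mat 1) = J (mat 1 + (-1) *\<^sub>R diag2 1 0) (mat 1)"
      by (simp only: addl sl)
    also have "mat 1 + (-1) *\<^sub>R diag2 1 0 = diag2 0 1" by (simp add: vec_eq_iff forall_2 mat_def)
    finally show ?thesis .
  qed
  \<comment> \<open>The projection onto the first axis, turned by \<open>\<theta>\<close>. Its
    off-diagonal entries \<open>cos \<theta> * sin \<theta>\<close> are nonzero, so cutting it with
    the two coordinate projections yields multiples of both off-diagonal matrix units.\<close>
  define G :: "real ^ 2 ^ 2" where
    "G = vector [vector [(cos \<theta>)\<^sup>2, cos \<theta> * sin \<theta>], vector [cos \<theta> * sin \<theta>, (sin \<theta>)\<^sup>2]]"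
  have G [simp]: "G $ 1 $ 1 = (cos \<theta>)\<^sup>2" "G $ 1 $ 2 = cos \<theta> * sin \<theta>" "G $ 2 $ 1 = cos \<theta> * sin \<theta>" "G $ 2 $ 2 = (sin \<theta>)\<^sup>2"
    by (simp_all add: G_def)
  have GA: "J G (mat 1) \<in> \<A>"
  proof (rule conj[OF E11])
    have "cos \<theta> * (cos \<theta>)\<^sup>2 + cos \<theta> * (sin \<theta>)\<^sup>2 = cos \<theta>" "sin \<theta> * (cos \<theta>)\<^sup>2 + sin \<theta> * (sin \<theta>)\<^sup>2 = sin \<theta>"
      by (simp_all add: distrib_left[symmetric])
    then show "G ** rotation2 \<theta> = rotation2 \<theta> ** diag2 1 0"
      by (simp add: vec_eq_iff forall_2 matrix_matrix_mult_def sum_2 power2_eq_square algebra_simps)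
  qed
  define E12 E21 where "E12 = diag2 1 0 ** G ** diag2 0 1" and "E21 = diag2 0 1 ** G ** diag2 1 0"
  have E: "E12 $ 1 $ 1 = 0" "E12 $ 1 $ 2 = cos \<theta> * sin \<theta>" "E12 $ 2 $ 1 = 0" "E12 $ 2 $ 2 = 0"
    "E21 $ 1 $ 1 = 0" "E21 $ 1 $ 2 = 0" "E21 $ 2 $ 1 = cos \<theta> * sin \<theta>" "E21 $ 2 $ 2 = 0"
    by (simp_all add: E12_def E21_def matrix_matrix_mult_def sum_2)
  have "J E12 (mat 1) \<in> \<A>" "J E21 (mat 1) \<in> \<A>"
    using A_mult[OF A_mult[OF E11 GA] E22] A_mult[OF A_mult[OF E22 GA] E11]
    unfolding mult matrix_mul_lid E12_def E21_def by simp_all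
  then have "J ((X $ 1 $ 1) *\<^sub>R diag2 1 0 + (X $ 2 $ 2) *\<^sub>R diag2 0 1 +
      (X $ 1 $ 2 / (cos \<theta> * sin \<theta>)) *\<^sub>R E12 + (X $ 2 $ 1 / (cos \<theta> * sin \<theta>)) *\<^sub>R E21) (mat 1) \<in> \<A>"
    unfolding addl sl using E11 E22 by (intro A_add A_scale)
  moreover have "(X $ 1 $ 1) *\<^sub>R diag2 1 0 + (X $ 2 $ 2) *\<^sub>R diag2 0 1 +
      (X $ 1 $ 2 / (cos \<theta> * sin \<theta>)) *\<^sub>R E12 + (X $ 2 $ 1 / (cos \<theta> * sin \<theta>)) *\<^sub>R E21 = X"
    using cs by (simp add: vec_eq_iff forall_2 E)
  ultimately show ?thesis by (simp only:)
qed

lemma invertible_imp_inj_matrix: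
  fixes A :: "real ^ 'n ^ 'n"
  assumes A: "invertible A"
  shows "inj ((*v) A)"
proof (rule injI)
  fix v w assume eq: "A *v v = A *v w"
  obtain B where B: "B ** A = mat 1" using A unfolding invertible_def by blast
  have "B *v (A *v v) = B *v (A *v w)" unfolding eq ..
  then show "v = w" unfolding matrix_vector_mul_assoc B by simp
qed

text \<open>In an invariant collection, the subspaces of maximal dimension are permuted by each
  generator. The matrices preserving every one of them form an algebra that is stable under
  conjugation by the generators and contains a power of each. By the preceding algebra it contains
  all Kronecker products, in particular all matrix units, which leave no nonzero proper subspace
  invariant.\<close>

lemma kron_pair_strongly_irreducible:
  fixes A :: "nat \<Rightarrow> real ^ 4 ^ 4"
  assumes ab: "a \<noteq> 0" "b \<noteq> 0" "\<bar>a\<bar> \<noteq> \<bar>b\<bar>" and cs: "cos \<theta> * sin \<theta> \<noteq> 0"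
    and A: "A 1 = kron (diag2 a b) (rotation2 \<theta>)" "A 2 = kron (rotation2 \<theta>) (diag2 a b)"
  shows "strongly_irreducible 2 A"
proof -
  let ?R = "rotation2 \<theta>" and ?D = "diag2 a b"
  have RR: "rotation2 (- \<theta>) ** ?R = mat 1" "?R ** rotation2 (- \<theta>) = mat 1"
    unfolding rotation2_mult by (simp_all add: vec_eq_iff forall_2 mat_def)
  have DD: "diag2 (1 / a) (1 / b) ** ?D = mat 1" "?D ** diag2 (1 / a) (1 / b) = mat 1"
    unfolding diag2_mult using ab by (simp_all add: vec_eq_iff forall_2 mat_def)
  have "invertible (A 1)" unfolding invertible_def A
    by (rule exI[of _ "kron (diag2 (1 / a) (1 / b)) (rotation2 (- \<theta>))"]) (simp add: kron_mult RR DD kron_one)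
  moreover have "invertible (A 2)" unfolding invertible_def A
    by (rule exI[of _ "kron (rotation2 (- \<theta>)) (diag2 (1 / a) (1 / b))"]) (simp add: kron_mult RR DD kron_one)
  moreover have set12: "{1..2::nat} = {1, 2}" by auto
  ultimately have inv: "invertible (A i)" if "i \<in> {1..2}" for i using that by auto
  have inj: "inj ((*v) (A i))" if "i \<in> {1..2}" for i
    using invertible_imp_inj_matrix[OF inv[OF that]] .
  have "\<not> (\<exists>\<V>. finite \<V> \<and> \<V> \<noteq> {} \<and> (\<forall>V\<in>\<V>. subspace V \<and> V \<noteq> {0} \<and> V \<noteq> UNIV) \<and>
      (\<forall>i\<in>{1..2}. (\<lambda>v. A i *v v) ` \<Union>\<V> = \<Union>\<V>))"
  proof
    assume "\<exists>\<V>. finite \<V> \<and> \<V> \<noteq> {} \<and> (\<forall>V\<in>\<V>. subspace V \<and> V \<noteq> {0} \<and> V \<noteq> UNIV) \<and>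
      (\<forall>i\<in>{1..2}. (\<lambda>v. A i *v v) ` \<Union>\<V> = \<Union>\<V>)"
    then obtain \<V> where *: "finite \<V> \<and> \<V> \<noteq> {} \<and> (\<forall>V\<in>\<V>. subspace V \<and> V \<noteq> {0} \<and> V \<noteq> UNIV) \<and>
      (\<forall>i\<in>{1..2}. (\<lambda>v. A i *v v) ` \<Union>\<V> = \<Union>\<V>)" by (rule exE)
    note \<V> = *[THEN conjunct1] *[THEN conjunct2, THEN conjunct1]
    note sub = *[THEN conjunct2, THEN conjunct2, THEN conjunct1, THEN bspec]
    note un = *[THEN conjunct2, THEN conjunct2, THEN conjunct2, THEN bspec]
    define m where "m = Max (dim ` \<V>)"
    define W where "W = {V \<in> \<V>. dim V = m}"
    have le_m: "dim V \<le> m" if "V \<in> \<V>" for V unfolding m_def using \<V>(1) that by simp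
    have "m \<in> dim ` \<V>" unfolding m_def using \<V> by (intro Max_in) auto
    then have W: "W \<noteq> {}" "finite W" unfolding W_def using \<V>(1) by auto
    \<comment> \<open>The image lies in the union of the collection, hence in a single member by
      \<open>subspace_Union_cover\<close>, and maximality of the dimension forces equality.\<close>
    have maps: "((*v) (A i)) ` V \<in> W" if V: "V \<in> W" and i: "i \<in> {1..2}" for V i
    proof -
      have VV: "V \<in> \<V>" "dim V = m" using V by (auto simp: W_def)
      let ?U = "((*v) (A i)) ` V"
      have lin: "linear ((*v) (A i))" by (rule matrix_vector_mul_linear)
      have sU: "subspace ?U" using sub[OF VV(1)] by (intro linear_subspace_image[OF lin]) simp
      have "?U \<subseteq> (\<lambda>v. A i *v v) ` \<Union>\<V>" using VV(1) by blast
      then have "?U \<subseteq> \<Union>\<V>" unfolding un[OF i] .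
      then obtain U where U: "U \<in> \<V>" "?U \<subseteq> U"
        using subspace_Union_cover[OF \<V>(1) sU] sub by blast
      have "dim ?U = dim V" by (rule dim_image_eq[OF lin]) (use inj[OF i] in \<open>rule inj_on_subset, simp\<close>)
      then have "dim U \<le> dim ?U" using le_m[OF U(1)] VV(2) by simp
      then have "?U = U" using sub[OF U(1)] by (intro subspace_dim_equal sU U(2)) simp
      then show ?thesis using U(1) \<open>dim ?U = dim V\<close> VV(2) by (simp add: W_def)
    qed
    have inj_W: "inj_on (\<lambda>V. ((*v) (A i)) ` V) W" if "i \<in> {1..2}" for i
      using inj[OF that] by (intro inj_onI) (simp add: inj_image_eq_iff)
    have surj_W: "\<exists>U\<in>W. V = ((*v) (A i)) ` U" if "V \<in> W" "i \<in> {1..2}" for V i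
    proof -
      have "(\<lambda>V. ((*v) (A i)) ` V) ` W = W"
        using maps[OF _ that(2)] by (intro endo_inj_surj[OF W(2) _ inj_W[OF that(2)]]) blast
      then have "V \<in> (\<lambda>V. ((*v) (A i)) ` V) ` W" using that(1) by (simp only:)
      then show ?thesis by blast
    qed
    define \<A> where "\<A> = {M :: real ^ 4 ^ 4. \<forall>V\<in>W. \<forall>v\<in>V. M *v v \<in> V}"
    have subW: "subspace V" if "V \<in> W" for V using sub that by (auto simp: W_def)
    have A_mult: "M ** M' \<in> \<A>" if "M \<in> \<A>" "M' \<in> \<A>" for M M'
      using that by (simp add: \<A>_def matrix_vector_mul_assoc[symmetric])
    have A_add: "M + M' \<in> \<A>" if "M \<in> \<A>" "M' \<in> \<A>" for M M'
      using that subW by (simp add: \<A>_def matrix_vector_mult_add_rdistrib subspace_add)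
    have A_scale: "r *\<^sub>R M \<in> \<A>" if "M \<in> \<A>" for r M
      using that subW by (simp add: \<A>_def scaleR_matrix_vector_assoc[symmetric] subspace_mul)
    have A_one: "kron (mat 1) (mat 1) \<in> \<A>" by (simp add: \<A>_def kron_one)
    \<comment> \<open>\<open>M'\<close> is the conjugate of \<open>M\<close> by \<open>A i\<close>,
      stated without an inverse; it preserves each member because \<open>A i\<close> permutes
      \<open>W\<close>.\<close>
    have conj: "M' \<in> \<A>" if M: "M \<in> \<A>" and i: "i \<in> {1..2}" and eq: "M' ** A i = A i ** M" for M M' i
      unfolding \<A>_def
    proof (intro CollectI ballI)
      fix V v assume V: "V \<in> W" and v: "v \<in> V"
      obtain U where U: "U \<in> W" "V = ((*v) (A i)) ` U" using surj_W[OF V i] by blast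
      then obtain u where u: "u \<in> U" "v = A i *v u" using v by blast
      have "M' *v v = A i *v (M *v u)" unfolding u(2) matrix_vector_mul_assoc eq ..
      moreover have "M *v u \<in> U" using M U(1) u(1) by (simp add: \<A>_def)
      ultimately show "M' *v v \<in> V" unfolding U(2) by blast
    qed
    have pow1: "((\<lambda>V. ((*v) (A 1)) ` V) ^^ n) V = ((*v) (kron (diag2 (a ^ n) (b ^ n)) (rotation2 (real n * \<theta>)))) ` V" for n V
    proof (induction n)
      case 0
      have "kron (diag2 1 1) (rotation2 0) = mat 1"
        unfolding kron_one[symmetric] by (rule arg_cong2[where f = kron]) (simp_all add: vec_eq_iff forall_2 mat_def)
      then show ?case by simp
    next
      case (Suc n)
      have "A 1 ** kron (diag2 (a ^ n) (b ^ n)) (rotation2 (real n * \<theta>)) = kron (diag2 (a ^ Suc n) (b ^ Suc n)) (rotation2 (real (Suc n) * \<theta>))"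
        unfolding A kron_mult diag2_mult rotation2_mult by (simp add: algebra_simps)
      then show ?case using Suc by (simp add: image_image matrix_vector_mul_assoc)
    qed
    have pow2: "((\<lambda>V. ((*v) (A 2)) ` V) ^^ n) V = ((*v) (kron (rotation2 (real n * \<theta>)) (diag2 (a ^ n) (b ^ n)))) ` V" for n V
    proof (induction n)
      case 0
      have "kron (rotation2 0) (diag2 1 1) = mat 1"
        unfolding kron_one[symmetric] by (rule arg_cong2[where f = kron]) (simp_all add: vec_eq_iff forall_2 mat_def)
      then show ?case by simp
    next
      case (Suc n)
      have "A 2 ** kron (rotation2 (real n * \<theta>)) (diag2 (a ^ n) (b ^ n)) = kron (rotation2 (real (Suc n) * \<theta>)) (diag2 (a ^ Suc n) (b ^ Suc n))"
        unfolding A kron_mult diag2_mult rotation2_mult by (simp add: algebra_simps)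
      then show ?case using Suc by (simp add: image_image matrix_vector_mul_assoc)
    qed
    have abn: "\<bar>a ^ n\<bar> \<noteq> \<bar>b ^ n\<bar>" if "n > 0" for n
      using ab(3) that power_eq_iff_eq_base[of n "\<bar>a\<bar>" "\<bar>b\<bar>"] by (simp add: power_abs)
    have left: "kron X (mat 1) \<in> \<A>" for X
    proof -
      have "\<exists>n>0. \<forall>V\<in>W. ((\<lambda>V. ((*v) (A 1)) ` V) ^^ n) V = V"
        by (rule finite_inj_periodic[OF W(2) _ inj_W]) (use maps in auto)
      then obtain n where n: "n > 0" "\<And>V. V \<in> W \<Longrightarrow> ((\<lambda>V. ((*v) (A 1)) ` V) ^^ n) V = V" by blast
      have "kron (diag2 (a ^ n) (b ^ n)) (rotation2 (real n * \<theta>)) \<in> \<A>"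
        unfolding \<A>_def
      proof (intro CollectI ballI)
        fix V v assume V: "V \<in> W" and v: "v \<in> V"
        have "kron (diag2 (a ^ n) (b ^ n)) (rotation2 (real n * \<theta>)) *v v \<in> ((*v) (kron (diag2 (a ^ n) (b ^ n)) (rotation2 (real n * \<theta>)))) ` V"
          using v by (rule imageI)
        then show "kron (diag2 (a ^ n) (b ^ n)) (rotation2 (real n * \<theta>)) *v v \<in> V"
          unfolding n(2)[OF V, unfolded pow1] .
      qed
      then show ?thesis
      proof (rule kronecker_algebra[where J = kron and \<A> = \<A>, OF kron_mult kron_add_left kron_add_right kron_scaleR_left
          kron_scaleR_right A_mult A_add A_scale A_one _ cs abn[OF n(1)], rotated -1])
        \<comment> \<open>Conjugation in the left factor uses the other generator, whose left factor
          is the rotation; its diagonal right factor commutes with the identity.\<close>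
        fix X X' assume X: "kron X (mat 1) \<in> \<A>" "X' ** ?R = ?R ** X"
        show "kron X' (mat 1) \<in> \<A>"
          by (rule conj[OF X(1), of 2]) (simp_all add: A kron_mult X(2))
      qed
    qed
    have right: "kron (mat 1) X \<in> \<A>" for X
    proof -
      have "\<exists>n>0. \<forall>V\<in>W. ((\<lambda>V. ((*v) (A 2)) ` V) ^^ n) V = V"
        by (rule finite_inj_periodic[OF W(2) _ inj_W]) (use maps in auto)
      then obtain n where n: "n > 0" "\<And>V. V \<in> W \<Longrightarrow> ((\<lambda>V. ((*v) (A 2)) ` V) ^^ n) V = V" by blast
      have "kron (rotation2 (real n * \<theta>)) (diag2 (a ^ n) (b ^ n)) \<in> \<A>"
        unfolding \<A>_def
      proof (intro CollectI ballI)
        fix V v assume V: "V \<in> W" and v: "v \<in> V"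
        have "kron (rotation2 (real n * \<theta>)) (diag2 (a ^ n) (b ^ n)) *v v \<in> ((*v) (kron (rotation2 (real n * \<theta>)) (diag2 (a ^ n) (b ^ n)))) ` V"
          using v by (rule imageI)
        then show "kron (rotation2 (real n * \<theta>)) (diag2 (a ^ n) (b ^ n)) *v v \<in> V"
          unfolding n(2)[OF V, unfolded pow2] .
      qed
      then show ?thesis
      proof (rule kronecker_algebra[where J = "\<lambda>X Y. kron Y X" and \<A> = \<A>, OF kron_mult kron_add_right kron_add_left kron_scaleR_right
          kron_scaleR_left A_mult A_add A_scale A_one _ cs abn[OF n(1)], rotated -1])
        fix X X' assume X: "kron (mat 1) X \<in> \<A>" "X' ** ?R = ?R ** X"
        show "kron (mat 1) X' \<in> \<A>"
          by (rule conj[OF X(1), of 1]) (simp_all only: A kron_mult X(2) set12 matrix_mul_lid matrix_mul_rid insert_iff simp_thms)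
      qed
    qed
    have all: "kron X Y \<in> \<A>" for X Y
      using A_mult[OF left[of X] right[of Y]] by (simp add: kron_mult)
    obtain V where V: "V \<in> W" using W(1) by blast
    then have "V \<in> \<V>" by (simp add: W_def)
    note sV = sub[OF this, THEN conjunct1] and V_ne = sub[OF this, THEN conjunct2]
    have "0 \<in> V" by (rule subspace_0[OF sV])
    then obtain v where v: "v \<in> V" "v \<noteq> 0" using V_ne by blast
    obtain k where k: "v $ k \<noteq> 0" using v(2) unfolding vec_eq_iff zero_index by blast
    have inj: "block_index i = block_index l \<longleftrightarrow> i = l" for i l
    proof -
      define h :: "2 \<times> 2 \<Rightarrow> 4" where
        "h = (\<lambda>p. if p = (1, 1) then 1 else if p = (1, 2) then 2 else if p = (2, 1) then 3 else 4)"
      have "h (block_index i) = i" for i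
        using exhaust_4[of i] by (elim disjE) (simp_all add: h_def block_index_def)
      then show ?thesis by metis
    qed
    have axis: "axis j (1::real) \<in> V" for j :: 4
    proof -
      \<comment> \<open>\<open>kron X Y\<close> is the matrix unit that moves coordinate
        \<open>k\<close> to coordinate \<open>j\<close>; since \<open>v $ k\<close> is nonzero, it
        sends \<open>v\<close> to a nonzero multiple of an axis vector.\<close>
      define X Y :: "real ^ 2 ^ 2"
        where "X = (\<chi> r c. if r = fst (block_index j) \<and> c = fst (block_index k) then 1 else 0)"
          and "Y = (\<chi> r c. if r = snd (block_index j) \<and> c = snd (block_index k) then 1 else 0)"
      have "X $ fst p $ fst q * Y $ snd p $ snd q = (if p = block_index j \<and> q = block_index k then 1 else 0)" for p q
        by (simp add: X_def Y_def prod_eq_iff)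
      then have entry: "kron X Y $ i $ l = (if i = j \<and> l = k then 1 else 0)" for i l
        unfolding kron_nth by (simp only: inj)
      have "kron X Y *v v = v $ k *\<^sub>R axis j 1"
        unfolding vec_eq_iff
      proof
        fix i
        have "(kron X Y *v v) $ i = (\<Sum>l\<in>UNIV. kron X Y $ i $ l * v $ l)"
          by (simp only: matrix_vector_mult_def vec_lambda_beta)
        also have "\<dots> = (\<Sum>l\<in>UNIV. if l = k then (if i = j then v $ k else 0) else 0)"
          by (rule sum.cong) (simp_all add: entry)
        also have "\<dots> = (v $ k *\<^sub>R axis j 1) $ i" by (simp add: axis_def)
        finally show "(kron X Y *v v) $ i = (v $ k *\<^sub>R axis j 1) $ i" .
      qed
      moreover have "kron X Y *v v \<in> V" using all[of X Y] V v(1) by (simp add: \<A>_def)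
      ultimately have "v $ k *\<^sub>R axis j 1 \<in> V" by (simp only:)
      then have "inverse (v $ k) *\<^sub>R (v $ k *\<^sub>R axis j 1) \<in> V" by (rule subspace_mul[OF sV])
      then show ?thesis using k by simp
    qed
    have "x \<in> V" for x
    proof -
      have "x = (\<Sum>j\<in>UNIV. x $ j *s axis j 1)" by (simp only: basis_expansion)
      also have "\<dots> \<in> V" unfolding scalar_mult_eq_scaleR
        by (rule subspace_sum[OF sV]) (rule subspace_mul[OF sV axis])
      finally show ?thesis .
    qed
    then have "V = UNIV" by blast
    then show False using V_ne by simp
  qed
  then show ?thesis unfolding strongly_irreducible_def by (intro conjI ballI inv)
qed

section \<open>Matrix cocycles\<close>

definition mprod :: "(nat \<Rightarrow> real ^ 'd ^ 'd) \<Rightarrow> nat list \<Rightarrow> real ^ 'd ^ 'd" where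
  "mprod f w = foldr (\<lambda>i M. f i ** M) w (mat 1)"

lemma mprod_Nil [simp]: "mprod f [] = mat 1" and mprod_Cons [simp]: "mprod f (i # w) = f i ** mprod f w"
  by (simp_all add: mprod_def)

lemma mprod_append: "mprod f (u @ v) = mprod f u ** mprod f v"
  by (induction u) (simp_all add: matrix_mul_assoc)

lemma word_product_eq: "word_product A x n = mprod A (init_word n x)"
  by (induction n) (simp_all add: init_word_Suc mprod_append, simp add: init_word_def)

lemma mprod_kron:
  assumes "\<And>i. i \<in> set w \<Longrightarrow> A i = kron (f i) (g i)"
  shows "mprod A w = kron (mprod f w) (mprod g w)"
  using assms by (induction w) (simp_all add: kron_one kron_mult)

lemma mprod_cong: "(\<And>i. i \<in> set w \<Longrightarrow> f i = g i) \<Longrightarrow> mprod f w = mprod g w"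
  by (induction w) simp_all

lemma mprod_map: "mprod f (map h w) = mprod (\<lambda>i. f (h i)) w"
  by (induction w) simp_all

lemma abs_det_mprod_ge:
  assumes m: "0 < m" and f: "\<And>i. i \<in> set w \<Longrightarrow> m \<le> \<bar>det (f i)\<bar>"
  shows "m ^ length w \<le> \<bar>det (mprod f w)\<bar>"
  using f by (induction w) (use m in \<open>auto simp: det_mul abs_mult intro!: mult_mono\<close>)

section \<open>Connecting words from strong irreducibility\<close>

text \<open>The span of the orbit of \<open>x\<close> is invariant under every generator, so a
  proper span would be an invariant collection with a single member.\<close>

lemma strongly_irreducible_span:
  fixes A :: "nat \<Rightarrow> real ^ 'd ^ 'd"
  assumes irr: "strongly_irreducible N A" and x: "x \<noteq> 0"
  shows "span {mprod A w *v x | w. set w \<subseteq> {1..N}} = UNIV"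
proof (rule ccontr)
  define S where "S = {mprod A w *v x | w. set w \<subseteq> {1..N}}"
  define V where "V = span S"
  assume "\<not> span {mprod A w *v x | w. set w \<subseteq> {1..N}} = UNIV"
  then have "V \<noteq> UNIV" by (simp add: V_def S_def)
  have V: "subspace V" by (simp add: V_def)
  have "mprod A [] *v x \<in> S" unfolding S_def by (intro CollectI exI[of _ "[]"]) simp
  then have "x \<in> V" unfolding V_def by (simp add: span_base)
  then have V0: "V \<noteq> {0}" using x by auto
  have im: "((*v) (A i)) ` V = V" if i: "i \<in> {1..N}" for i
  proof -
    have lin: "linear ((*v) (A i))" by (rule matrix_vector_mul_linear)
    have "((*v) (A i)) ` S \<subseteq> S"
    proof
      fix y assume "y \<in> ((*v) (A i)) ` S"
      then obtain w where w: "set w \<subseteq> {1..N}" "y = A i *v (mprod A w *v x)" unfolding S_def by blast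
      have "y = mprod A (i # w) *v x" "set (i # w) \<subseteq> {1..N}"
        using w i by (simp_all add: matrix_vector_mul_assoc)
      then show "y \<in> S" unfolding S_def by blast
    qed
    then have sub: "((*v) (A i)) ` V \<subseteq> V"
      unfolding V_def linear_span_image[OF lin, symmetric] by (rule span_mono)
    have "invertible (A i)" using irr i unfolding strongly_irreducible_def by blast
    then have "dim (((*v) (A i)) ` V) = dim V"
      by (intro dim_image_eq[OF lin] inj_on_subset[OF invertible_imp_inj_matrix]) simp_all
    then show ?thesis
      by (intro subspace_dim_equal linear_subspace_image[OF lin V] V sub) simp
  qed
  have "\<exists>\<V>. finite \<V> \<and> \<V> \<noteq> {} \<and> (\<forall>V\<in>\<V>. subspace V \<and> V \<noteq> {0} \<and> V \<noteq> UNIV) \<and>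
      (\<forall>i\<in>{1..N}. (\<lambda>v. A i *v v) ` \<Union>\<V> = \<Union>\<V>)"
    by (rule exI[of _ "{V}"]) (simp add: V V0 \<open>V \<noteq> UNIV\<close> im)
  then show False using irr unfolding strongly_irreducible_def by blast
qed

lemma scaleR_matrix_mult: "(r *\<^sub>R X) ** Y = r *\<^sub>R (X ** Y)" "X ** (r *\<^sub>R Y) = r *\<^sub>R (X ** Y)"
  for X :: "real ^ 'n ^ 'm" and Y :: "real ^ 'p ^ 'n"
  by (simp_all add: vec_eq_iff matrix_matrix_mult_def sum_distrib_left mult_ac)

text \<open>For every pair of nonzero matrices some inserted word gives a nonzero product.
  Compactness of the product of two unit spheres reduces this to finitely many words and a uniform
  lower bound, and homogeneity extends it to all pairs.\<close>

lemma strongly_irreducible_connecting: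
  fixes A :: "nat \<Rightarrow> real ^ 'd ^ 'd"
  assumes irr: "strongly_irreducible N A"
  shows "\<exists>c>0. \<exists>L. \<forall>(M :: real ^ 'd ^ 'd) (M' :: real ^ 'd ^ 'd). \<exists>w. set w \<subseteq> {1..N} \<and> length w \<le> L \<and>
    c * (norm M * norm M') \<le> norm (M ** mprod A w ** M')"
proof -
  define g where "g = (\<lambda>w (p :: (real ^ 'd ^ 'd) \<times> (real ^ 'd ^ 'd)). norm (fst p ** mprod A w ** snd p))"
  define K where "K = sphere (0 :: real ^ 'd ^ 'd) 1 \<times> sphere (0 :: real ^ 'd ^ 'd) 1"
  define C where "C = {w. set w \<subseteq> {1..N}}"
  have K: "compact K" "K \<noteq> {}" unfolding K_def by (auto intro: compact_Times compact_sphere)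
  have cont: "continuous_on UNIV (g w)" for w
    unfolding g_def matrix_matrix_mult_def
    by (intro continuous_intros)
  have pos: "\<exists>w\<in>C. 0 < g w p" if p: "p \<in> K" for p :: "(real ^ 'd ^ 'd) \<times> (real ^ 'd ^ 'd)"
  proof -
    have "fst p \<noteq> 0" "snd p \<noteq> 0" using p unfolding K_def by auto
    then obtain v where v: "snd p *v v \<noteq> 0" unfolding matrix_eq[of "snd p" 0] by auto
    have "\<exists>w\<in>C. fst p ** mprod A w ** snd p \<noteq> 0"
    proof (rule ccontr)
      assume "\<not> (\<exists>w\<in>C. fst p ** mprod A w ** snd p \<noteq> 0)"
      then have z: "fst p ** mprod A w ** snd p = 0" if "w \<in> C" for w using that by blast
      have "span {mprod A w *v (snd p *v v) | w. set w \<subseteq> {1..N}} \<subseteq> {y. fst p *v y = 0}"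
      proof (rule span_minimal)
        show "{mprod A w *v (snd p *v v) | w. set w \<subseteq> {1..N}} \<subseteq> {y. fst p *v y = 0}"
        proof
          fix y assume "y \<in> {mprod A w *v (snd p *v v) | w. set w \<subseteq> {1..N}}"
          then obtain w where w: "y = mprod A w *v (snd p *v v)" "w \<in> C" unfolding C_def by blast
          have "fst p *v y = (fst p ** mprod A w ** snd p) *v v"
            unfolding w(1) by (simp add: matrix_vector_mul_assoc matrix_mul_assoc)
          then show "y \<in> {y. fst p *v y = 0}" unfolding z[OF w(2)] by simp
        qed
        show "subspace {y. fst p *v y = 0}"
          by (auto simp: subspace_def matrix_vector_right_distrib matrix_vector_mult_scaleR)
      qed
      then have "fst p *v y = 0" for y unfolding strongly_irreducible_span[OF irr v] by blast
      then have "fst p = 0" unfolding matrix_eq[of "fst p" 0] by simp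
      then show False using \<open>fst p \<noteq> 0\<close> by simp
    qed
    then show ?thesis unfolding g_def by simp
  qed
  have op: "open {p. 0 < g w p}" for w
    by (rule open_Collect_less[OF continuous_on_const cont])
  have "K \<subseteq> (\<Union>w\<in>C. {p. 0 < g w p})" using pos by auto
  from compactE_image[OF K(1) op this] obtain D where D: "D \<subseteq> C" "finite D" "K \<subseteq> (\<Union>w\<in>D. {p. 0 < g w p})"
    by auto
  have "continuous_on K (\<lambda>p. \<Sum>w\<in>D. g w p)"
    by (intro continuous_on_sum continuous_on_subset[OF cont]) simp
  from continuous_attains_inf[OF K this] obtain p0 where p0: "p0 \<in> K" "\<And>p. p \<in> K \<Longrightarrow> (\<Sum>w\<in>D. g w p0) \<le> (\<Sum>w\<in>D. g w p)"
    by auto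
  define \<delta> where "\<delta> = (\<Sum>w\<in>D. g w p0)"
  obtain w0 where w0: "w0 \<in> D" "0 < g w0 p0" using D(3) p0(1) by auto
  have "g w0 p0 \<le> \<delta>" unfolding \<delta>_def using w0(1) D(2) by (intro member_le_sum) (simp_all add: g_def)
  then have \<delta>: "\<delta> > 0" using w0 by linarith
  have cD: "real (card D) > 0" using w0 D(2) by (auto simp: card_gt_0_iff)
  \<comment> \<open>The sum over \<open>D\<close> is at least \<open>\<delta>\<close> on the
    spheres, so some word reaches the average.\<close>
  define c where "c = \<delta> / real (card D)"
  define L where "L = (\<Sum>w\<in>D. length w)"
  have L: "length w \<le> L" if "w \<in> D" for w unfolding L_def using that D(2) by (intro member_le_sum) auto
  have c: "c > 0" unfolding c_def using \<delta> cD by simp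
  have "\<exists>w. set w \<subseteq> {1..N} \<and> length w \<le> L \<and> c * (norm M * norm M') \<le> norm (M ** mprod A w ** M')"
    for M M' :: "real ^ 'd ^ 'd"
  proof (cases "M = 0 \<or> M' = 0")
    case True
    then have "c * (norm M * norm M') \<le> norm (M ** mprod A w0 ** M')" by auto
    moreover have "set w0 \<subseteq> {1..N}" using w0(1) D(1) unfolding C_def by blast
    ultimately show ?thesis using L[OF w0(1)] by (intro exI[of _ w0]) simp
  next
    case False
    then have n: "norm M > 0" "norm M' > 0" by auto
    define p where "p = ((1 / norm M) *\<^sub>R M, (1 / norm M') *\<^sub>R M')"
    have "p \<in> K" using n unfolding p_def K_def by simp
    then have "\<delta> \<le> (\<Sum>w\<in>D. g w p)" unfolding \<delta>_def by (rule p0(2))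
    have "\<exists>w\<in>D. c \<le> g w p"
    proof (rule ccontr)
      assume "\<not> (\<exists>w\<in>D. c \<le> g w p)"
      then have lt: "g w p < c" if "w \<in> D" for w using that by (meson not_le)
      have "(\<Sum>w\<in>D. g w p) < (\<Sum>w\<in>D. c)"
        using D(2) w0(1) lt by (intro sum_strict_mono) auto
      also have "\<dots> = \<delta>" using cD by (simp add: c_def)
      finally show False using \<open>\<delta> \<le> (\<Sum>w\<in>D. g w p)\<close> by simp
    qed
    then obtain w where w: "w \<in> D" "c \<le> g w p" by blast
    have "g w p = norm (M ** mprod A w ** M') / (norm M * norm M')"
      unfolding g_def p_def by (simp add: scaleR_matrix_mult divide_simps)
    then have "c * (norm M * norm M') \<le> norm (M ** mprod A w ** M')"
      using w(2) n by (simp add: pos_le_divide_eq)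
    moreover have "set w \<subseteq> {1..N}" using w(1) D(1) unfolding C_def by blast
    ultimately show ?thesis using L[OF w(1)] by (intro exI[of _ w]) simp
  qed
  then show ?thesis using c by blast
qed

text \<open>The matrix norm is the Frobenius norm, and the squares of the entries of a Kronecker
  product factor. This lets a bound on the product be shared out between the factors.\<close>

lemma norm_kron: "norm (kron X Y) = norm X * norm Y"
proof -
  have "(norm (kron X Y))\<^sup>2 = (norm X)\<^sup>2 * (norm Y)\<^sup>2"
    unfolding power2_norm_eq_inner by (simp add: inner_vec_def sum_4 sum_2 kron_nth algebra_simps)
  then have "(norm (kron X Y))\<^sup>2 = (norm X * norm Y)\<^sup>2" by (simp only: power_mult_distrib)
  then show ?thesis by (rule power2_eq_imp_eq) simp_all
qed

lemma norm_vec_2: "(norm x)\<^sup>2 = (norm (x $ 1))\<^sup>2 + (norm (x $ 2))\<^sup>2" for x :: "('a :: real_inner) ^ 2"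
  unfolding power2_norm_eq_inner by (simp add: inner_vec_def sum_2)

lemma opnorm_le_norm: "opnorm X \<le> norm X" for X :: "real ^ 2 ^ 2"
  unfolding opnorm_def
proof (rule onorm_le)
  fix x
  have cs: "(norm (X $ i \<bullet> x))\<^sup>2 \<le> (norm (X $ i))\<^sup>2 * (norm x)\<^sup>2" for i
    using Cauchy_Schwarz_ineq[of "X $ i" x] by (simp add: power2_norm_eq_inner[symmetric])
  have "(norm (X *v x))\<^sup>2 = (norm (X $ 1 \<bullet> x))\<^sup>2 + (norm (X $ 2 \<bullet> x))\<^sup>2"
    unfolding norm_vec_2[of "X *v x"] matrix_vector_mul_component ..
  also have "\<dots> \<le> (norm (X $ 1))\<^sup>2 * (norm x)\<^sup>2 + (norm (X $ 2))\<^sup>2 * (norm x)\<^sup>2" by (intro add_mono cs)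
  also have "\<dots> = (norm X * norm x)\<^sup>2" unfolding norm_vec_2[of X] power_mult_distrib by (simp only: distrib_right)
  finally show "norm (X *v x) \<le> norm X * norm x" by (rule power2_le_imp_le) simp
qed

lemma component_le_opnorm: "\<bar>X $ i $ j\<bar> \<le> opnorm X" for X :: "real ^ 2 ^ 2"
proof -
  have "X $ i $ j = (X *v axis j 1) $ i"
    by (simp add: matrix_vector_mult_def axis_def if_distrib cong: if_cong)
  then have "\<bar>X $ i $ j\<bar> \<le> norm (X *v axis j 1)" by (simp add: component_le_norm_cart)
  also have "\<dots> \<le> opnorm X" using norm_matrix_vector_le[of X "axis j 1"] by (simp add: norm_axis_1)
  finally show ?thesis .
qed

text \<open>The factor 2 is the square root of the number of entries, each of which is at most the
  operator norm.\<close>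

lemma norm_le_opnorm: "norm X \<le> 2 * opnorm X" for X :: "real ^ 2 ^ 2"
proof -
  have "(norm (X $ i $ j))\<^sup>2 \<le> (opnorm X)\<^sup>2" for i j
  proof (rule power_mono)
    show "norm (X $ i $ j) \<le> opnorm X" using component_le_opnorm by (simp only: real_norm_def)
  qed simp
  then have "(norm X)\<^sup>2 \<le> (opnorm X)\<^sup>2 + (opnorm X)\<^sup>2 + ((opnorm X)\<^sup>2 + (opnorm X)\<^sup>2)"
    unfolding norm_vec_2[of X] norm_vec_2[of "X $ i" for i] by (intro add_mono)
  also have "\<dots> = (2 * opnorm X)\<^sup>2" by (simp add: power_mult_distrib)
  finally have *: "(norm X)\<^sup>2 \<le> (2 * opnorm X)\<^sup>2" .
  have "0 \<le> opnorm X" unfolding opnorm_def by (rule onorm_pos_le) (rule matrix_vector_mul_bounded_linear)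
  then show ?thesis using * by (intro power2_le_imp_le[OF *]) simp
qed

text \<open>The same \<open>k\<close> has to serve both cocycles, because each potential involves
  the norms of both factors.\<close>

definition connecting :: "nat \<Rightarrow> (nat \<Rightarrow> real ^ 2 ^ 2) \<Rightarrow> (nat \<Rightarrow> real ^ 2 ^ 2) \<Rightarrow> bool" where
  "connecting N f g \<longleftrightarrow> (\<exists>c>0. \<exists>L. \<forall>m n. \<forall>u\<in>words N m. \<forall>v\<in>words N n. \<exists>l\<le>L. \<exists>k\<in>words N l.
     c * opnorm (mprod f u) * opnorm (mprod f v) \<le> opnorm (mprod f (u @ k @ v)) \<and>
     c * opnorm (mprod g u) * opnorm (mprod g v) \<le> opnorm (mprod g (u @ k @ v)))"

lemma connecting_sym: "connecting N f g \<Longrightarrow> connecting N g f"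
  unfolding connecting_def by (simp only: conj_commute)

context
  fixes N :: nat and f g :: "nat \<Rightarrow> real ^ 2 ^ 2"
  assumes N: "0 < N" and f: "\<And>i. i \<in> {1..N} \<Longrightarrow> det (f i) \<noteq> 0" and g: "\<And>i. i \<in> {1..N} \<Longrightarrow> det (g i) \<noteq> 0"
begin

lemma ex_det_bound: "\<exists>m>0. m \<le> 1 \<and> (\<forall>i\<in>{1..N}. m \<le> \<bar>det (f i)\<bar> \<and> m \<le> \<bar>det (g i)\<bar>)"
proof -
  \<comment> \<open>Including 1 makes the bound at most 1, so that its powers decrease.\<close>
  define S where "S = insert 1 ((\<lambda>i. \<bar>det (f i)\<bar>) ` {1..N} \<union> (\<lambda>i. \<bar>det (g i)\<bar>) ` {1..N})"
  have S: "finite S" "S \<noteq> {}" by (simp_all add: S_def)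
  have "0 < x" if "x \<in> S" for x
    using that unfolding S_def by (elim insertE UnE imageE) (simp_all add: f g)
  then have "0 < Min S" using Min_in[OF S] by simp
  moreover have "Min S \<le> 1" by (rule Min_le[OF S(1)]) (simp add: S_def)
  moreover have "Min S \<le> \<bar>det (f i)\<bar> \<and> Min S \<le> \<bar>det (g i)\<bar>" if "i \<in> {1..N}" for i
  proof -
    have "\<bar>det (f i)\<bar> \<in> S" "\<bar>det (g i)\<bar> \<in> S"
      using imageI[OF that, of "\<lambda>i. \<bar>det (f i)\<bar>"] imageI[OF that, of "\<lambda>i. \<bar>det (g i)\<bar>"]
      by (simp_all only: S_def insert_iff Un_iff simp_thms)
    then show ?thesis by (intro conjI Min_le[OF S(1)])
  qed
  ultimately show ?thesis by blast
qed

lemma det_mprod_nonzero: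
  assumes "w \<in> words N n"
  shows "det (mprod f w) \<noteq> 0" "det (mprod g w) \<noteq> 0"
proof -
  obtain m where m: "0 < m" "\<forall>i\<in>{1..N}. m \<le> \<bar>det (f i)\<bar> \<and> m \<le> \<bar>det (g i)\<bar>" using ex_det_bound by blast
  have w: "set w \<subseteq> {1..N}" using assms by (simp add: words_def)
  have "m ^ length w \<le> \<bar>det (mprod f w)\<bar>" "m ^ length w \<le> \<bar>det (mprod g w)\<bar>"
    using m w by (auto intro!: abs_det_mprod_ge)
  moreover have "0 < m ^ length w" using m(1) by simp
  ultimately show "det (mprod f w) \<noteq> 0" "det (mprod g w) \<noteq> 0" by auto
qed

lemma opnorm_mprod_pos:
  assumes "w \<in> words N n"
  shows "0 < opnorm (mprod f w)" "0 < opnorm (mprod g w)"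
  using det_mprod_nonzero[OF assms] by (simp_all add: opnorm_pos det_nonzero_imp_nonzero)

text \<open>The inserted word makes the product of the two norms comparable to its largest possible
  size. Submultiplicativity bounds each norm from above, so neither can be small without the other
  exceeding its bound.\<close>

lemma strongly_irreducible_imp_connecting:
  assumes irr: "strongly_irreducible N A" and A: "\<And>i. i \<in> {1..N} \<Longrightarrow> A i = kron (f i) (g i)"
  shows "connecting N f g"
proof -
  obtain c L where c: "c > 0" and conn: "\<And>(M :: real ^ 4 ^ 4) (M' :: real ^ 4 ^ 4). \<exists>w. set w \<subseteq> {1..N} \<and> length w \<le> L \<and>
    c * (norm M * norm M') \<le> norm (M ** mprod A w ** M')"
    using strongly_irreducible_connecting[OF irr] by blast
  define Q where "Q = (\<Sum>l\<le>L. \<Sum>k\<in>words N l. opnorm (mprod f k) + opnorm (mprod g k))"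
  have nn: "0 \<le> opnorm (mprod f k) + opnorm (mprod g k)" if "k \<in> words N l" for k l
    using opnorm_mprod_pos[OF that] by linarith
  have Q: "opnorm (mprod f k) \<le> Q" "opnorm (mprod g k) \<le> Q" if k: "k \<in> words N l" and l: "l \<le> L" for k l
  proof -
    have "opnorm (mprod f k) + opnorm (mprod g k) \<le> (\<Sum>k\<in>words N l. opnorm (mprod f k) + opnorm (mprod g k))"
      using k nn by (intro member_le_sum) auto
    also have "\<dots> \<le> Q" unfolding Q_def
      using l nn by (intro member_le_sum[of l "{..L}" "\<lambda>l. \<Sum>k\<in>words N l. opnorm (mprod f k) + opnorm (mprod g k)"]) (auto intro!: sum_nonneg)
    finally show "opnorm (mprod f k) \<le> Q" "opnorm (mprod g k) \<le> Q" using opnorm_mprod_pos[OF k] by linarith+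
  qed
  have "0 < Q" using Q(1)[of "[]" 0] opnorm_mprod_pos(1)[of "[]" 0] by simp
  \<comment> \<open>The 4 comes from comparing Frobenius and operator norms of two factors, the
    \<open>Q\<close> from the upper bound of the opposite factor on connecting words.\<close>
  define c' where "c' = c / (4 * Q)"
  have c': "c' > 0" using c \<open>0 < Q\<close> by (simp add: c'_def)
  have "\<exists>l\<le>L. \<exists>k\<in>words N l.
     c' * opnorm (mprod f u) * opnorm (mprod f v) \<le> opnorm (mprod f (u @ k @ v)) \<and>
     c' * opnorm (mprod g u) * opnorm (mprod g v) \<le> opnorm (mprod g (u @ k @ v))"
    if u: "u \<in> words N m" and v: "v \<in> words N n" for u v m n
  proof -
    obtain k where k: "set k \<subseteq> {1..N}" "length k \<le> L"
      "c * (norm (mprod A u) * norm (mprod A v)) \<le> norm (mprod A u ** mprod A k ** mprod A v)"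
      using conn[of "mprod A u" "mprod A v"] by blast
    define l where "l = length k"
    have kw: "k \<in> words N l" using k(1) by (simp add: words_def l_def)
    have l: "l \<le> L" using k(2) by (simp add: l_def)
    have ukv: "u @ k @ v \<in> words N (m + (l + n))" by (intro append_in_words u kw v)
    have Akron: "mprod A w = kron (mprod f w) (mprod g w)" if "w \<in> words N j" for w j
      using that by (intro mprod_kron A) (auto simp: words_def)
    have step: "mprod A u ** mprod A k ** mprod A v = mprod A (u @ k @ v)"
      by (simp add: mprod_append matrix_mul_assoc)
    let ?F = "\<lambda>w. opnorm (mprod f w)" and ?G = "\<lambda>w. opnorm (mprod g w)"
    have pos: "0 < ?F u" "0 < ?F v" "0 < ?G u" "0 < ?G v" "0 < ?F (u @ k @ v)" "0 < ?G (u @ k @ v)" "0 < ?F k" "0 < ?G k"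
      using opnorm_mprod_pos[OF u] opnorm_mprod_pos[OF v] opnorm_mprod_pos[OF ukv] opnorm_mprod_pos[OF kw] by auto
    have "c * ((?F u * ?G u) * (?F v * ?G v)) \<le> c * (norm (mprod A u) * norm (mprod A v))"
      unfolding Akron[OF u] Akron[OF v] norm_kron
      using c pos by (intro mult_left_mono mult_mono opnorm_le_norm) auto
    also have "\<dots> \<le> norm (mprod f (u @ k @ v)) * norm (mprod g (u @ k @ v))"
      using k(3) unfolding step Akron[OF ukv] norm_kron .
    also have "\<dots> \<le> (2 * ?F (u @ k @ v)) * (2 * ?G (u @ k @ v))"
      using pos by (intro mult_mono norm_le_opnorm) auto
    finally have main: "c * ((?F u * ?G u) * (?F v * ?G v)) \<le> 4 * (?F (u @ k @ v) * ?G (u @ k @ v))" by simp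
    have three: "opnorm (mprod h (u @ k @ v)) \<le> opnorm (mprod h u) * (opnorm (mprod h k) * opnorm (mprod h v))"
      if "0 < opnorm (mprod h u)" for h
    proof -
      have "opnorm (mprod h (u @ k @ v)) \<le> opnorm (mprod h u) * opnorm (mprod h (k @ v))"
        unfolding mprod_append[of h u] by (rule opnorm_mult)
      also have "\<dots> \<le> opnorm (mprod h u) * (opnorm (mprod h k) * opnorm (mprod h v))"
        unfolding mprod_append[of h k] using that by (intro mult_left_mono opnorm_mult) simp
      finally show ?thesis .
    qed
    have G: "?G (u @ k @ v) \<le> ?G u * (Q * ?G v)"
      using three[OF pos(3)] pos Q(2)[OF kw l] by (elim order_trans) (intro mult_left_mono mult_right_mono; simp)
    have F: "?F (u @ k @ v) \<le> ?F u * (Q * ?F v)"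
      using three[OF pos(1)] pos Q(1)[OF kw l] by (elim order_trans) (intro mult_left_mono mult_right_mono; simp)
    have "c * ((?F u * ?G u) * (?F v * ?G v)) \<le> 4 * (?F (u @ k @ v) * (?G u * (Q * ?G v)))"
      using main mult_left_mono[OF G, of "?F (u @ k @ v)"] pos by linarith
    then have "(?G u * ?G v) * (c * ?F u * ?F v) \<le> (?G u * ?G v) * (4 * Q * ?F (u @ k @ v))" by (simp add: mult_ac)
    then have 1: "c * ?F u * ?F v \<le> 4 * Q * ?F (u @ k @ v)" using pos by (subst (asm) mult_le_cancel_left_pos) auto
    have "c * ((?F u * ?G u) * (?F v * ?G v)) \<le> 4 * ((?F u * (Q * ?F v)) * ?G (u @ k @ v))"
      using main mult_right_mono[OF F, of "?G (u @ k @ v)"] pos by linarith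
    then have "(?F u * ?F v) * (c * ?G u * ?G v) \<le> (?F u * ?F v) * (4 * Q * ?G (u @ k @ v))" by (simp add: mult_ac)
    then have 2: "c * ?G u * ?G v \<le> 4 * Q * ?G (u @ k @ v)" using pos by (subst (asm) mult_le_cancel_left_pos) auto
    have "c' * ?F u * ?F v \<le> ?F (u @ k @ v)" "c' * ?G u * ?G v \<le> ?G (u @ k @ v)"
      using 1 2 \<open>0 < Q\<close> by (simp_all add: c'_def field_simps)
    then show ?thesis using l kw by blast
  qed
  then show ?thesis unfolding connecting_def using c' by blast
qed

section \<open>Quasi-multiplicativity of the factor potentials\<close>

text \<open>\<open>factor_potential\<close> as a function of norms and determinants alone:
  multiplicative in these four numbers and, for \<open>1 < s < 3\<close>, nondecreasing in
  each.\<close>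

definition pot :: "real \<Rightarrow> real \<Rightarrow> real \<Rightarrow> real \<Rightarrow> real \<Rightarrow> real" where
  "pot s x y u v = x powr (2 - \<bar>s - 2\<bar>) * y powr \<bar>s - 2\<bar> * u powr max 0 (s - 2) * v powr min 1 (s - 1)"

lemma factor_potential_eq: "factor_potential s X Y = pot s (opnorm X) (opnorm Y) \<bar>det X\<bar> \<bar>det Y\<bar>"
  by (simp add: factor_potential_def pot_def)

lemma pot_mult:
  assumes "0 \<le> x" "0 \<le> y" "0 \<le> u" "0 \<le> v" "0 \<le> x'" "0 \<le> y'" "0 \<le> u'" "0 \<le> v'"
  shows "pot s (x * x') (y * y') (u * u') (v * v') = pot s x y u v * pot s x' y' u' v'"
  unfolding pot_def using assms by (simp add: powr_mult mult_ac)

lemma pot_mono: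
  assumes "1 < s" "s < 3" "0 \<le> x" "x \<le> x'" "0 \<le> y" "y \<le> y'" "0 \<le> u" "u \<le> u'" "0 \<le> v" "v \<le> v'"
  shows "pot s x y u v \<le> pot s x' y' u' v'"
  unfolding pot_def using assms by (intro mult_mono powr_mono2 mult_nonneg_nonneg) auto

text \<open>Determinants are multiplicative, operator norms are submultiplicative and connected by a
  common word, and all exponents are nonnegative, so these relations pass to the potential.\<close>

lemma quasi_multiplicative_factor_potential:
  assumes conn: "connecting N f g" and s: "1 < s" "s < 3"
  shows "quasi_multiplicative N (\<lambda>w. factor_potential s (mprod f w) (mprod g w))"
proof -
  define F G where "F = (\<lambda>w. opnorm (mprod f w))" and "G = (\<lambda>w. opnorm (mprod g w))"
  define d e where "d = (\<lambda>w. \<bar>det (mprod f w)\<bar>)" and "e = (\<lambda>w. \<bar>det (mprod g w)\<bar>)"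
  have pot: "factor_potential s (mprod f w) (mprod g w) = pot s (F w) (G w) (d w) (e w)" for w
    by (simp add: factor_potential_eq F_def G_def d_def e_def)
  have pos: "0 < F w" "0 < G w" "0 < d w" "0 < e w" if "w \<in> words N n" for w n
    using opnorm_mprod_pos[OF that] det_mprod_nonzero[OF that] by (auto simp: F_def G_def d_def e_def)
  have de: "d (u @ v) = d u * d v" "e (u @ v) = e u * e v" for u v
    by (simp_all add: d_def e_def mprod_append det_mul abs_mult)
  have FG: "F (u @ v) \<le> F u * F v" "G (u @ v) \<le> G u * G v" for u v
    unfolding F_def G_def mprod_append by (rule opnorm_mult)+
  obtain m where m: "0 < m" "m \<le> 1" "\<forall>i\<in>{1..N}. m \<le> \<bar>det (f i)\<bar> \<and> m \<le> \<bar>det (g i)\<bar>"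
    using ex_det_bound by blast
  have de_ge: "m ^ n \<le> d w" "m ^ n \<le> e w" if "w \<in> words N n" for w n
  proof -
    have w: "set w \<subseteq> {1..N}" "length w = n" using that by (simp_all add: words_def)
    show "m ^ n \<le> d w" "m ^ n \<le> e w" unfolding d_def e_def w(2)[symmetric]
      by (rule abs_det_mprod_ge[OF m(1)], use m(3) w(1) in blast)+
  qed
  \<comment> \<open>The absolute determinant is at most the square of the operator norm, hence at
    most the norm itself when that is below 1; otherwise \<open>m ^ n \<le> 1\<close>
    suffices.\<close>
  have norm_ge: "m ^ n \<le> opnorm X" if "m ^ n \<le> \<bar>det X\<bar>" "0 < opnorm X" "det X \<noteq> 0" for X :: "real ^ 2 ^ 2" and n
  proof (cases "opnorm X \<le> 1")
    case True
    have "\<bar>det X\<bar> / opnorm X \<le> opnorm X" by (rule singular_decomposition_2[OF that(3)])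
    then have "\<bar>det X\<bar> \<le> opnorm X * opnorm X" using that(2) by (simp add: pos_divide_le_eq)
    also have "\<dots> \<le> opnorm X * 1" using True that(2) by (intro mult_left_mono) auto
    finally show ?thesis using that(1) by simp
  next
    case False
    have "m ^ n \<le> 1" using m by (intro power_le_one) auto
    then show ?thesis using False by simp
  qed
  show ?thesis unfolding pot
  proof
    fix w n assume w: "w \<in> words N n"
    show "0 < pot s (F w) (G w) (d w) (e w)" unfolding pot_def using pos[OF w] by simp
  next
    fix u v m n assume u: "u \<in> words N m" and v: "v \<in> words N n"
    note pu = pos[OF u] and pv = pos[OF v] and puv = pos[OF append_in_words[OF u v]]
    have "pot s (F (u @ v)) (G (u @ v)) (d (u @ v)) (e (u @ v)) \<le> pot s (F u * F v) (G u * G v) (d u * d v) (e u * e v)"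
      using FG[of u v] puv unfolding de[of u v] by (intro pot_mono s) auto
    also have "\<dots> = pot s (F u) (G u) (d u) (e u) * pot s (F v) (G v) (d v) (e v)"
      using pu pv by (intro pot_mult) auto
    finally show "pot s (F (u @ v)) (G (u @ v)) (d (u @ v)) (e (u @ v)) \<le>
      pot s (F u) (G u) (d u) (e u) * pot s (F v) (G v) (d v) (e v)" .
  next
    \<comment> \<open>The sum of the four exponents, of which those of the norms add up to
      2.\<close>
    define t where "t = 2 + max 0 (s - 2) + min 1 (s - 1)"
    have "exp (- (- (t * ln m)) * real n) \<le> pot s (F w) (G w) (d w) (e w)" if w: "w \<in> words N n" for w n
    proof -
      have "m ^ n \<le> F w" "m ^ n \<le> G w"
        unfolding F_def G_def
        using de_ge[OF w] opnorm_mprod_pos[OF w] det_mprod_nonzero[OF w] unfolding d_def e_def by (auto intro: norm_ge)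
      then have "pot s (m ^ n) (m ^ n) (m ^ n) (m ^ n) \<le> pot s (F w) (G w) (d w) (e w)"
        using m(1) de_ge[OF w] by (intro pot_mono s) auto
      also have "pot s (m ^ n) (m ^ n) (m ^ n) (m ^ n) = (m ^ n) powr t"
        unfolding pot_def powr_add[symmetric] t_def by simp
      also have "\<dots> = exp (t * (real n * ln m))" using m(1) by (simp add: powr_def ln_realpow)
      finally show ?thesis by (simp add: mult_ac)
    qed
    then show "\<exists>K. \<forall>n. \<forall>w\<in>words N n. exp (- K * real n) \<le> pot s (F w) (G w) (d w) (e w)" by blast
  next
    show "0 < N" by (rule N)
  next
    obtain c L where c: "c > 0" and conn': "\<And>m n u v. u \<in> words N m \<Longrightarrow> v \<in> words N n \<Longrightarrow> \<exists>l\<le>L. \<exists>k\<in>words N l.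
       c * F u * F v \<le> F (u @ k @ v) \<and> c * G u * G v \<le> G (u @ k @ v)"
      using conn unfolding connecting_def F_def G_def by blast
    \<comment> \<open>Norms lose the factor \<open>c\<close>; determinants only pick up that of the
      connecting word, which is at least \<open>m ^ L\<close>.\<close>
    define C where "C = pot s c c (m ^ L) (m ^ L)"
    have C_pos: "C > 0" unfolding C_def pot_def using c m(1) by simp
    have connected: "\<exists>l\<le>L. \<exists>k\<in>words N l. C * pot s (F u) (G u) (d u) (e u) * pot s (F v) (G v) (d v) (e v)
        \<le> pot s (F (u @ k @ v)) (G (u @ k @ v)) (d (u @ k @ v)) (e (u @ k @ v))"
      if u: "u \<in> words N i" and v: "v \<in> words N j" for u v i j
    proof -
      obtain l k where l: "l \<le> L" and k: "k \<in> words N l" and FF: "c * F u * F v \<le> F (u @ k @ v)"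
        and GG: "c * G u * G v \<le> G (u @ k @ v)" using conn'[OF u v] by blast
      note pu = pos[OF u] and pv = pos[OF v]
      have "m ^ L \<le> m ^ l" using m l by (intro power_decreasing) auto
      then have dk: "m ^ L \<le> d k" "m ^ L \<le> e k" using de_ge[OF k] by linarith+
      have mL: "0 < m ^ L" using m(1) by simp
      have D: "m ^ L * d u * d v \<le> d (u @ k @ v)" "m ^ L * e u * e v \<le> e (u @ k @ v)"
        unfolding de using mult_right_mono[OF dk(1), of "d u * d v"] mult_right_mono[OF dk(2), of "e u * e v"] pu pv
        by (simp_all add: mult_ac)
      have "pot s (c * F u) (c * G u) (m ^ L * d u) (m ^ L * e u) = C * pot s (F u) (G u) (d u) (e u)"
        unfolding C_def by (rule pot_mult; intro mult_nonneg_nonneg less_imp_le c mL pu pv)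
      moreover have "pot s (c * F u * F v) (c * G u * G v) (m ^ L * d u * d v) (m ^ L * e u * e v)
        = pot s (c * F u) (c * G u) (m ^ L * d u) (m ^ L * e u) * pot s (F v) (G v) (d v) (e v)"
        by (rule pot_mult; intro mult_nonneg_nonneg less_imp_le c mL pu pv)
      ultimately have "C * pot s (F u) (G u) (d u) (e u) * pot s (F v) (G v) (d v) (e v)
        = pot s (c * F u * F v) (c * G u * G v) (m ^ L * d u * d v) (m ^ L * e u * e v)" by (simp only:)
      also have "\<dots> \<le> pot s (F (u @ k @ v)) (G (u @ k @ v)) (d (u @ k @ v)) (e (u @ k @ v))"
        by (rule pot_mono[OF s]; intro mult_nonneg_nonneg less_imp_le c mL pu pv FF GG D)
      finally show ?thesis using l k by blast
    qed
    show "\<exists>c>0. \<exists>L. \<forall>m n. \<forall>u\<in>words N m. \<forall>v\<in>words N n. \<exists>l\<le>L. \<exists>k\<in>words N l.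
        c * pot s (F u) (G u) (d u) (e u) * pot s (F v) (G v) (d v) (e v) \<le> pot s (F (u @ k @ v)) (G (u @ k @ v)) (d (u @ k @ v)) (e (u @ k @ v))"
      by (rule exI[of _ C], rule conjI[OF C_pos], rule exI[of _ L], intro allI ballI, rule connected)
  qed
qed

end

lemma factor_potential_pos: "det B \<noteq> 0 \<Longrightarrow> det C \<noteq> 0 \<Longrightarrow> 0 < factor_potential s B C"
  using opnorm_pos[OF det_nonzero_imp_nonzero[of B]] opnorm_pos[OF det_nonzero_imp_nonzero[of C]]
  unfolding factor_potential_def by (intro mult_pos_pos) simp_all

text \<open>In the abbreviations of the proof, the quotient of the two potentials is
  \<open>(x\<^sup>2 * v) / (y\<^sup>2 * u)\<close> to the power
  \<open>\<tau> = 1 - \<bar>s - 2\<bar>\<close>; \<open>eq\<close> is this identity with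
  denominators cleared.\<close>

lemma factor_potential_dominates:
  assumes s: "1 < s" "s < 3" and B: "det B \<noteq> 0" and C: "det C \<noteq> 0" and k: "0 \<le> k"
    and le: "k * ((opnorm C)\<^sup>2 * \<bar>det B\<bar>) \<le> (opnorm B)\<^sup>2 * \<bar>det C\<bar>"
  shows "k powr (1 - \<bar>s - 2\<bar>) * factor_potential s C B \<le> factor_potential s B C"
proof -
  define \<tau> p q where "\<tau> = 1 - \<bar>s - 2\<bar>" and "p = max 0 (s - 2)" and "q = min 1 (s - 1)"
  define x y u v where "x = opnorm B" and "y = opnorm C" and "u = \<bar>det B\<bar>" and "v = \<bar>det C\<bar>"
  have pos: "0 < x" "0 < y" "0 < u" "0 < v"
    using B C by (simp_all add: x_def y_def u_def v_def opnorm_pos det_nonzero_imp_nonzero)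
  have \<tau>: "0 < \<tau>" using s by (simp add: \<tau>_def abs_if)
  have e: "2 - \<bar>s - 2\<bar> = \<bar>s - 2\<bar> + (\<tau> + \<tau>)" by (simp add: \<tau>_def)
  have q: "q = p + \<tau>" using s by (simp add: \<tau>_def p_def q_def max_def min_def abs_if)
  have "factor_potential s B C = x powr (2 - \<bar>s - 2\<bar>) * y powr \<bar>s - 2\<bar> * u powr p * v powr q"
    by (simp only: factor_potential_def x_def y_def u_def v_def p_def q_def)
  then have F: "factor_potential s B C = x powr \<bar>s - 2\<bar> * (x powr \<tau> * x powr \<tau>) * y powr \<bar>s - 2\<bar> * u powr p * (v powr p * v powr \<tau>)"
    by (simp only: e q powr_add)
  have "factor_potential s C B = y powr (2 - \<bar>s - 2\<bar>) * x powr \<bar>s - 2\<bar> * v powr p * u powr q"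
    by (simp only: factor_potential_def x_def y_def u_def v_def p_def q_def)
  then have G: "factor_potential s C B = y powr \<bar>s - 2\<bar> * (y powr \<tau> * y powr \<tau>) * x powr \<bar>s - 2\<bar> * v powr p * (u powr p * u powr \<tau>)"
    by (simp only: e q powr_add)
  define Y where "Y = (y\<^sup>2 * u) powr \<tau>"
  have Y_eq: "Y = y powr \<tau> * y powr \<tau> * u powr \<tau>"
    unfolding Y_def power2_eq_square using pos by (simp add: powr_mult)
  have X_eq: "(x\<^sup>2 * v) powr \<tau> = x powr \<tau> * x powr \<tau> * v powr \<tau>"
    unfolding power2_eq_square using pos by (simp add: powr_mult)
  have eq: "factor_potential s B C * Y = factor_potential s C B * (x\<^sup>2 * v) powr \<tau>"
    unfolding F G X_eq Y_eq by (simp only: mult_ac)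
  have "k powr \<tau> * Y = (k * (y\<^sup>2 * u)) powr \<tau>"
    unfolding Y_def using k pos by (simp add: powr_mult)
  also have "\<dots> \<le> (x\<^sup>2 * v) powr \<tau>"
  proof (rule powr_mono2)
    show "k * (y\<^sup>2 * u) \<le> x\<^sup>2 * v" using le by (simp only: x_def y_def u_def v_def)
  qed (use \<tau> k pos in simp_all)
  finally have le2: "k powr \<tau> * Y \<le> (x\<^sup>2 * v) powr \<tau>" .
  have G_pos: "0 < factor_potential s C B" using factor_potential_pos[OF C B] .
  have "(k powr \<tau> * factor_potential s C B) * Y = factor_potential s C B * (k powr \<tau> * Y)"
    by (metis mult.assoc mult.commute)
  also have "\<dots> \<le> factor_potential s C B * (x\<^sup>2 * v) powr \<tau>"
    by (rule mult_left_mono[OF le2 less_imp_le[OF G_pos]])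
  also have "\<dots> = factor_potential s B C * Y" by (rule eq[symmetric])
  finally have *: "(k powr \<tau> * factor_potential s C B) * Y \<le> factor_potential s B C * Y" .
  have "0 < Y" unfolding Y_def by (rule iffD2[OF powr_gt_zero]) (use pos in simp)
  with * have "k powr \<tau> * factor_potential s C B \<le> factor_potential s B C" by (rule mult_right_le_imp_le)
  then show ?thesis unfolding \<tau>_def .
qed

text \<open>The Frobenius norm of a rotation is the square root of 2. A bound uniform in
  \<open>t\<close> is what the comparison of the potentials along powers uses.\<close>

lemma opnorm_rotation2: "opnorm (rotation2 t) \<le> 2"
proof -
  have "(norm (rotation2 t))\<^sup>2 = (norm (rotation2 t $ 1))\<^sup>2 + (norm (rotation2 t $ 2))\<^sup>2"
    by (rule norm_vec_2)
  also have "(norm (rotation2 t $ 1))\<^sup>2 = 1"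
    using sin_cos_squared_add2[of t] by (simp add: norm_vec_2[of "rotation2 t $ 1"])
  also have "(norm (rotation2 t $ 2))\<^sup>2 = 1"
    using sin_cos_squared_add[of t] by (simp add: norm_vec_2[of "rotation2 t $ 2"])
  finally have sq: "(norm (rotation2 t))\<^sup>2 = 2" by simp
  have "norm (rotation2 t) \<le> 2" by (rule power2_le_imp_le) (simp_all add: sq)
  then show ?thesis using opnorm_le_norm[of "rotation2 t"] by linarith
qed

lemma det_rotation2: "det (rotation2 t) = 1"
  using sin_cos_squared_add3[of t] by (simp add: det_2)

lemma det_diag2: "det (diag2 a b) = a * b"
  by (simp add: det_2)

lemma mprod_replicate_diag2: "f i = diag2 a b \<Longrightarrow> mprod f (replicate n i) = diag2 (a ^ n) (b ^ n)"
  by (induction n) (simp_all add: diag2_mult, simp add: vec_eq_iff forall_2 mat_def)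

lemma mprod_replicate_rotation2: "f i = rotation2 t \<Longrightarrow> mprod f (replicate n i) = rotation2 (real n * t)"
  by (induction n) (simp_all add: rotation2_mult algebra_simps, simp add: vec_eq_iff forall_2 mat_def)

text \<open>Along the letter \<open>i\<close> repeated \<open>n\<close> times, the diagonal factor
  has norm at least \<open>M ^ n\<close> and absolute determinant \<open>(M * m) ^ n\<close>, while
  the rotation factor stays bounded with determinant 1. The quotient that controls the potentials is
  therefore at least \<open>(M / m) ^ n / 4\<close>.\<close>

lemma factor_potential_unbounded:
  assumes ab: "a \<noteq> 0" "b \<noteq> 0" "\<bar>a\<bar> \<noteq> \<bar>b\<bar>" and s: "1 < s" "s < 3"
    and i: "i \<in> {1..N}" and f: "f i = diag2 a b" and g: "g i = rotation2 \<theta>"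
  shows "\<exists>n. \<exists>w\<in>words N n. C * factor_potential s (mprod g w) (mprod f w) < factor_potential s (mprod f w) (mprod g w)"
proof -
  define M m where "M = max \<bar>a\<bar> \<bar>b\<bar>" and "m = min \<bar>a\<bar> \<bar>b\<bar>"
  have Mm: "0 < m" "m < M" using ab by (auto simp: M_def m_def)
  have abs_ab: "\<bar>a * b\<bar> = M * m" by (simp add: M_def m_def max_def min_def abs_mult)
  define \<tau> where "\<tau> = 1 - \<bar>s - 2\<bar>"
  have \<tau>: "0 < \<tau>" using s by (simp add: \<tau>_def abs_if)
  have "1 < M / m" using Mm by simp
  \<comment> \<open>The threshold is the value of \<open>(M / m) ^ n\<close> at which
    \<open>k powr \<tau> = \<bar>C\<bar> + 1\<close>, for
    \<open>k = (M / m) ^ n / 4\<close>.\<close>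
  from real_arch_pow[OF this, of "4 * (\<bar>C\<bar> + 1) powr (1 / \<tau>)"]
  obtain n where n: "4 * (\<bar>C\<bar> + 1) powr (1 / \<tau>) < (M / m) ^ n" by blast
  define w where "w = replicate n i"
  have w: "w \<in> words N n" using i by (auto simp: w_def words_def)
  have mf: "mprod f w = diag2 (a ^ n) (b ^ n)" unfolding w_def by (rule mprod_replicate_diag2[of f, OF f])
  have mg: "mprod g w = rotation2 (real n * \<theta>)" unfolding w_def by (rule mprod_replicate_rotation2[of g, OF g])
  have detf: "\<bar>det (mprod f w)\<bar> = (M * m) ^ n"
    unfolding mf det_diag2 power_mult_distrib[symmetric] power_abs abs_ab ..
  have detg: "\<bar>det (mprod g w)\<bar> = 1" unfolding mg det_rotation2 by simp
  have nz: "det (mprod f w) \<noteq> 0" "det (mprod g w) \<noteq> 0"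
    unfolding mf mg det_diag2 det_rotation2 using ab by simp_all
  have "\<bar>a ^ n\<bar> \<le> opnorm (mprod f w)" "\<bar>b ^ n\<bar> \<le> opnorm (mprod f w)"
    unfolding mf using component_le_opnorm[of "diag2 (a ^ n) (b ^ n)" 1 1] component_le_opnorm[of "diag2 (a ^ n) (b ^ n)" 2 2]
    by (simp_all only: diag2_nth)
  then have opf: "M ^ n \<le> opnorm (mprod f w)" unfolding M_def max_def by (simp add: power_abs)
  have og: "0 < opnorm (mprod g w)" "opnorm (mprod g w) \<le> 2"
    using opnorm_pos[OF det_nonzero_imp_nonzero[OF nz(2)]] opnorm_rotation2 by (simp_all only: mg)
  have og2: "(opnorm (mprod g w))\<^sup>2 \<le> 4" using power_mono[OF og(2), of 2] og(1) by simp
  define k where "k = (M / m) ^ n / 4"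
  have k: "0 < k" unfolding k_def using Mm by simp
  have "k * ((opnorm (mprod g w))\<^sup>2 * \<bar>det (mprod f w)\<bar>) \<le> k * (4 * (M * m) ^ n)"
    unfolding detf using k og2 Mm by (intro mult_left_mono mult_right_mono) simp_all
  also have "\<dots> = (M / m * (M * m)) ^ n" unfolding k_def power_mult_distrib[of "M / m"] by simp
  also have "\<dots> = (M ^ n)\<^sup>2" using Mm by (simp add: power2_eq_square power_mult_distrib)
  also have "\<dots> \<le> (opnorm (mprod f w))\<^sup>2" using Mm by (intro power_mono[OF opf]) simp
  finally have "k * ((opnorm (mprod g w))\<^sup>2 * \<bar>det (mprod f w)\<bar>) \<le> (opnorm (mprod f w))\<^sup>2 * \<bar>det (mprod g w)\<bar>"
    unfolding detg by simp
  from factor_potential_dominates[OF s nz less_imp_le[OF k] this]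
  have dom: "k powr \<tau> * factor_potential s (mprod g w) (mprod f w) \<le> factor_potential s (mprod f w) (mprod g w)"
    unfolding \<tau>_def .
  have "C < \<bar>C\<bar> + 1" by simp
  also have "\<dots> = ((\<bar>C\<bar> + 1) powr (1 / \<tau>)) powr \<tau>" using \<tau> by (simp add: powr_powr)
  also have "\<dots> \<le> k powr \<tau>" using \<tau> n by (intro powr_mono2) (simp_all add: k_def)
  finally have "C < k powr \<tau>" .
  then have "C * factor_potential s (mprod g w) (mprod f w) < k powr \<tau> * factor_potential s (mprod g w) (mprod f w)"
    using factor_potential_pos[OF nz(2,1)] by (rule mult_strict_right_mono)
  then have "C * factor_potential s (mprod g w) (mprod f w) < factor_potential s (mprod f w) (mprod g w)"
    using dom by (rule less_le_trans)
  then show ?thesis using w by blast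
qed

section \<open>Exchange of the letters, pressure and energy of the maximum\<close>

text \<open>Subtraction from 3 exchanges the letters 1 and 2. It is an involution there but not on
  all naturals, where subtraction is truncated.\<close>

lemma sum_words_swap: "(\<Sum>w\<in>words 2 n. h w) = (\<Sum>w\<in>words 2 n. h (map (\<lambda>i. 3 - i) w))"
proof (rule sum.reindex_bij_witness[of _ "map (\<lambda>i. 3 - i)" "map (\<lambda>i. 3 - i)"])
  have range: "3 - i \<in> {1..2} \<and> 3 - (3 - i) = i" if "w \<in> words 2 n" "i \<in> set w" for w and i :: nat
  proof -
    have "i \<in> {1..2}" using that by (auto simp: words_def)
    then show ?thesis by auto
  qed
  fix w assume w: "w \<in> words 2 n"
  show inv: "map (\<lambda>i. 3 - i) (map (\<lambda>i. 3 - i) w) = w"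
    unfolding map_map by (rule map_idI) (use range[OF w] in simp)
  then show "map (\<lambda>i. 3 - i) (map (\<lambda>i. 3 - i) w) = w" .
  show "map (\<lambda>i. 3 - i) w \<in> words 2 n"
    using w range[OF w] by (simp add: words_def image_subset_iff)
  then show "map (\<lambda>i. 3 - i) w \<in> words 2 n" .
  show "h (map (\<lambda>i. 3 - i) (map (\<lambda>i. 3 - i) w)) = h w" unfolding inv ..
qed

text \<open>Connects the two encodings of words: extensional functions in \<open>pressure\<close>,
  lists everywhere else.\<close>

lemma bij_betw_init_word: "bij_betw (init_word n) ({..<n} \<rightarrow>\<^sub>E {1..N}) (words N n)"
proof (rule bij_betw_byWitness[where f' = "\<lambda>w i. if i < n then w ! i else undefined"])
  show "\<forall>x\<in>{..<n} \<rightarrow>\<^sub>E {1..N}. (\<lambda>i. if i < n then init_word n x ! i else undefined) = x"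
  proof
    fix x assume x: "x \<in> {..<n} \<rightarrow>\<^sub>E {1..N}"
    show "(\<lambda>i. if i < n then init_word n x ! i else undefined) = x"
    proof
      fix i show "(if i < n then init_word n x ! i else undefined) = x i"
        using PiE_arb[OF x, of i] by (simp add: init_word_def)
    qed
  qed
  show "\<forall>w\<in>words N n. init_word n (\<lambda>i. if i < n then w ! i else undefined) = w"
  proof
    fix w assume "w \<in> words N n"
    then have "length w = n" by (simp add: words_def)
    then show "init_word n (\<lambda>i. if i < n then w ! i else undefined) = w"
      unfolding init_word_def by (intro nth_equalityI) simp_all
  qed
  show "init_word n ` ({..<n} \<rightarrow>\<^sub>E {1..N}) \<subseteq> words N n"
  proof (rule image_subsetI)
    fix x assume x: "x \<in> {..<n} \<rightarrow>\<^sub>E {1..N}"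
    have "x i \<in> {1..N}" if "i \<in> {..<n}" for i by (rule PiE_mem[OF x that])
    then show "init_word n x \<in> words N n" by (simp add: words_def init_word_def image_subset_iff)
  qed
  show "(\<lambda>w i. if i < n then w ! i else undefined) ` words N n \<subseteq> {..<n} \<rightarrow>\<^sub>E {1..N}"
  proof (rule image_subsetI)
    fix w assume "w \<in> words N n"
    then have w: "set w \<subseteq> {1..N}" "length w = n" by (simp_all add: words_def)
    then have "w ! i \<in> {1..N}" if "i < n" for i using nth_mem[of i w] that by blast
    then show "(\<lambda>i. if i < n then w ! i else undefined) \<in> {..<n} \<rightarrow>\<^sub>E {1..N}" by (intro PiE_I) simp_all
  qed
qed

text \<open>The maximum lies between \<open>F\<close> and \<open>F + G\<close>, whose sums over
  words are \<open>Z n\<close> and \<open>2 * Z n\<close>; the factor 2 vanishes in the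
  limit.\<close>

lemma pressure_max:
  assumes F: "quasi_multiplicative N F" and G: "\<And>n w. w \<in> words N n \<Longrightarrow> 0 < G w"
    and Z: "\<And>n. (\<Sum>w\<in>words N n. F w) = (\<Sum>w\<in>words N n. G w)"
    and sv: "\<And>n w. w \<in> words N n \<Longrightarrow> sv_function s (mprod A w) = max (F w) (G w)"
  shows "pressure s N A = quasi_multiplicative.press N F"
proof -
  interpret F: quasi_multiplicative N F by (rule F)
  define S where "S = (\<lambda>n. \<Sum>w\<in>words N n. max (F w) (G w))"
  have eq: "(\<Sum>x\<in>{..<n} \<rightarrow>\<^sub>E {1..N}. sv_function s (word_product A x n)) = S n" for n
  proof -
    have "(\<Sum>x\<in>{..<n} \<rightarrow>\<^sub>E {1..N}. sv_function s (word_product A x n)) = (\<Sum>w\<in>words N n. sv_function s (mprod A w))"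
      unfolding word_product_eq by (rule sum.reindex_bij_betw[OF bij_betw_init_word, of "\<lambda>w. sv_function s (mprod A w)"])
    also have "\<dots> = S n" unfolding S_def by (rule sum.cong[OF refl]) (rule sv)
    finally show ?thesis .
  qed
  have lo: "F.Z n \<le> S n" for n unfolding F.Z_def S_def by (intro sum_mono) simp
  have hi: "S n \<le> 2 * F.Z n" for n
  proof -
    have "S n \<le> (\<Sum>w\<in>words N n. F w + G w)" unfolding S_def
      using F.pos G by (intro sum_mono) (simp add: less_imp_le)
    also have "\<dots> = 2 * F.Z n" unfolding sum.distrib Z[symmetric] F.Z_def by simp
    finally show ?thesis .
  qed
  have "(\<lambda>n. ln (S n) / real n) \<longlonglongrightarrow> F.press"
  proof (rule tendsto_sandwich[OF _ _ F.press_LIMSEQ])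
    show "(\<lambda>n. ln 2 / real n + ln (F.Z n) / real n) \<longlonglongrightarrow> F.press"
      using tendsto_add[OF lim_const_over_n F.press_LIMSEQ] by simp
    have "ln (F.Z n) / real n \<le> ln (S n) / real n" for n
      using lo[of n] F.Z_pos[of n] by (intro divide_right_mono) simp_all
    then show "\<forall>\<^sub>F n in sequentially. ln (F.Z n) / real n \<le> ln (S n) / real n" by simp
    have "ln (S n) / real n \<le> ln 2 / real n + ln (F.Z n) / real n" for n
    proof -
      have "ln (S n) \<le> ln (2 * F.Z n)" using hi[of n] lo[of n] F.Z_pos[of n] by simp
      also have "\<dots> = ln 2 + ln (F.Z n)" using F.Z_pos[of n] by (simp add: ln_mult)
      finally show ?thesis unfolding add_divide_distrib[symmetric] by (rule divide_right_mono) simp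
    qed
    then show "\<forall>\<^sub>F n in sequentially. ln (S n) / real n \<le> ln 2 / real n + ln (F.Z n) / real n" by simp
  qed
  then show ?thesis unfolding pressure_def eq by (rule limI)
qed

lemma (in shift_invariant) sv_energy_eq:
  assumes sv: "\<And>n w. w \<in> words N n \<Longrightarrow> sv_function s (mprod A w) = \<phi> w"
  shows "sv_energy s A \<mu> = energy \<phi>"
proof -
  have "(\<integral>x. ln (sv_function s (word_product A x n)) \<partial>\<mu>) = energy_sum \<phi> n" for n
  proof -
    have "(\<integral>x. ln (sv_function s (word_product A x n)) \<partial>\<mu>) =
        (\<Sum>w\<in>words N n. prob (cyl N w) * ln (sv_function s (mprod A w)))"
      unfolding word_product_eq by (rule integral_init_word[of "\<lambda>w. ln (sv_function s (mprod A w))"])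
    also have "\<dots> = energy_sum \<phi> n" unfolding energy_sum_def
      by (rule sum.cong[OF refl]) (simp only: sv)
    finally show ?thesis .
  qed
  then show ?thesis unfolding sv_energy_def energy_def by (simp only:)
qed

theorem theorem1:
  fixes \<alpha>1 \<alpha>2 \<theta> :: real and A :: "nat \<Rightarrow> real ^ 4 ^ 4"
  assumes "\<alpha>1 \<noteq> 0" and "\<alpha>2 \<noteq> 0" and "\<bar>\<alpha>1\<bar> \<noteq> \<bar>\<alpha>2\<bar>"
    and "\<theta> \<notin> range (\<lambda>k::int. pi / 2 * of_int k)"
    and "A 1 = block_matrix (diag2 \<alpha>1 \<alpha>2 \<otimes>\<^sub>K rotation2 \<theta>)"
    and "A 2 = block_matrix (rotation2 \<theta> \<otimes>\<^sub>K diag2 \<alpha>1 \<alpha>2)"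
  shows "strongly_irreducible 2 A \<and>
    (\<forall>s. 1 < s \<and> s < 3 \<longrightarrow>
       card {\<mu>. ergodic_measure 2 \<mu> \<and> equilibrium_state s 2 A \<mu>} = 2 \<and>
       (\<forall>\<mu>. ergodic_measure 2 \<mu> \<and> equilibrium_state s 2 A \<mu> \<longrightarrow> fully_supported 2 \<mu>))"
proof (intro conjI allI impI)
  define D R where "D = diag2 \<alpha>1 \<alpha>2" and "R = rotation2 \<theta>"
  have \<theta>: "\<theta> \<noteq> pi / 2 * of_int k" for k :: int
  proof
    assume "\<theta> = pi / 2 * of_int k"
    then have "\<theta> \<in> range (\<lambda>k::int. pi / 2 * of_int k)" by (rule range_eqI)
    then show False using assms(4) by (rule notE[rotated])
  qed
  have "cos \<theta> \<noteq> 0"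
  proof
    assume "cos \<theta> = 0"
    then obtain k :: int where "\<theta> = of_int k * (pi / 2)" unfolding cos_zero_iff_int by blast
    then show False using \<theta>[of k] by (simp add: mult.commute)
  qed
  moreover have "sin \<theta> \<noteq> 0"
  proof
    assume "sin \<theta> = 0"
    then obtain k :: int where "\<theta> = of_int k * (pi / 2)" unfolding sin_zero_iff_int by blast
    then show False using \<theta>[of k] by (simp add: mult.commute)
  qed
  ultimately have cs: "cos \<theta> * sin \<theta> \<noteq> 0" by simp
  have A: "A 1 = kron D R" "A 2 = kron R D"
    unfolding kron_def D_def R_def by (rule assms)+
  show irr: "strongly_irreducible 2 A"
    by (rule kron_pair_strongly_irreducible[OF assms(1-3) cs A[unfolded D_def R_def]])
  \<comment> \<open>Both generators take the form \<open>kron (f i) (g i)\<close>, and exchanging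
    the letters 1 and 2 exchanges \<open>f\<close> and \<open>g\<close>.\<close>
  define f g where "f = (\<lambda>i::nat. if i = 1 then D else R)" and "g = (\<lambda>i::nat. if i = 1 then R else D)"
  have two: "i = 1 \<or> i = 2" if "i \<in> {1..2}" for i :: nat using that by auto
  have A_kron: "A i = kron (f i) (g i)" if "i \<in> {1..2}" for i
    using two[OF that] by (elim disjE) (simp_all add: f_def g_def A[unfolded One_nat_def])
  have detD: "det D \<noteq> 0" and detR: "det R \<noteq> 0"
    unfolding D_def R_def det_diag2 det_rotation2 using assms by simp_all
  have dets: "det (f i) \<noteq> 0" "det (g i) \<noteq> 0" if "i \<in> {1..2}" for i
    by (simp_all add: f_def g_def detD detR)
  have conn: "connecting 2 f g"
    by (rule strongly_irreducible_imp_connecting[OF _ dets irr A_kron]) simp_all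
  have swap: "mprod f (map (\<lambda>i. 3 - i) w) = mprod g w" "mprod g (map (\<lambda>i. 3 - i) w) = mprod f w"
    if w: "w \<in> words 2 n" for w n
  proof -
    have fg: "f (3 - i) = g i \<and> g (3 - i) = f i" if "i \<in> set w" for i
    proof -
      have "i \<in> {1..2}" using that w by (auto simp: words_def)
      from two[OF this] show ?thesis by (elim disjE) (simp_all add: f_def g_def)
    qed
    show "mprod f (map (\<lambda>i. 3 - i) w) = mprod g w"
      unfolding mprod_map by (rule mprod_cong) (rule fg[THEN conjunct1])
    show "mprod g (map (\<lambda>i. 3 - i) w) = mprod f w"
      unfolding mprod_map by (rule mprod_cong) (rule fg[THEN conjunct2])
  qed
  fix s :: real assume "1 < s \<and> s < 3"
  then have s: "1 < s" "s < 3" by simp_all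
  define F G where "F = (\<lambda>w. factor_potential s (mprod f w) (mprod g w))"
    and "G = (\<lambda>w. factor_potential s (mprod g w) (mprod f w))"
  have F: "quasi_multiplicative 2 F" unfolding F_def
    by (rule quasi_multiplicative_factor_potential[OF _ dets conn s]) simp_all
  have G: "quasi_multiplicative 2 G" unfolding G_def
    by (rule quasi_multiplicative_factor_potential[OF _ dets(2) dets(1) connecting_sym[OF conn] s]) simp_all
  interpret F: quasi_multiplicative 2 F by (rule F)
  interpret G: quasi_multiplicative 2 G by (rule G)
  \<comment> \<open>Relabelling the letters turns \<open>F\<close> into \<open>G\<close>, so the
    partition functions agree at every length.\<close>
  have Z: "(\<Sum>w\<in>words 2 n. F w) = (\<Sum>w\<in>words 2 n. G w)" for n
    unfolding sum_words_swap[of F] by (rule sum.cong[OF refl]) (simp only: F_def G_def swap)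
  have sv: "sv_function s (mprod A w) = max (F w) (G w)" if w: "w \<in> words 2 n" for n w
  proof -
    have eq: "mprod A w = kron (mprod f w) (mprod g w)"
      using w by (intro mprod_kron A_kron) (auto simp: words_def)
    have d: "det (mprod f w) \<noteq> 0" "det (mprod g w) \<noteq> 0"
      by (rule det_mprod_nonzero[OF _ dets w]; simp)+
    show ?thesis unfolding F_def G_def eq by (rule sv_function_kron[OF d s])
  qed
  have unbounded: "\<exists>n. \<exists>w\<in>words 2 n. C * G w < F w" for C
    unfolding F_def G_def
    by (rule factor_potential_unbounded[OF assms(1-3) s, of 1]) (simp_all add: f_def g_def D_def R_def)
  have "\<exists>\<mu> \<nu>. \<mu> \<noteq> \<nu> \<and> fully_supported 2 \<mu> \<and> fully_supported 2 \<nu> \<and>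
      {\<rho>. ergodic_measure 2 \<rho> \<and> shift_invariant.entropy \<rho> +
        shift_invariant.energy 2 \<rho> (\<lambda>w. max (F w) (G w)) = F.press} = {\<mu>, \<nu>}"
    (is "\<exists>\<mu> \<nu>. ?P \<mu> \<nu>")
    by (rule equilibrium_states_max[OF F G Z unbounded])
  then obtain \<mu> where "\<exists>\<nu>. ?P \<mu> \<nu>" by (rule exE)
  then obtain \<nu> where P: "?P \<mu> \<nu>" by (rule exE)
  note states = P[THEN conjunct2, THEN conjunct2, THEN conjunct2]
  \<comment> \<open>Pressure, entropy and energy are now all expressed through sums over words, so
    the definition of an equilibrium state becomes the equation solved by
    \<open>equilibrium_states_max\<close>.\<close>
  have "equilibrium_state s 2 A \<rho> \<longleftrightarrow>
      shift_invariant.entropy \<rho> + shift_invariant.energy 2 \<rho> (\<lambda>w. max (F w) (G w)) = F.press"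
    if erg: "ergodic_measure 2 \<rho>" for \<rho>
  proof -
    have inv: "invariant_measure 2 \<rho>" using erg by (simp add: ergodic_measure_def)
    interpret \<rho>: shift_invariant 2 \<rho> by unfold_locales (rule inv)
    have "pressure s 2 A = F.press"
      by (rule pressure_max[OF F _ Z]; (erule G.pos | erule sv))
    moreover have "sv_energy s A \<rho> = \<rho>.energy (\<lambda>w. max (F w) (G w))"
      by (rule \<rho>.sv_energy_eq) (erule sv)
    ultimately show ?thesis
      unfolding equilibrium_state_def \<rho>.ks_entropy_eq using inv by auto
  qed
  then have "{\<rho>. ergodic_measure 2 \<rho> \<and> equilibrium_state s 2 A \<rho>} =
      {\<rho>. ergodic_measure 2 \<rho> \<and> shift_invariant.entropy \<rho> +
        shift_invariant.energy 2 \<rho> (\<lambda>w. max (F w) (G w)) = F.press}"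
    by (intro Collect_cong conj_cong refl)
  then have eq: "{\<rho>. ergodic_measure 2 \<rho> \<and> equilibrium_state s 2 A \<rho>} = {\<mu>, \<nu>}" unfolding states .
  show "card {\<rho>. ergodic_measure 2 \<rho> \<and> equilibrium_state s 2 A \<rho>} = 2"
    unfolding eq using P[THEN conjunct1] by simp
  show "fully_supported 2 \<rho>" if "ergodic_measure 2 \<rho> \<and> equilibrium_state s 2 A \<rho>" for \<rho>
  proof -
    have "\<rho> \<in> {\<mu>, \<nu>}" unfolding eq[symmetric] using that by simp
    then show ?thesis using P[THEN conjunct2, THEN conjunct1] P[THEN conjunct2, THEN conjunct2, THEN conjunct1]
      by (elim insertE emptyE) simp_all
  qed
qed


end
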